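(* Let $M^6$ be a 6-manifold with an $\mathrm{SU}(3)$-structure $(\omega,\psi_\pm)$ with torsion forms $\pi_0,\sigma_0,\pi_1,\nu_1,\pi_2,\sigma_2,\nu_3$, let $f$ be a non-vanishing smooth function on $M^6$, let $\alpha,\beta\in\mathbb R$ with $\alpha^2+\beta^2=1$, and let $M^7=M^6\times_f S^1$ be endowed with the warped $\mathrm{G}_2$-structure $\varphi=f\,\omega\wedge ds+(\alpha\psi_+-\beta\psi_-)$. Then the torsion forms $\tau_0,\tau_1,\tau_2,\tau_3$ of $\varphi$ are given by $$\tau_0=\tfrac{12}{7}(\alpha\pi_0-\beta\sigma_0),$$ $$\tau_1=\tfrac12(\alpha\sigma_0+\beta\pi_0)f\,ds+\tfrac16\eta_1,$$ $$\tau_2=-\alpha\sigma_2-\beta\pi_2+\tfrac{f}{3}\ast_6(\eta_2\wedge\omega^2)\wedge ds-\tfrac13\ast_6\big(\eta_2\wedge(\alpha\psi_-+\beta\psi_+)\big),$$ $$\tau_3=\Big[\tfrac27(\alpha\pi_0-\beta\sigma_0)f\omega-\tfrac f2\ast_6\big(\eta_3\wedge(\alpha\psi_+-\beta\psi_-)\big)+f(\alpha\pi_2-\beta\sigma_2)\Big]\wedge ds-\tfrac12\ast_6(\eta_3\wedge\omega)-\tfrac{3}{14}(\alpha\pi_0-\beta\sigma_0)(\alpha\psi_+-\beta\psi_-)-\ast_6\nu_3,$$ where $$\eta_1=\tfrac1f d_6f+\pi_1+\nu_1,\qquad \eta_2=\tfrac1f d_6f+\pi_1-2\nu_1,\qquad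 \eta_3=\tfrac1f d_6f-\pi_1+\nu_1.$$
   Context: $\mathrm{SU}(3)$-structures. An $\mathrm{SU}(3)$-structure on a 6-manifold $M^6$ is a triple $(\omega,\psi_+,\psi_-)$ of a 2-form and two 3-forms such that locally there is a coframe $\{e^1,\dots,e^6\}$ (an adapted basis) with $\omega=e^{12}+e^{34}+e^{56}$, $\psi_+=e^{135}-e^{146}-e^{236}-e^{245}$, $\psi_-=-e^{246}+e^{235}+e^{145}+e^{136}$, where $e^{ij}=e^i\wedge e^j$, etc. The induced metric $g_{\omega,\psi_\pm}$ is the one for which adapted bases are orthonormal, the volume form is $vol_6=\frac1{3!}\omega^3=e^{123456}$, and $\ast_6$ is the corresponding Hodge star. $d_6$ denotes the exterior derivative on $M^6$. Put $\Omega^2_8(M^6)=\{\sigma\in\Omega^2(M^6):\sigma\wedge\psi_+=0,\ \ast_6\sigma=-\sigma\wedge\omega\}$ and $\Omega^3_{12}(M^6)=\{\gamma\in\Omega^3(M^6):\gamma\wedge\omega=0,\ \gamma\wedge\psi_\pm=0\}$. The torsion forms are the functions $\sigma_0,\pi_0$, 1-forms $\pi_1,\nu_1$, 2-forms $\pi_2,\sigma_2\in\Omega^2_8(M^6)$ and 3-form $\nu_3\in\Omega^3_{12}(M^6)$ determined by $$d\omega=-\tfrac32\sigma_0\psi_++\tfrac32\pi_0\psi_-+\nu_1\wedge\omega+\nu_3,\quad d\psi_+=\pi_0\omega^2+\pi_1\wedge\psi_+-\pi_2\wedge\omega,\quad d\psi_-=\sigma_0\omega^2+\pi_1\wedge\psi_--\sigma_2\wedge\omega.$$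 Warped $\mathrm{G}_2$-structures. $s$ is the coordinate on $S^1$. The 3-form $\varphi=f\,\omega\wedge ds+(\alpha\psi_+-\beta\psi_-)$ on $M^6\times S^1$ is a $\mathrm{G}_2$-structure with metric $g_\varphi=g_{\omega,\psi_\pm}+f^2ds^2$ and volume form $vol_7=f\,vol_6\wedge ds$; $\ast_7$ is the corresponding Hodge star. One has $\ast_7\varphi=\frac12\omega^2+f(\alpha\psi_-+\beta\psi_+)\wedge ds$. $M^6\times_f S^1$ denotes $M^6\times S^1$ with this warped metric. $\mathrm{G}_2$ torsion forms. Put $\Omega^2_{14}(M^7)=\{\sigma\in\Omega^2(M^7):\sigma\wedge\varphi=-\ast_7\sigma\}$ and $\Omega^3_{27}(M^7)=\{\gamma\in\Omega^3(M^7):\gamma\wedge\varphi=\gamma\wedge\ast_7\varphi=0\}$. The torsion forms of $\varphi$ are the unique $\tau_0\in C^\infty(M^7)$, $\tau_1\in\Omega^1(M^7)$, $\tau_2\in\Omega^2_{14}(M^7)$, $\tau_3\in\Omega^3_{27}(M^7)$ with $d\varphi=\tau_0\ast_7\varphi+3\tau_1\wedge\varphi+\ast_7\tau_3$ and $d(\ast_7\varphi)=4\tau_1\wedge\ast_7\varphi+\tau_2\wedge\varphi$. *)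

theory Defs
  imports "HOL-Analysis.Analysis" "HOL-Library.Function_Algebras"
begin

text \<open>Addition, subtraction, negation and zero of forms are the pointwise operations on functions
  provided by \<^theory>\<open>HOL-Library.Function_Algebras\<close>.\<close>

section \<open>Multilinear algebra at a point\<close>

text \<open>An exterior form on \<open>'v\<close> is a function on argument lists; an alternating \<open>k\<close>-form is
  extended by zero to the lists whose length is not \<open>k\<close>.\<close>

type_synonym 'v mform = "'v list \<Rightarrow> real"

definition alternating :: "nat \<Rightarrow> 'v::real_vector mform \<Rightarrow> bool" where
  "alternating k A \<longleftrightarrow>
     (\<forall>vs. length vs \<noteq> k \<longrightarrow> A vs = 0) \<and>
     (\<forall>us ws. length us + 1 + length ws = k \<longrightarrow> linear (\<lambda>v. A (us @ v # ws))) \<and>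
     (\<forall>vs. length vs = k \<and> \<not> distinct vs \<longrightarrow> A vs = 0)"

text \<open>The shuffle formula for the exterior product. The set \<open>I\<close> holds the positions of the arguments
  passed to the first factor; for a \<open>k\<close>-form \<open>A\<close> only the sets with \<open>k\<close> elements contribute. The
  exponent is the number of inversions of the shuffle. In particular
  \<open>(a \<^bold>\<and> b) [u, v] = a [u] * b [v] - a [v] * b [u]\<close> for 1-forms.\<close>

definition mwedge :: "'v mform \<Rightarrow> 'v mform \<Rightarrow> 'v mform" (infixr "\<^bold>\<and>" 70) where
  "(A \<^bold>\<and> B) vs =
     (\<Sum>I\<in>Pow {..<length vs}.
        (- 1) ^ card {(i, j). i \<in> I \<and> j \<in> {..<length vs} - I \<and> j < i}
        * A (nths vs I) * B (nths vs ({..<length vs} - I)))"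

definition orthonormal_basis :: "('v::euclidean_space \<Rightarrow> 'v \<Rightarrow> real) \<Rightarrow> 'v set \<Rightarrow> bool" where
  "orthonormal_basis g B \<longleftrightarrow>
     finite B \<and> independent B \<and> span B = UNIV \<and>
     (\<forall>u\<in>B. \<forall>v\<in>B. g u v = (if u = v then 1 else 0))"

text \<open>The Hodge star of the inner product \<open>g\<close> and the volume form \<open>vol\<close>, in the index form
  \<open>(\<ast>A)\<^bsub>j\<dots>\<^esub> = 1/k! A\<^bsup>i\<dots>\<^esup> vol\<^bsub>i\<dots>j\<dots>\<^esub>\<close> with \<open>k\<close> the degree of \<open>A\<close>. This is the convention
  \<open>A \<and> \<ast>B = \<langle>A, B\<rangle> vol\<close>. The value does not depend on the orthonormal basis.\<close>

definition hodge ::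
    "('v::euclidean_space \<Rightarrow> 'v \<Rightarrow> real) \<Rightarrow> 'v mform \<Rightarrow> 'v mform \<Rightarrow> 'v mform" where
  "hodge g vol A vs =
     (let B = (SOME B. orthonormal_basis g B); k = DIM('v) - length vs
      in if length vs \<le> DIM('v)
         then (\<Sum>es\<in>{es. set es \<subseteq> B \<and> length es = k}. A es * vol (es @ vs)) / fact k
         else 0)"

section \<open>Smooth manifolds\<close>

primrec C_diff_on ::
    "nat \<Rightarrow> 'a::real_normed_vector set \<Rightarrow> ('a \<Rightarrow> 'b::real_normed_vector) \<Rightarrow> bool" where
  "C_diff_on 0 S f \<longleftrightarrow> continuous_on S f"
| "C_diff_on (Suc n) S f \<longleftrightarrow>
     (\<forall>x\<in>S. f differentiable (at x)) \<and> (\<forall>v. C_diff_on n S (\<lambda>x. frechet_derivative f (at x) v))"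

text \<open>Used for open \<open>S\<close> only.\<close>

definition smooth_on ::
    "'a::real_normed_vector set \<Rightarrow> ('a \<Rightarrow> 'b::real_normed_vector) \<Rightarrow> bool" where
  "smooth_on S f \<longleftrightarrow> (\<forall>n. C_diff_on n S f)"

text \<open>A manifold modelled on \<open>'v\<close> is given by its topology and an indexed atlas.\<close>

record ('i, 'p, 'v) manifold =
  mf_top :: "'p topology"
  mf_idx :: "'i set"
  mf_dom :: "'i \<Rightarrow> 'p set"
  mf_map :: "'i \<Rightarrow> 'p \<Rightarrow> 'v"

abbreviation mf_points :: "('i, 'p, 'v) manifold \<Rightarrow> 'p set" where
  "mf_points M \<equiv> topspace (mf_top M)"

definition mf_img :: "('i, 'p, 'v) manifold \<Rightarrow> 'i \<Rightarrow> 'v set" where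
  "mf_img M i = mf_map M i ` mf_dom M i"

definition mf_inv :: "('i, 'p, 'v) manifold \<Rightarrow> 'i \<Rightarrow> 'v \<Rightarrow> 'p" where
  "mf_inv M i = inv_into (mf_dom M i) (mf_map M i)"

definition smooth_manifold :: "('i, 'p, 'v::euclidean_space) manifold \<Rightarrow> bool" where
  "smooth_manifold M \<longleftrightarrow>
     Hausdorff_space (mf_top M) \<and> second_countable (mf_top M) \<and>
     (\<Union>i\<in>mf_idx M. mf_dom M i) = mf_points M \<and>
     (\<forall>i\<in>mf_idx M.
        openin (mf_top M) (mf_dom M i) \<and> open (mf_img M i) \<and>
        homeomorphic_map (subtopology (mf_top M) (mf_dom M i)) (top_of_set (mf_img M i))
          (mf_map M i)) \<and>
     (\<forall>i\<in>mf_idx M. \<forall>j\<in>mf_idx M.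
        smooth_on (mf_map M i ` (mf_dom M i \<inter> mf_dom M j)) (mf_map M j \<circ> mf_inv M i))"

definition smooth_fun :: "('i, 'p, 'v::euclidean_space) manifold \<Rightarrow> ('p \<Rightarrow> real) \<Rightarrow> bool" where
  "smooth_fun M f \<longleftrightarrow> (\<forall>i\<in>mf_idx M. smooth_on (mf_img M i) (f \<circ> mf_inv M i))"

section \<open>Differential forms\<close>

text \<open>\<open>\<omega> i p\<close> is the value at the point \<open>p\<close> of the form \<open>\<omega>\<close>, expressed in the trivialisation of the
  tangent space at \<open>p\<close> by the chart \<open>i\<close>. It is meaningful only for \<open>i \<in> mf_idx M\<close> and
  \<open>p \<in> mf_dom M i\<close>, so equality of forms on \<open>M\<close> is \<open>form_eq\<close>. The representatives in two charts
  must be related by the derivative of the transition map.\<close>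

type_synonym ('i, 'p, 'v) dform = "'i \<Rightarrow> 'p \<Rightarrow> 'v mform"

definition form_eq ::
    "('i, 'p, 'v) dform \<Rightarrow> ('i, 'p, 'v) manifold \<Rightarrow> ('i, 'p, 'v) dform \<Rightarrow> bool"
    ("_ \<doteq>\<^bsub>_\<^esub> _" [51, 0, 51] 50) where
  "\<omega> \<doteq>\<^bsub>M\<^esub> \<eta> \<longleftrightarrow> (\<forall>i\<in>mf_idx M. \<forall>p\<in>mf_dom M i. \<omega> i p = \<eta> i p)"

definition dforms ::
    "('i, 'p, 'v::euclidean_space) manifold \<Rightarrow> nat \<Rightarrow> ('i, 'p, 'v) dform set" where
  "dforms M k =
     {\<omega>. (\<forall>i\<in>mf_idx M. \<forall>p\<in>mf_dom M i. alternating k (\<omega> i p)) \<and>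
         (\<forall>i\<in>mf_idx M. \<forall>j\<in>mf_idx M. \<forall>p\<in>mf_dom M i \<inter> mf_dom M j. \<forall>vs.
            \<omega> i p vs =
            \<omega> j p (map (frechet_derivative (mf_map M j \<circ> mf_inv M i) (at (mf_map M i p))) vs)) \<and>
         (\<forall>i\<in>mf_idx M. \<forall>vs. smooth_on (mf_img M i) (\<lambda>x. \<omega> i (mf_inv M i x) vs))}"

definition zero_form :: "('p \<Rightarrow> real) \<Rightarrow> ('i, 'p, 'v) dform" where
  "zero_form f i p vs = (if vs = [] then f p else 0)"

definition fun_scale ::
    "('p \<Rightarrow> real) \<Rightarrow> ('i, 'p, 'v) dform \<Rightarrow> ('i, 'p, 'v) dform" (infixr "\<cdot>\<^sub>f" 75) where
  "(f \<cdot>\<^sub>f \<omega>) i p vs = f p * \<omega> i p vs"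

definition const_scale ::
    "real \<Rightarrow> ('i, 'p, 'v) dform \<Rightarrow> ('i, 'p, 'v) dform" (infixr "*\<^sub>f" 75) where
  "(c *\<^sub>f \<omega>) i p vs = c * \<omega> i p vs"

definition wedge ::
    "('i, 'p, 'v) dform \<Rightarrow> ('i, 'p, 'v) dform \<Rightarrow> ('i, 'p, 'v) dform" (infixr "\<and>\<^sub>f" 70) where
  "(\<omega> \<and>\<^sub>f \<eta>) i p = \<omega> i p \<^bold>\<and> \<eta> i p"

text \<open>In each chart, \<open>(d\<omega>) (v\<^sub>0, \<dots>, v\<^sub>k) = \<Sum>l. (-1)\<^sup>l D\<omega>(\<dots>, v\<^sub>l omitted, \<dots>) v\<^sub>l\<close> for constant vector
  fields \<open>v\<^sub>l\<close>.\<close>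

definition ext_d ::
    "('i, 'p, 'v::euclidean_space) manifold \<Rightarrow> ('i, 'p, 'v) dform \<Rightarrow> ('i, 'p, 'v) dform" where
  "ext_d M \<omega> i p vs =
     (\<Sum>l<length vs. (- 1) ^ l *
        frechet_derivative (\<lambda>x. \<omega> i (mf_inv M i x) (take l vs @ drop (Suc l) vs))
          (at (mf_map M i p)) (vs ! l))"

text \<open>A metric assigns to \<open>i\<close> and \<open>p\<close> the inner product on the tangent space at \<open>p\<close> in the
  trivialisation by the chart \<open>i\<close>.\<close>

type_synonym ('i, 'p, 'v) metric = "'i \<Rightarrow> 'p \<Rightarrow> 'v \<Rightarrow> 'v \<Rightarrow> real"

definition star ::
    "('i, 'p, 'v::euclidean_space) metric \<Rightarrow> ('i, 'p, 'v) dform \<Rightarrow> ('i, 'p, 'v) dform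
     \<Rightarrow> ('i, 'p, 'v) dform" where
  "star g vol \<omega> i p = hodge (g i p) (vol i p) (\<omega> i p)"

section \<open>SU(3)-structures\<close>

definition coframe6 :: "(nat \<Rightarrow> (real^6) mform) \<Rightarrow> bool" where
  "coframe6 e \<longleftrightarrow>
     (\<forall>k\<in>{1..6}. alternating 1 (e k)) \<and> (\<forall>v. (\<forall>k\<in>{1..6}. e k [v] = 0) \<longrightarrow> v = 0)"

definition adapted ::
    "(nat \<Rightarrow> (real^6) mform) \<Rightarrow> (real^6) mform \<Rightarrow> (real^6) mform \<Rightarrow> (real^6) mform \<Rightarrow> bool" where
  "adapted e w a b \<longleftrightarrow>
     coframe6 e \<and>
     w = e 1 \<^bold>\<and> e 2 + e 3 \<^bold>\<and> e 4 + e 5 \<^bold>\<and> e 6 \<and>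
     a = e 1 \<^bold>\<and> e 3 \<^bold>\<and> e 5 - e 1 \<^bold>\<and> e 4 \<^bold>\<and> e 6 - e 2 \<^bold>\<and> e 3 \<^bold>\<and> e 6 - e 2 \<^bold>\<and> e 4 \<^bold>\<and> e 5 \<and>
     b = - (e 2 \<^bold>\<and> e 4 \<^bold>\<and> e 6) + e 2 \<^bold>\<and> e 3 \<^bold>\<and> e 5 + e 1 \<^bold>\<and> e 4 \<^bold>\<and> e 5 + e 1 \<^bold>\<and> e 3 \<^bold>\<and> e 6"

definition su3_structure ::
    "('i, 'p, real^6) manifold \<Rightarrow> ('i, 'p, real^6) dform \<Rightarrow> ('i, 'p, real^6) dform
     \<Rightarrow> ('i, 'p, real^6) dform \<Rightarrow> bool" where
  "su3_structure M \<omega> \<psi>\<^sub>p \<psi>\<^sub>m \<longleftrightarrow>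
     \<omega> \<in> dforms M 2 \<and> \<psi>\<^sub>p \<in> dforms M 3 \<and> \<psi>\<^sub>m \<in> dforms M 3 \<and>
     (\<forall>i\<in>mf_idx M. \<forall>p\<in>mf_dom M i. \<exists>W e.
        openin (mf_top M) W \<and> p \<in> W \<and> W \<subseteq> mf_dom M i \<and>
        (\<forall>k\<in>{1..6}. \<forall>vs. smooth_on (mf_map M i ` W) (\<lambda>x. e (mf_inv M i x) k vs)) \<and>
        (\<forall>q\<in>W. adapted (e q) (\<omega> i q) (\<psi>\<^sub>p i q) (\<psi>\<^sub>m i q)))"

text \<open>The metric for which adapted bases are orthonormal.\<close>

definition su3_metric ::
    "('i, 'p, real^6) dform \<Rightarrow> ('i, 'p, real^6) dform \<Rightarrow> ('i, 'p, real^6) dform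
     \<Rightarrow> ('i, 'p, real^6) metric" where
  "su3_metric \<omega> \<psi>\<^sub>p \<psi>\<^sub>m i p =
     (THE g. \<forall>e. adapted e (\<omega> i p) (\<psi>\<^sub>p i p) (\<psi>\<^sub>m i p) \<longrightarrow>
        g = (\<lambda>u v. \<Sum>k = 1..6. e k [u] * e k [v]))"

definition su3_vol :: "('i, 'p, real^6) dform \<Rightarrow> ('i, 'p, real^6) dform" where
  "su3_vol \<omega> = (1 / fact 3) *\<^sub>f (\<omega> \<and>\<^sub>f \<omega> \<and>\<^sub>f \<omega>)"

definition su3_star ::
    "('i, 'p, real^6) dform \<Rightarrow> ('i, 'p, real^6) dform \<Rightarrow> ('i, 'p, real^6) dform
     \<Rightarrow> ('i, 'p, real^6) dform \<Rightarrow> ('i, 'p, real^6) dform" where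
  "su3_star \<omega> \<psi>\<^sub>p \<psi>\<^sub>m = star (su3_metric \<omega> \<psi>\<^sub>p \<psi>\<^sub>m) (su3_vol \<omega>)"

definition su3_Omega28 ::
    "('i, 'p, real^6) manifold \<Rightarrow> ('i, 'p, real^6) dform \<Rightarrow> ('i, 'p, real^6) dform
     \<Rightarrow> ('i, 'p, real^6) dform \<Rightarrow> ('i, 'p, real^6) dform set" where
  "su3_Omega28 M \<omega> \<psi>\<^sub>p \<psi>\<^sub>m =
     {\<sigma> \<in> dforms M 2. \<sigma> \<and>\<^sub>f \<psi>\<^sub>p \<doteq>\<^bsub>M\<^esub> 0 \<and> su3_star \<omega> \<psi>\<^sub>p \<psi>\<^sub>m \<sigma> \<doteq>\<^bsub>M\<^esub> - (\<sigma> \<and>\<^sub>f \<omega>)}"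

definition su3_Omega312 ::
    "('i, 'p, real^6) manifold \<Rightarrow> ('i, 'p, real^6) dform \<Rightarrow> ('i, 'p, real^6) dform
     \<Rightarrow> ('i, 'p, real^6) dform \<Rightarrow> ('i, 'p, real^6) dform set" where
  "su3_Omega312 M \<omega> \<psi>\<^sub>p \<psi>\<^sub>m =
     {\<gamma> \<in> dforms M 3. \<gamma> \<and>\<^sub>f \<omega> \<doteq>\<^bsub>M\<^esub> 0 \<and> \<gamma> \<and>\<^sub>f \<psi>\<^sub>p \<doteq>\<^bsub>M\<^esub> 0 \<and> \<gamma> \<and>\<^sub>f \<psi>\<^sub>m \<doteq>\<^bsub>M\<^esub> 0}"

definition su3_torsion ::
    "('i, 'p, real^6) manifold \<Rightarrow> ('i, 'p, real^6) dform \<Rightarrow> ('i, 'p, real^6) dform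
     \<Rightarrow> ('i, 'p, real^6) dform \<Rightarrow> ('p \<Rightarrow> real) \<Rightarrow> ('p \<Rightarrow> real)
     \<Rightarrow> ('i, 'p, real^6) dform \<Rightarrow> ('i, 'p, real^6) dform \<Rightarrow> ('i, 'p, real^6) dform
     \<Rightarrow> ('i, 'p, real^6) dform \<Rightarrow> ('i, 'p, real^6) dform \<Rightarrow> bool" where
  "su3_torsion M \<omega> \<psi>\<^sub>p \<psi>\<^sub>m \<pi>\<^sub>0 \<sigma>\<^sub>0 \<pi>\<^sub>1 \<nu>\<^sub>1 \<pi>\<^sub>2 \<sigma>\<^sub>2 \<nu>\<^sub>3 \<longleftrightarrow>
     smooth_fun M \<pi>\<^sub>0 \<and> smooth_fun M \<sigma>\<^sub>0 \<and> \<pi>\<^sub>1 \<in> dforms M 1 \<and> \<nu>\<^sub>1 \<in> dforms M 1 \<and>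
     \<pi>\<^sub>2 \<in> su3_Omega28 M \<omega> \<psi>\<^sub>p \<psi>\<^sub>m \<and> \<sigma>\<^sub>2 \<in> su3_Omega28 M \<omega> \<psi>\<^sub>p \<psi>\<^sub>m \<and>
     \<nu>\<^sub>3 \<in> su3_Omega312 M \<omega> \<psi>\<^sub>p \<psi>\<^sub>m \<and>
     ext_d M \<omega> \<doteq>\<^bsub>M\<^esub> - ((3/2) *\<^sub>f \<sigma>\<^sub>0 \<cdot>\<^sub>f \<psi>\<^sub>p) + (3/2) *\<^sub>f \<pi>\<^sub>0 \<cdot>\<^sub>f \<psi>\<^sub>m + \<nu>\<^sub>1 \<and>\<^sub>f \<omega> + \<nu>\<^sub>3 \<and>
     ext_d M \<psi>\<^sub>p \<doteq>\<^bsub>M\<^esub> \<pi>\<^sub>0 \<cdot>\<^sub>f (\<omega> \<and>\<^sub>f \<omega>) + \<pi>\<^sub>1 \<and>\<^sub>f \<psi>\<^sub>p - \<pi>\<^sub>2 \<and>\<^sub>f \<omega> \<and>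
     ext_d M \<psi>\<^sub>m \<doteq>\<^bsub>M\<^esub> \<sigma>\<^sub>0 \<cdot>\<^sub>f (\<omega> \<and>\<^sub>f \<omega>) + \<pi>\<^sub>1 \<and>\<^sub>f \<psi>\<^sub>m - \<sigma>\<^sub>2 \<and>\<^sub>f \<omega>"

section \<open>The product with the circle\<close>

definition prod_manifold ::
    "('i, 'p, 'v) manifold \<Rightarrow> ('j, 'q, 'w) manifold \<Rightarrow> ('i \<times> 'j, 'p \<times> 'q, 'v \<times> 'w) manifold" where
  "prod_manifold M N =
     \<lparr> mf_top = prod_topology (mf_top M) (mf_top N),
       mf_idx = mf_idx M \<times> mf_idx N,
       mf_dom = (\<lambda>(i, j). mf_dom M i \<times> mf_dom N j),
       mf_map = (\<lambda>(i, j). map_prod (mf_map M i) (mf_map N j)) \<rparr>"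

text \<open>The pullbacks along the two projections.\<close>

definition pull1 :: "('i, 'p, 'v) dform \<Rightarrow> ('i \<times> 'j, 'p \<times> 'q, 'v \<times> 'w) dform" where
  "pull1 \<omega> c x vs = \<omega> (fst c) (fst x) (map fst vs)"

definition pull2 :: "('j, 'q, 'w) dform \<Rightarrow> ('i \<times> 'j, 'p \<times> 'q, 'v \<times> 'w) dform" where
  "pull2 \<omega> c x vs = \<omega> (snd c) (snd x) (map snd vs)"

text \<open>The unit circle with two angular charts, with angles in \<open>(-\<pi>, \<pi>)\<close> and in \<open>(0, 2\<pi>)\<close>. The
  transition maps are locally translations, so the differential \<open>ds\<close> of the angle is a global
  1-form that is the standard one in each chart.\<close>

definition circle :: "(bool, complex, real) manifold" where
  "circle =
     \<lparr> mf_top = top_of_set (sphere 0 1),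
       mf_idx = UNIV,
       mf_dom = (\<lambda>b. sphere 0 1 - {if b then - 1 else 1}),
       mf_map = (\<lambda>b. if b then Arg else Arg2pi) \<rparr>"

definition circle_ds :: "(bool, complex, real) dform" where
  "circle_ds b z vs = (if length vs = 1 then hd vs else 0)"

definition ds :: "('i \<times> bool, 'p \<times> complex, 'v \<times> real) dform" where
  "ds = pull2 circle_ds"

section \<open>Warped G2-structures\<close>

definition warped_metric ::
    "('p \<Rightarrow> real) \<Rightarrow> ('i, 'p, 'v) metric \<Rightarrow> ('i \<times> bool, 'p \<times> complex, 'v \<times> real) metric" where
  "warped_metric f g c x u v =
     g (fst c) (fst x) (fst u) (fst v) + (f (fst x))\<^sup>2 * (snd u * snd v)"

definition warped_vol ::
    "('p \<Rightarrow> real) \<Rightarrow> ('i, 'p, 'v) dform \<Rightarrow> ('i \<times> bool, 'p \<times> complex, 'v \<times> real) dform" where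
  "warped_vol f vol = (f \<circ> fst) \<cdot>\<^sub>f (pull1 vol \<and>\<^sub>f ds)"

definition warped_star ::
    "('p \<Rightarrow> real) \<Rightarrow> ('i, 'p, real^6) dform \<Rightarrow> ('i, 'p, real^6) dform \<Rightarrow> ('i, 'p, real^6) dform
     \<Rightarrow> ('i \<times> bool, 'p \<times> complex, (real^6) \<times> real) dform
     \<Rightarrow> ('i \<times> bool, 'p \<times> complex, (real^6) \<times> real) dform" where
  "warped_star f \<omega> \<psi>\<^sub>p \<psi>\<^sub>m =
     star (warped_metric f (su3_metric \<omega> \<psi>\<^sub>p \<psi>\<^sub>m)) (warped_vol f (su3_vol \<omega>))"

text \<open>In the following three definitions \<open>S\<close> is the Hodge star of the metric and volume form of the
  G2-structure \<open>\<phi>\<close> on the 7-manifold \<open>N\<close>.\<close>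

definition g2_Omega214 ::
    "('i, 'p, 'v::euclidean_space) manifold \<Rightarrow> (('i, 'p, 'v) dform \<Rightarrow> ('i, 'p, 'v) dform)
     \<Rightarrow> ('i, 'p, 'v) dform \<Rightarrow> ('i, 'p, 'v) dform set" where
  "g2_Omega214 N S \<phi> = {\<sigma> \<in> dforms N 2. \<sigma> \<and>\<^sub>f \<phi> \<doteq>\<^bsub>N\<^esub> - S \<sigma>}"

definition g2_Omega327 ::
    "('i, 'p, 'v::euclidean_space) manifold \<Rightarrow> (('i, 'p, 'v) dform \<Rightarrow> ('i, 'p, 'v) dform)
     \<Rightarrow> ('i, 'p, 'v) dform \<Rightarrow> ('i, 'p, 'v) dform set" where
  "g2_Omega327 N S \<phi> = {\<gamma> \<in> dforms N 3. \<gamma> \<and>\<^sub>f \<phi> \<doteq>\<^bsub>N\<^esub> 0 \<and> \<gamma> \<and>\<^sub>f S \<phi> \<doteq>\<^bsub>N\<^esub> 0}"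

definition g2_torsion ::
    "('i, 'p, 'v::euclidean_space) manifold \<Rightarrow> (('i, 'p, 'v) dform \<Rightarrow> ('i, 'p, 'v) dform)
     \<Rightarrow> ('i, 'p, 'v) dform \<Rightarrow> ('p \<Rightarrow> real) \<Rightarrow> ('i, 'p, 'v) dform \<Rightarrow> ('i, 'p, 'v) dform
     \<Rightarrow> ('i, 'p, 'v) dform \<Rightarrow> bool" where
  "g2_torsion N S \<phi> \<tau>\<^sub>0 \<tau>\<^sub>1 \<tau>\<^sub>2 \<tau>\<^sub>3 \<longleftrightarrow>
     smooth_fun N \<tau>\<^sub>0 \<and> \<tau>\<^sub>1 \<in> dforms N 1 \<and> \<tau>\<^sub>2 \<in> g2_Omega214 N S \<phi> \<and> \<tau>\<^sub>3 \<in> g2_Omega327 N S \<phi> \<and>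
     ext_d N \<phi> \<doteq>\<^bsub>N\<^esub> \<tau>\<^sub>0 \<cdot>\<^sub>f S \<phi> + 3 *\<^sub>f (\<tau>\<^sub>1 \<and>\<^sub>f \<phi>) + S \<tau>\<^sub>3 \<and>
     ext_d N (S \<phi>) \<doteq>\<^bsub>N\<^esub> 4 *\<^sub>f (\<tau>\<^sub>1 \<and>\<^sub>f S \<phi>) + \<tau>\<^sub>2 \<and>\<^sub>f \<phi>"

end

theory Submission
  imports Defs "HOL-Combinatorics.Multiset_Permutations"
begin

text \<open>Both sides of each equation are forms on \<open>\<real>\<^sup>6 \<times> \<real>\<close> at a point, so they can be compared on the frame dual to
  an adapted coframe completed by \<open>e\<^sup>7 = f ds\<close>. In such a frame all structure forms have coefficients \<open>0\<close>, \<open>1\<close>, \<open>-1\<close>, the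
  conditions on \<open>\<pi>\<^sub>2, \<sigma>\<^sub>2, \<nu>\<^sub>3\<close> become linear relations between coefficients, and every identity is linear.
  Rotating the adapted coframe by \<open>\<alpha> + i \<beta>\<close> replaces \<open>\<psi>\<^sub>+ + i \<psi>\<^sub>-\<close> by its multiple and reduces the pointwise
  computation to \<open>\<alpha> = 1\<close>, \<open>\<beta> = 0\<close>. The torsion forms are unique because the same linear system with zero right-hand
  side has only the zero solution. That the candidates are smooth forms on the manifold follows since the metric, and
  therefore the Hodge star, is determined by the SU(3)-structure and can be computed in smooth local frames.\<close>

section \<open>Algebra of the exterior product\<close>

text \<open>For given derivatives of \<phi> and of its star, the torsion equations are algebraic at
  each point, so existence and uniqueness merge into one pointwise equivalence. The obstacle is that
  an adapted coframe chosen at a single point says nothing about derivatives there. For \<phi> this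
  is harmless, since the torsion equations give the derivatives of \<omega> and
  \<open>\<psi>\<^sub>p\<close>, \<open>\<psi>\<^sub>m\<close>. The star of \<phi>, however, is
  reached through a metric given by description and a basis given by choice; before it can be
  differentiated it has to be identified, on a whole chart, with a closed expression in global
  forms. The rotation is compatible with differentiation because \<alpha> and \<beta> are constants:
  the rotated 3-forms satisfy torsion equations of the same shape, with
  \<open>\<pi>\<^sub>0\<close>, \<open>\<sigma>\<^sub>0\<close> and \<open>\<pi>\<^sub>2\<close>,
  \<open>\<sigma>\<^sub>2\<close> rotated alongside, while the metric and \<omega> stay
  fixed.\<close>

definition iprod :: "'v \<Rightarrow> 'v mform \<Rightarrow> 'v mform" where
  "iprod v A = (\<lambda>vs. A (v # vs))"

text \<open>The exterior product with a \<open>p\<close>-form as a recursion that the simplifier can run on explicit argument lists.\<close>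

fun shuf :: "nat \<Rightarrow> 'v mform \<Rightarrow> 'v mform \<Rightarrow> 'v mform" where
  "shuf 0 A B vs = A [] * B vs"
| "shuf (Suc p) A B [] = 0"
| "shuf (Suc p) A B (v # vs) =
     shuf p (iprod v A) B vs + (- 1) ^ Suc p * shuf (Suc p) A (iprod v B) vs"

text \<open>The grading involution. It carries the sign of a k-form without a degree hypothesis, so
  the contraction rule and the Leibniz rule hold for arbitrary functions on lists and their
  inductions need not track degrees.\<close>

definition parity :: "'v mform \<Rightarrow> 'v mform" where
  "parity A = (\<lambda>vs. (- 1) ^ length vs * A vs)"

lemma mwedge_Nil [simp]: "(A \<^bold>\<and> B) [] = A [] * B []"
  by (simp add: mwedge_def)

text \<open>Contraction is an antiderivation. The shuffles split by the factor that receives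
  position 0; if it is the second factor, every argument of the first one has to jump over it, which
  is the sign in \<open>parity A\<close>.\<close>

lemma mwedge_Cons:
  "(A \<^bold>\<and> B) (v # vs) = (iprod v A \<^bold>\<and> B) vs + (parity A \<^bold>\<and> iprod v B) vs"
proof -
  define n where "n = length vs"
  define inv where "inv m I = {(i, j). i \<in> I \<and> j \<in> {..<m} - I \<and> j < i}" for m and I :: "nat set"
  define h where "h I = (- 1) ^ card (inv (Suc n) I) * A (nths (v # vs) I)
      * B (nths (v # vs) ({..<Suc n} - I))" for I
  have S: "{..<Suc n} = insert 0 (Suc ` {..<n})"
    by (rule lessThan_Suc_eq_insert_0)
  have inj: "inj_on ((`) Suc) (Pow {..<n})"
    by (meson inj_Suc inj_image_eq_iff inj_onI)
  have P: "Pow {..<Suc n} = ((`) Suc) ` Pow {..<n} \<union> insert 0 ` ((`) Suc) ` Pow {..<n}"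
    unfolding S Pow_insert using image_Pow_surj[of Suc "{..<n}", OF refl] by auto
  have fin: "finite (inv m I)" if "I \<subseteq> {..<m}" for m I
    by (rule finite_subset[of _ "{..<m} \<times> {..<m}"]) (use that in \<open>auto simp: inv_def\<close>)
  have h1: "h (Suc ` J) = (- 1) ^ card (inv n J) * parity A (nths vs J) * iprod v B (nths vs ({..<n} - J))"
    if J: "J \<subseteq> {..<n}" for J
  proof -
    have fJ: "finite J"
      using J finite_subset by blast
    \<comment> \<open>Position 0 now belongs to the second factor, so each \<open>i\<close> in
      \<open>J\<close> gains exactly one new inversion, the one with 0.\<close>
    have "inv (Suc n) (Suc ` J) = map_prod Suc Suc ` inv n J \<union> (\<lambda>i. (Suc i, 0)) ` J"
      unfolding inv_def S by (auto simp: image_iff)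
    moreover have "card (map_prod Suc Suc ` inv n J) = card (inv n J)"
      by (rule card_image) (auto simp: inj_on_def)
    moreover have "card ((\<lambda>i. (Suc i, 0::nat)) ` J) = card J"
      by (rule card_image) (auto simp: inj_on_def)
    moreover have "card (map_prod Suc Suc ` inv n J \<union> (\<lambda>i. (Suc i, 0)) ` J)
        = card (map_prod Suc Suc ` inv n J) + card ((\<lambda>i. (Suc i, 0::nat)) ` J)"
      by (rule card_Un_disjoint) (use fin[OF J] fJ in auto)
    ultimately have c: "card (inv (Suc n) (Suc ` J)) = card (inv n J) + card J"
      by simp
    have "{i. i < length vs \<and> i \<in> J} = J"
      using J n_def by auto
    then have l: "length (nths vs J) = card J"
      by (simp add: length_nths)
    have "{j. Suc j \<in> {..<Suc n} - Suc ` J} = {..<n} - J"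
      by auto
    then show ?thesis
      by (auto simp: h_def c l nths_Cons parity_def iprod_def power_add image_iff)
  qed
  have h2: "h (insert 0 (Suc ` J)) = (- 1) ^ card (inv n J) * iprod v A (nths vs J) * B (nths vs ({..<n} - J))"
    if J: "J \<subseteq> {..<n}" for J
  proof -
    \<comment> \<open>No position is smaller than 0, so handing it to the first factor creates no
      inversion.\<close>
    have "inv (Suc n) (insert 0 (Suc ` J)) = map_prod Suc Suc ` inv n J"
      unfolding inv_def S by (auto simp: image_iff)
    moreover have "card (map_prod Suc Suc ` inv n J) = card (inv n J)"
      by (rule card_image) (auto simp: inj_on_def)
    moreover have "{j. Suc j \<in> {..<Suc n} - insert 0 (Suc ` J)} = {..<n} - J" "{j. Suc j \<in> insert 0 (Suc ` J)} = J"
      by auto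
    ultimately show ?thesis
      by (simp add: h_def nths_Cons iprod_def image_iff)
  qed
  have inj2: "inj_on (insert 0) (((`) Suc) ` Pow {..<n})"
    by (auto simp: inj_on_def insert_eq_iff)
  have "(A \<^bold>\<and> B) (v # vs) = sum h (Pow {..<Suc n})"
    by (simp add: mwedge_def h_def n_def inv_def)
  also have "\<dots> = sum h (((`) Suc) ` Pow {..<n}) + sum h (insert 0 ` ((`) Suc) ` Pow {..<n})"
    unfolding P by (rule sum.union_disjoint) auto
  also have "\<dots> = (\<Sum>J\<in>Pow {..<n}. h (Suc ` J)) + (\<Sum>J\<in>Pow {..<n}. h (insert 0 (Suc ` J)))"
    by (simp add: sum.reindex[OF inj] sum.reindex[OF inj2] o_def)
  also have "\<dots> = (\<Sum>J\<in>Pow {..<n}. (- 1) ^ card (inv n J) * parity A (nths vs J) * iprod v B (nths vs ({..<n} - J)))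
      + (\<Sum>J\<in>Pow {..<n}. (- 1) ^ card (inv n J) * iprod v A (nths vs J) * B (nths vs ({..<n} - J)))"
    by (intro arg_cong2[of _ _ _ _ "(+)"] sum.cong refl) (simp_all only: Pow_iff h1 h2)
  finally show ?thesis
    by (simp add: mwedge_def n_def inv_def)
qed

lemma mwedge_map: "(A \<^bold>\<and> B) (map g vs) = ((\<lambda>us. A (map g us)) \<^bold>\<and> (\<lambda>us. B (map g us))) vs"
  by (simp add: mwedge_def nths_map)

lemma mwedge_add_left: "(A + B) \<^bold>\<and> C = A \<^bold>\<and> C + B \<^bold>\<and> C"
  and mwedge_add_right: "A \<^bold>\<and> (B + C) = A \<^bold>\<and> B + A \<^bold>\<and> C"
  and mwedge_diff_left: "(A - B) \<^bold>\<and> C = A \<^bold>\<and> C - B \<^bold>\<and> C"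
  and mwedge_diff_right: "A \<^bold>\<and> (B - C) = A \<^bold>\<and> B - A \<^bold>\<and> C"
  and mwedge_minus_left: "(- A) \<^bold>\<and> C = - (A \<^bold>\<and> C)"
  and mwedge_scale_left: "(\<lambda>vs. c * A vs) \<^bold>\<and> B = (\<lambda>vs. c * (A \<^bold>\<and> B) vs)"
  and mwedge_scale_right: "A \<^bold>\<and> (\<lambda>vs. c * B vs) = (\<lambda>vs. c * (A \<^bold>\<and> B) vs)"
  and mwedge_zero_left: "0 \<^bold>\<and> B = 0"
  and mwedge_zero_right: "A \<^bold>\<and> 0 = 0"
  by (auto simp: fun_eq_iff mwedge_def algebra_simps sum.distrib sum_subtractf sum_distrib_left
      sum_negf intro!: sum.cong)

text \<open>The degree, separated from skew-symmetry: it needs no vector space and therefore also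
  applies to forms on lists of indices.\<close>

definition of_degree :: "nat \<Rightarrow> 'v mform \<Rightarrow> bool" where
  "of_degree k A \<longleftrightarrow> (\<forall>vs. length vs \<noteq> k \<longrightarrow> A vs = 0)"

lemma of_degree_iprod: "of_degree (Suc k) A \<Longrightarrow> of_degree k (iprod v A)"
  by (simp add: of_degree_def iprod_def)

lemma iprod_of_degree_0: "of_degree 0 A \<Longrightarrow> iprod v A = 0"
  by (simp add: of_degree_def iprod_def fun_eq_iff)

lemma parity_of_degree: "of_degree k A \<Longrightarrow> parity A = (\<lambda>vs. (- 1) ^ k * A vs)"
  by (auto simp: of_degree_def parity_def fun_eq_iff)

text \<open>On a p-form \<open>parity\<close> is the scalar \<open>(- 1) ^ p\<close>, which turns
  the contraction rule into the recursion of \<open>shuf\<close>; contracting the first factor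
  lowers \<open>p\<close> by one.\<close>

lemma mwedge_shuf: "of_degree p A \<Longrightarrow> A \<^bold>\<and> B = shuf p A B"
proof
  show "of_degree p A \<Longrightarrow> (A \<^bold>\<and> B) vs = shuf p A B vs" for vs
  proof (induction vs arbitrary: p A B)
    case Nil
    then show ?case
      by (cases p) (simp_all add: of_degree_def)
  next
    case (Cons v vs)
    show ?case
    proof (cases p)
      case 0
      then show ?thesis
        using Cons.IH[of 0 A "iprod v B"] Cons.prems
        by (simp add: mwedge_Cons iprod_of_degree_0 mwedge_zero_left parity_of_degree) (simp add: iprod_def)
    next
      case (Suc q)
      then have "(iprod v A \<^bold>\<and> B) vs = shuf q (iprod v A) B vs"
        using Cons.IH[of q "iprod v A" B] Cons.prems by (simp add: of_degree_iprod)
      moreover have "(A \<^bold>\<and> iprod v B) vs = shuf p A (iprod v B) vs"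
        using Cons.IH[of p A "iprod v B"] Cons.prems by simp
      ultimately show ?thesis
        unfolding mwedge_Cons parity_of_degree[OF Cons.prems] mwedge_scale_left by (simp add: Suc)
    qed
  qed
qed

lemma of_degree_mwedge:
  assumes "of_degree p A" "of_degree q B"
  shows "of_degree (p + q) (A \<^bold>\<and> B)"
  unfolding of_degree_def
proof (intro allI impI)
  fix vs :: "'a list"
  assume vs: "length vs \<noteq> p + q"
  have "A (nths vs I) * B (nths vs ({..<length vs} - I)) = 0" if I: "I \<subseteq> {..<length vs}" for I
  proof -
    have "{i. i < length vs \<and> i \<in> I} = I" "{i. i < length vs \<and> i \<in> {..<length vs} - I} = {..<length vs} - I"
      using I by auto
    then have "length (nths vs I) + length (nths vs ({..<length vs} - I)) = length vs"
      using card_mono[OF _ I] card_Diff_subset[OF finite_subset[OF I] I] by (simp only: length_nths) simp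
    then have "length (nths vs I) \<noteq> p \<or> length (nths vs ({..<length vs} - I)) \<noteq> q"
      using vs by linarith
    then show ?thesis
      using assms by (auto simp: of_degree_def)
  qed
  then show "(A \<^bold>\<and> B) vs = 0"
    unfolding mwedge_def by (intro sum.neutral ballI) (simp only: Pow_iff mult.assoc mult_zero_right)
qed

section \<open>Multilinear and skew-symmetric forms\<close>

definition multilinear :: "'v::real_vector mform \<Rightarrow> bool" where
  "multilinear A \<longleftrightarrow> (\<forall>us ws. linear (\<lambda>v. A (us @ v # ws)))"

text \<open>Only adjacent equal arguments have to give zero, because this is easy to propagate
  through an induction that contracts leading arguments. Arbitrary repetitions follow in
  \<open>skew_not_distinct\<close>.\<close>

definition skew :: "'v::real_vector mform \<Rightarrow> bool" where
  "skew A \<longleftrightarrow> multilinear A \<and> (\<forall>us v ws. A (us @ v # v # ws) = 0)"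

lemma skew_multilinear: "skew A \<Longrightarrow> multilinear A"
  by (simp add: skew_def)

lemma multilinear_Cons: "multilinear A \<Longrightarrow> linear (\<lambda>v. A (v # ws))"
  unfolding multilinear_def by (drule spec[of _ "[]"]) simp

lemma multilinear_iprod: "multilinear A \<Longrightarrow> multilinear (iprod v A)"
  unfolding multilinear_def
proof (intro allI)
  fix us ws
  assume "\<forall>us ws. linear (\<lambda>v. A (us @ v # ws))"
  then have "linear (\<lambda>w. A ((v # us) @ w # ws))" by blast
  then show "linear (\<lambda>w. iprod v A (us @ w # ws))" by (simp add: iprod_def)
qed

lemma skew_iprod: "skew A \<Longrightarrow> skew (iprod v A)"
  unfolding skew_def
proof (intro conjI allI)
  fix us w ws
  assume A: "multilinear A \<and> (\<forall>us v ws. A (us @ v # v # ws) = 0)"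
  then have "A ((v # us) @ w # w # ws) = 0" by blast
  then show "iprod v A (us @ w # w # ws) = 0" by (simp add: iprod_def)
qed (simp add: multilinear_iprod)

lemma linear_const_mult: "linear f \<Longrightarrow> linear (\<lambda>v. c * f v :: real)"
  using linear_compose_scale_right[of f c] by simp

lemma skew_parity: "skew A \<Longrightarrow> skew (parity A)"
  unfolding skew_def multilinear_def parity_def by (auto simp del: power_Suc intro!: linear_compose_neg linear_const_mult)

text \<open>Polarisation: both slots are expanded at \<open>v + w\<close>.\<close>

lemma skew_swap:
  assumes "skew A"
  shows "A (us @ v # w # ws) = - A (us @ w # v # ws)"
proof -
  have l1: "linear (\<lambda>x. A (us @ x # y # ws))" for y
    using assms by (simp add: skew_def multilinear_def)
  have l2: "linear (\<lambda>y. A (us @ x # y # ws))" for x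
  proof -
    have "linear (\<lambda>y. A ((us @ [x]) @ y # ws))"
      using assms by (simp only: skew_def multilinear_def)
    then show ?thesis by simp
  qed
  have z: "A (us @ x # x # ws) = 0" for x
    using assms by (simp add: skew_def)
  have "0 = A (us @ v # (v + w) # ws) + A (us @ w # (v + w) # ws)"
    using z[of "v + w"] by (simp only: linear_add[OF l1])
  also have "\<dots> = A (us @ v # w # ws) + A (us @ w # v # ws)"
    by (simp only: linear_add[OF l2] z add_0_left add_0_right)
  finally show ?thesis
    by simp
qed

text \<open>Adjacent transpositions bring the two equal arguments together, at the cost of a
  sign.\<close>

lemma skew_not_distinct:
  assumes "skew A" "\<not> distinct vs"
  shows "A vs = 0"
proof -
  obtain us v ws xs where "vs = us @ v # ws @ v # xs"
    using not_distinct_decomp[OF assms(2)] by auto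
  moreover have "A (us @ v # ws @ v # xs) = 0"
  proof (induction ws arbitrary: us)
    case Nil
    then show ?case using assms(1) by (simp add: skew_def)
  next
    case (Cons w ws)
    then show ?case using skew_swap[OF assms(1), of us v w] Cons[of "us @ [w]"] by simp
  qed
  ultimately show ?thesis by simp
qed

text \<open>On lists of the wrong length the form is constantly zero, hence linear there as well;
  this removes the length condition from linearity.\<close>

lemma alternating_iff: "alternating k A \<longleftrightarrow> of_degree k A \<and> skew A"
proof
  assume A: "alternating k A"
  have "linear (\<lambda>v. A (us @ v # ws))" for us ws
  proof (cases "length us + 1 + length ws = k")
    case False
    then have "(\<lambda>v. A (us @ v # ws)) = (\<lambda>v. 0)"
      using A by (auto simp: alternating_def fun_eq_iff)
    then show ?thesis by (simp add: linear_zero)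
  qed (use A in \<open>simp add: alternating_def\<close>)
  moreover have "A (us @ v # v # ws) = 0" for us v ws
    using A by (cases "length (us @ v # v # ws) = k") (simp_all add: alternating_def)
  ultimately show "of_degree k A \<and> skew A"
    using A by (simp add: of_degree_def skew_def alternating_def multilinear_def)
next
  assume A: "of_degree k A \<and> skew A"
  then show "alternating k A"
    unfolding alternating_def
    by (metis of_degree_def skew_def multilinear_def skew_not_distinct)
qed

lemma linear_mwedge_left:
  assumes "\<And>us. linear (\<lambda>v. F v us)"
  shows "linear (\<lambda>v. (F v \<^bold>\<and> B) vs)"
  by (rule linearI) (simp_all add: mwedge_def linear_add[OF assms] linear_scale[OF assms]
      algebra_simps sum.distrib sum_distrib_left)

lemma linear_mwedge_right:
  assumes "\<And>us. linear (\<lambda>v. F v us)"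
  shows "linear (\<lambda>v. (A \<^bold>\<and> F v) vs)"
  by (rule linearI) (simp_all add: mwedge_def linear_add[OF assms] linear_scale[OF assms]
      algebra_simps sum.distrib sum_distrib_left)

text \<open>Leading arguments are removed by the contraction rule. With the equal pair in front,
  contracting twice by \<open>v\<close> kills either factor, and the two mixed terms cancel because
  contraction anticommutes with \<open>parity\<close>.\<close>

lemma skew_mwedge:
  assumes "skew A" "skew B"
  shows "skew (A \<^bold>\<and> B)"
proof -
  have "linear (\<lambda>v. (A \<^bold>\<and> B) (us @ v # ws))" for us ws
    using assms
  proof (induction us arbitrary: A B)
    case Nil
    then show ?case
      by (auto simp: mwedge_Cons iprod_def skew_def intro!: linear_compose_add linear_mwedge_left
          linear_mwedge_right multilinear_Cons)
  next
    case (Cons u us)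
    then show ?case
      by (auto simp: mwedge_Cons intro!: linear_compose_add Cons.IH skew_iprod skew_parity)
  qed
  moreover have "(A \<^bold>\<and> B) (us @ v # v # ws) = 0" for us v ws
    using assms
  proof (induction us arbitrary: A B)
    case Nil
    have "iprod v (iprod v A) = 0" "iprod v (iprod v B) = 0"
      using Nil[unfolded skew_def] by (auto simp: iprod_def fun_eq_iff dest!: spec[of _ "[]"])
    moreover have "iprod v (parity A) = - parity (iprod v A)"
      by (simp add: iprod_def parity_def fun_eq_iff)
    ultimately show ?case
      by (simp add: mwedge_Cons mwedge_zero_left mwedge_zero_right mwedge_minus_left)
  next
    case (Cons u us)
    then show ?case
      by (simp add: mwedge_Cons skew_iprod skew_parity)
  qed
  ultimately show ?thesis
    by (simp add: skew_def multilinear_def)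
qed

lemma alternating_mwedge: "alternating p A \<Longrightarrow> alternating q B \<Longrightarrow> alternating (p + q) (A \<^bold>\<and> B)"
  by (simp add: alternating_iff of_degree_mwedge skew_mwedge)

lemma alternating_add: "alternating k A \<Longrightarrow> alternating k B \<Longrightarrow> alternating k (A + B)"
  and alternating_diff: "alternating k A \<Longrightarrow> alternating k B \<Longrightarrow> alternating k (A - B)"
  and alternating_minus: "alternating k A \<Longrightarrow> alternating k (- A)"
  and alternating_scale: "alternating k A \<Longrightarrow> alternating k (\<lambda>vs. c * A vs)"
  and alternating_zero: "alternating k 0"
  by (auto simp: alternating_def intro!: linear_compose_add linear_compose_sub linear_compose_neg
      linear_const_mult linear_zero)

lemma alternating_comp:
  assumes "alternating k A" "linear g"
  shows "alternating k (\<lambda>vs. A (map g vs))"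
  unfolding alternating_iff
proof
  show "of_degree k (\<lambda>vs. A (map g vs))"
    using assms(1) by (simp add: alternating_iff of_degree_def)
  have "linear (\<lambda>v. A (us @ v # ws))" for us ws
    using assms(1) by (simp add: alternating_iff skew_def multilinear_def)
  then have "linear (\<lambda>v. A (map g us @ g v # map g ws))" for us ws
    using linear_compose[OF assms(2), of "\<lambda>v. A (map g us @ v # map g ws)"] by (simp add: o_def)
  then show "skew (\<lambda>vs. A (map g vs))"
    using assms(1) by (simp add: alternating_iff skew_def multilinear_def)
qed

section \<open>Forms in components\<close>

text \<open>A form on a space with a frame \<open>E 1, \<dots>, E n\<close> is represented by its values on increasing lists of indices;
  the index \<open>7\<close> is the circle direction, with dual covector \<open>f ds\<close>.\<close>

fun combs :: "nat \<Rightarrow> 'a list \<Rightarrow> 'a list list" where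
  "combs 0 xs = [[]]"
| "combs (Suc k) [] = []"
| "combs (Suc k) (x # xs) = map ((#) x) (combs k xs) @ combs (Suc k) xs"

text \<open>The finite check to which equality of k-forms in dimension \<open>n\<close> is reduced
  by \<open>alternating_eqI\<close>.\<close>

definition agree :: "nat \<Rightarrow> nat \<Rightarrow> nat mform \<Rightarrow> nat mform \<Rightarrow> bool" where
  "agree n k A B \<longleftrightarrow> (\<forall>js\<in>set (combs k [1..<Suc n]). A js = B js)"

text \<open>The sign of the permutation that sorts the list, by counting inversions.\<close>

fun inv_sign :: "nat list \<Rightarrow> real" where
  "inv_sign [] = 1"
| "inv_sign (x # xs) = (if odd (length (filter (\<lambda>y. y < x) xs)) then - 1 else 1) * inv_sign xs"

definition cmpl :: "nat \<Rightarrow> nat list \<Rightarrow> nat list" where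
  "cmpl n js = filter (\<lambda>k. k \<notin> set js) [1..<Suc n]"

text \<open>The Hodge star in an oriented orthonormal frame. The complement stands in front of
  \<open>js\<close> because \<open>hodge\<close> evaluates the volume form on
  \<open>es @ vs\<close>; the factor \<open>1/k!\<close> is absorbed by the orderings of the
  complement.\<close>

definition nstar :: "nat \<Rightarrow> nat mform \<Rightarrow> nat mform" where
  "nstar n A js = inv_sign (cmpl n js @ js) * A (cmpl n js)"

definition tab :: "'a list list \<Rightarrow> 'a list list \<Rightarrow> 'a mform" where
  "tab ps ns js = (if js \<in> set ps then 1 else if js \<in> set ns then -1 else 0)"

definition up :: "nat mform \<Rightarrow> nat mform" where
  "up A js = (if 7 \<in> set js then 0 else A js)"

text \<open>The exterior product with the seventh covector as right factor: 7 is the largest index,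
  hence last in an increasing list, and removing it costs no sign.\<close>

definition up7 :: "nat mform \<Rightarrow> nat mform" where
  "up7 A js = (if 7 \<in> set js then A (removeAll 7 js) else 0)"

abbreviation "tw \<equiv> tab [[1,2],[3,4],[5,6]] ([] :: nat list list)"
abbreviation "ta \<equiv> tab [[1,3,5]] [[1,4,6],[2,3,6],[2,4,5::nat]]"
abbreviation "tb \<equiv> tab [[2,3,5],[1,4,5],[1,3,6]] [[2,4,6::nat]]"

section \<open>Evaluation rules for components\<close>

lemma upt_16: "[1..<7] = [1,2,3,4,5,6]" "[1..<8] = [1,2,3,4,5,6,7]" "[1..<Suc 6] = [1,2,3,4,5,6]" "[1..<Suc 7] = [1,2,3,4,5,6,7]"
  by (simp_all add: upt_rec)

lemma combs_simps:
  "combs 1 [] = []" "combs (numeral n) [] = []" 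
  "combs 1 (x # xs) = [x] # combs 1 xs"
  "combs (numeral n) (x # xs) = map ((#) x) (combs (pred_numeral n) xs) @ combs (numeral n) xs"
  by (simp_all add: numeral_eq_Suc)

lemma shuf_simps:
  "shuf 1 A B [] = 0" "shuf (numeral n) A B [] = 0"
  "shuf 1 A B (v # vs) = A [v] * B vs - shuf 1 A (iprod v B) vs"
  "shuf (numeral n) A B (v # vs) = shuf (pred_numeral n) (iprod v A) B vs
    + (if even (numeral n :: nat) then 1 else - 1) * shuf (numeral n) A (iprod v B) vs"
proof -
  show "shuf (numeral n) A B (v # vs) = shuf (pred_numeral n) (iprod v A) B vs
    + (if even (numeral n :: nat) then 1 else - 1) * shuf (numeral n) A (iprod v B) vs"
    unfolding numeral_eq_Suc shuf.simps minus_one_power_iff ..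
qed (simp_all add: numeral_eq_Suc iprod_def)

text \<open>Under these rules an \<open>agree\<close> statement becomes a finite conjunction of
  equations between components, and the tables replace those of the structure forms by
  numbers.\<close>

lemmas comps = agree_def upt_16 combs_simps shuf_simps iprod_def nstar_def cmpl_def up_def up7_def tab_def



text \<open>The rules for \<open>shuf 1\<close> and \<open>combs 1\<close> match only while the
  literal \<open>1\<close> is not rewritten to \<open>Suc 0\<close>.\<close>

declare One_nat_def [simp del]

text \<open>These are the primitive forms of type (1,1): the first relation is vanishing trace, the
  other six are invariance under the complex structure. Seven relations among 15 components leave
  the dimension 8.\<close>

lemma omega8:
  assumes A: "agree 6 3 A ta" and W: "agree 6 2 W tw" and
    S: "agree 6 5 (shuf 2 S A) 0" "agree 6 4 (nstar 6 S) (- shuf 2 S W)"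
  shows "S [5,6] = - S [1,2] - S [3,4]" 
   "S [2,4] = S [1,3]" "S [2,3] = - S [1,4]" "S [2,6] = S [1,5]" "S [2,5] = - S [1,6]"
     "S [4,6] = S [3,5]" "S [4,5] = - S [3,6]"
proof -
  note comps [simp]
  note tA [simp] = A[simplified] and tW [simp] = W[simplified]
  note r = S[simplified]
  show "S [5,6] = - S [1,2] - S [3,4]" 
   "S [2,4] = S [1,3]" "S [2,3] = - S [1,4]" "S [2,6] = S [1,5]" "S [2,5] = - S [1,6]"
     "S [4,6] = S [3,5]" "S [4,5] = - S [3,6]"
    using r by linarith+
qed


text \<open>Eight relations among 20 components leave the dimension 12: the product with \<omega>
  gives the first six, the products with the two structure 3-forms the last two.\<close>

lemma omega12:
  assumes A: "agree 6 3 A ta" and B: "agree 6 3 B tb" and W: "agree 6 2 W tw"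
    and S: "agree 6 5 (shuf 3 S W) 0" "agree 6 6 (shuf 3 S A) 0" "agree 6 6 (shuf 3 S B) 0"
  shows "S [1,5,6] = - S [1,3,4]" "S [2,5,6] = - S [2,3,4]"
   "S [3,5,6] = - S [1,2,3]" "S [4,5,6] = - S [1,2,4]"
   "S [3,4,5] = - S [1,2,5]" "S [3,4,6] = - S [1,2,6]"
   "S [2,4,6] = S [2,3,5] + S [1,4,5] + S[1,3,6]"
   "S [1,3,5] = S [1,4,6] + S [2,3,6] + S[2,4,5]"
proof -
  note comps [simp]
  note tA [simp] = A[simplified] and tB [simp] = B[simplified] and tW [simp] = W[simplified]
  note r = S[simplified]
  show "S [1,5,6] = - S [1,3,4]" "S [2,5,6] = - S [2,3,4]"
   "S [3,5,6] = - S [1,2,3]" "S [4,5,6] = - S [1,2,4]"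
   "S [3,4,5] = - S [1,2,5]" "S [3,4,6] = - S [1,2,6]"
   "S [2,4,6] = S [2,3,5] + S [1,4,5] + S[1,3,6]"
   "S [1,3,5] = S [1,4,6] + S [2,3,6] + S[2,4,5]"
    using r by linarith+
qed

text \<open>One point with \<alpha> = 1 and \<beta> = 0, in components. The seventh covector is
  \<open>f ds\<close> and absorbs every factor \<open>f\<close>. \<open>T\<close>, \<open>P\<close>,
  \<open>N\<close> are the components of \<open>df/f\<close>, \<open>\<pi>\<^sub>1\<close>,
  \<open>\<nu>\<^sub>1\<close>; the assumptions on \<open>T1\<close>, \<open>T2\<close>,
  \<open>T3\<close> are the claimed formulas.\<close>

locale comps7 =
  fixes W A B T P N A2 S2 N3 PH SPH T1 T2 T3 :: "nat mform" and p0 s0 :: real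
  assumes W: "agree 6 2 W tw" and A: "agree 6 3 A ta" and B: "agree 6 3 B tb"
    and A2: "agree 6 5 (shuf 2 A2 A) 0" "agree 6 4 (nstar 6 A2) (- shuf 2 A2 W)"
    and S2: "agree 6 5 (shuf 2 S2 A) 0" "agree 6 4 (nstar 6 S2) (- shuf 2 S2 W)"
    and N3: "agree 6 5 (shuf 3 N3 W) 0" "agree 6 6 (shuf 3 N3 A) 0" "agree 6 6 (shuf 3 N3 B) 0"
    and PH: "agree 7 3 PH (up7 W + up A)"
    and SPH: "agree 7 4 SPH (nstar 7 PH)"
    and T1: "agree 7 1 T1 (up7 (\<lambda>_. s0/2) + up (\<lambda>js. 1/6 * (T + P + N) js))"
    and T2: "agree 7 2 T2 (up (- S2) + up7 (\<lambda>js. 1/3 * nstar 6 (shuf 1 (\<lambda>js. T js + P js - 2 * N js) (shuf 2 W W)) js)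
      - up (\<lambda>js. 1/3 * nstar 6 (shuf 1 (\<lambda>js. T js + P js - 2 * N js) B) js))"
    and T3: "agree 7 3 T3 (up7 (\<lambda>js. 2/7 * p0 * W js - 1/2 * nstar 6 (shuf 1 (T - P + N) A) js + A2 js)
      - up (\<lambda>js. 1/2 * nstar 6 (shuf 1 (T - P + N) W) js) 
      - up (\<lambda>js. 3/14 * p0 * A js) - up (nstar 6 N3))"
begin

context
  notes comps [simp] and eq_divide_eq_numeral1 [simp del]
begin

lemmas table6 [simp] = W[simplified] A[simplified] B[simplified]
lemmas table7 [simp] = PH[simplified] SPH[simplified]
lemmas r [simp] = omega8[OF A W A2] omega8[OF A W S2] omega12[OF A B W N3]
lemmas tT1 [simp] = T1[simplified]
lemmas tT2 [simp] = T2[simplified]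
lemmas tT3 [simp] = T3[simplified]

text \<open>The left side is the derivative of \<phi>, with \<open>df\<close> written as
  \<open>f T\<close>. The constant 12/7 is a projection onto the star of \<phi>, of square norm 7:
  the term with 3/2 contributes \<open>3/2 * 4\<close>, the square of \<omega> contributes 6. The
  remainders \<open>3/2 - 12/7 = - 3/14\<close> and \<open>2 - 12/7 = 2/7\<close> are the
  coefficients in the third torsion form.\<close>

lemma d_phi_comps:
  "agree 7 4 (up7 (\<lambda>js. shuf 1 T W js - 3/2 * s0 * A js + 3/2 * p0 * B js + shuf 1 N W js + N3 js)
     + up (\<lambda>js. p0 * shuf 2 W W js + shuf 1 P A js - shuf 2 A2 W js))
    (\<lambda>js. p0 * 12/7 * SPH js + 3 * shuf 1 T1 PH js + nstar 7 T3 js)"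
  by simp (intro conjI; argo)

text \<open>The left side is the derivative of the star of \<phi>, namely of half the square of
  \<omega> plus \<open>f B\<close> times \<open>ds\<close>. The coefficient \<open>s0/2\<close> in
  \<open>T1\<close> serves both equations: times 3 it gives the 3/2 in the derivative of \<omega>,
  and times 4 and the factor 1/2 in front of the square of \<omega> it gives
  \<open>s0\<close>.\<close>

lemma d_star_phi_comps:
  "agree 7 5 (up7 (\<lambda>js. shuf 1 T B js + s0 * shuf 2 W W js + shuf 1 P B js - shuf 2 S2 W js)
     + up (shuf 2 W (\<lambda>js. - 3/2 * s0 * A js + 3/2 * p0 * B js + shuf 1 N W js + N3 js)))
    (\<lambda>js. 4 * shuf 1 T1 SPH js + shuf 2 T2 PH js)"
  by simp (intro conjI; argo)

lemma T2_wedge_phi: "agree 7 5 (shuf 2 T2 PH) (- nstar 7 T2)"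
  by simp (intro conjI; argo)

lemma T3_wedge_phi: "agree 7 6 (shuf 3 T3 PH) 0"
  by simp (intro conjI; argo)

lemma T3_wedge_star_phi: "agree 7 7 (shuf 3 T3 SPH) 0"
  by simp

end

end

text \<open>The two conditions on \<open>T3\<close> make its star orthogonal to the star of \<phi>
  and to all products of 1-forms with \<phi>, so the first equation splits and forces
  \<open>t0\<close>, \<open>T1\<close> and then \<open>T3\<close> to vanish. The second equation
  becomes \<open>shuf 2 T2 PH = 0\<close>, and the condition on \<open>T2\<close> identifies this
  product with minus its star.\<close>

lemma g2_unique:
  assumes "agree 7 3 PH (\<lambda>js. tab [[1,2,7],[3,4,7],[5,6,7],[1,3,5]] [[1,4,6],[2,3,6],[2,4,5]] js)"
    and "agree 7 4 SPH (nstar 7 PH)"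
    and "agree 7 4 (\<lambda>js. t0 * SPH js + 3 * shuf 1 T1 PH js + nstar 7 T3 js) 0"
    and "agree 7 5 (\<lambda>js. 4 * shuf 1 T1 SPH js + shuf 2 T2 PH js) 0"
    and "agree 7 5 (shuf 2 T2 PH) (- nstar 7 T2)"
    and "agree 7 6 (shuf 3 T3 PH) 0" "agree 7 7 (shuf 3 T3 SPH) 0"
  shows "t0 = 0" "agree 7 1 T1 0" "agree 7 2 T2 0" "agree 7 3 T3 0"
proof -
  note comps [simp]
  note table [simp] = assms(1,2)[simplified]
  note r = assms(3,6,7)[simplified]
  have T1: "t0 = 0" "T1 [1] = 0" "T1 [2] = 0" "T1 [3] = 0" "T1 [4] = 0" "T1 [5] = 0" "T1 [6] = 0" "T1 [7] = 0"
    using r by linarith+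
  note T1 [simp]
  show "t0 = 0" "agree 7 1 T1 0" by simp_all
  show "agree 7 3 T3 0"
    using assms(3) by simp
  show "agree 7 2 T2 0"
    using assms(4,5) by simp
qed

section \<open>The Hodge star in a frame\<close>


lemma swap_invariant_mset:
  assumes "\<And>us a b ws. F (us @ a # b # ws) = F (us @ b # a # ws)" "mset xs = mset ys"
  shows "F xs = F ys"
  using assms
proof (induction xs arbitrary: F ys)
  case Nil
  then show ?case by simp
next
  case (Cons x xs)
  then have "x \<in> set ys"
    by (metis list.set_intros(1) set_mset_mset)
  then obtain us ws where ys: "ys = us @ x # ws"
    by (meson split_list)
  have "F (us @ x # ws) = F (x # us @ ws)" for ws
  proof (induction us arbitrary: ws rule: rev_induct)
    case (snoc u us)
    then show ?case
      using Cons.prems(1)[of us u x ws] by simp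
  qed simp
  moreover have "(\<lambda>l. F (x # l)) xs = (\<lambda>l. F (x # l)) (us @ ws)"
  proof (rule Cons.IH)
    show "F (x # vs @ a # b # zs) = F (x # vs @ b # a # zs)" for vs a b zs
      using Cons.prems(1)[of "x # vs" a b zs] by simp
    show "mset xs = mset (us @ ws)"
      using Cons.prems(2) by (simp add: ys)
  qed
  ultimately show ?case
    by (simp add: ys)
qed

text \<open>On its way to its place \<open>x\<close> is transposed once with each smaller entry, and
  each transposition changes the sign of \<open>F\<close>.\<close>

lemma insort_inv_sign:
  assumes "\<And>us a b ws. F (us @ a # b # ws) = - F (us @ b # a # ws :: nat list)" "sorted ys" "x \<notin> set ys"
  shows "F (x # ys) = (if odd (length (filter (\<lambda>y. y < x) ys)) then - 1 else (1::real)) * F (insort x ys)"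
  using assms
proof (induction ys arbitrary: F)
  case Nil
  then show ?case by simp
next
  case (Cons y ys)
  show ?case
  proof (cases "x < y")
    case True
    then have "filter (\<lambda>y. y < x) (y # ys) = []"
      using Cons.prems(2) by (auto simp: filter_empty_conv)
    then show ?thesis
      using True by simp
  next
    case False
    have "(\<lambda>l. F (y # l)) (x # ys) = (if odd (length (filter (\<lambda>y. y < x) ys)) then - 1 else 1) * (\<lambda>l. F (y # l)) (insort x ys)"
    proof (rule Cons.IH)
      show "F (y # vs @ a # b # zs) = - F (y # vs @ b # a # zs)" for vs a b zs
        using Cons.prems(1)[of "y # vs" a b zs] by simp
    qed (use Cons.prems in auto)
    then show ?thesis
      using False Cons.prems(1)[of "[]" x y ys] Cons.prems(3) by auto
  qed
qed

text \<open>Insertion sort: sorting the tail does not change how many of its entries are smaller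
  than the head, so the inversions add up.\<close>

lemma sort_inv_sign:
  assumes "\<And>us a b ws. F (us @ a # b # ws) = - F (us @ b # a # ws :: nat list)" "distinct xs"
  shows "F xs = inv_sign xs * F (sort xs)"
  using assms
proof (induction xs arbitrary: F)
  case (Cons x xs)
  have "(\<lambda>l. F (x # l)) xs = inv_sign xs * (\<lambda>l. F (x # l)) (sort xs)"
  proof (rule Cons.IH)
    show "F (x # vs @ a # b # zs) = - F (x # vs @ b # a # zs)" for vs a b zs
      using Cons.prems(1)[of "x # vs" a b zs] by simp
  qed (use Cons.prems in auto)
  moreover have "F (x # sort xs) = (if odd (length (filter (\<lambda>y. y < x) (sort xs))) then - 1 else 1) * F (insort x (sort xs))"
    by (rule insort_inv_sign; (rule Cons.prems(1))?) (use Cons.prems(2) in auto)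
  moreover have "length (filter (\<lambda>y. y < x) (sort xs)) = length (filter (\<lambda>y. y < x) xs)"
    by (metis filter_sort length_sort)
  ultimately show ?case
    by simp
qed simp

lemma sorted_in_combs:
  "sorted_wrt (<) js \<Longrightarrow> sorted_wrt (<) xs \<Longrightarrow> set js \<subseteq> set xs \<Longrightarrow> js \<in> set (combs (length js) (xs :: nat list))"
proof (induction xs arbitrary: js)
  case (Cons x xs)
  show ?case
  proof (cases js)
    case Nil
    then show ?thesis by simp
  next
    case (Cons j js')
    show ?thesis
    proof (cases "j = x")
      case True
      then have "set js' \<subseteq> set xs"
        using Cons.prems Cons by fastforce
      then show ?thesis
        using Cons.IH[of js'] Cons.prems Cons True by simp
    next
      case False
      then have "j \<in> set xs"
        using Cons.prems Cons by auto
      then have "x \<notin> set js"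
        using Cons.prems Cons by (auto dest: less_asym)
      then have "set js \<subseteq> set xs"
        using Cons.prems by auto
      then show ?thesis
        using Cons.IH[of js] Cons.prems Cons by simp
    qed
  qed
qed simp

lemma combs_sorted:
  assumes "js \<in> set (combs k xs)" "sorted_wrt (<) xs"
  shows "length js = k \<and> sorted_wrt (<) js \<and> set js \<subseteq> set (xs :: nat list)"
proof -
  have "length js = k \<and> set js \<subseteq> set xs \<and> sorted_wrt (<) js"
    using assms
  proof (induction k xs arbitrary: js rule: combs.induct)
    case (3 k x xs)
    then have "sorted_wrt (<) xs" "\<forall>y\<in>set xs. x < y" by auto
    then show ?case
      using 3(1) 3(2)[of js] 3(3) by fastforce
  qed auto
  then show ?thesis by auto
qed

lemma skew_spans_0:
  assumes "multilinear D" "\<And>es. set es \<subseteq> B \<Longrightarrow> length es = length vs \<Longrightarrow> D es = 0" "span B = UNIV"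
  shows "D vs = 0"
  using assms(1,2)
proof (induction vs arbitrary: D)
  case (Cons v vs)
  have "linear (\<lambda>v. D (v # vs))"
    by (rule multilinear_Cons[OF Cons.prems(1)])
  moreover have "D (b # vs) = 0" if "b \<in> B" for b
  proof -
    have "iprod b D vs = 0"
      by (rule Cons.IH) (use Cons.prems that multilinear_iprod[of D b] in \<open>auto simp: iprod_def\<close>)
    then show ?thesis by (simp add: iprod_def)
  qed
  ultimately show ?case
    using linear_eq_0_on_span[of "\<lambda>v. D (v # vs)" B v] assms(3) by auto
qed simp

section \<open>Orthonormal frames and the component formula for the Hodge star\<close>

definition dual_frame :: "nat \<Rightarrow> (nat \<Rightarrow> 'v::euclidean_space \<Rightarrow> real) \<Rightarrow> (nat \<Rightarrow> 'v) \<Rightarrow> bool" where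
  "dual_frame n c E \<longleftrightarrow> (\<forall>k\<in>{1..n}. linear (c k)) \<and>
     (\<forall>k\<in>{1..n}. \<forall>l\<in>{1..n}. c k (E l) = (if k = l then 1 else 0)) \<and>
     (\<forall>v. v = (\<Sum>k = 1..n. c k v *\<^sub>R E k))"

text \<open>The inner product for which the frame dual to \<open>c\<close> is orthonormal.\<close>

definition gram :: "nat \<Rightarrow> (nat \<Rightarrow> 'v \<Rightarrow> real) \<Rightarrow> 'v \<Rightarrow> 'v \<Rightarrow> real" where
  "gram n c u v = (\<Sum>k = 1..n. c k u * c k v)"

lemma upt_sorted: "sorted_wrt (<) [1..<Suc n]" "set [1..<Suc n] = {1..n}"
  by (auto simp del: upt_Suc)

context
  fixes n c and E :: "nat \<Rightarrow> 'v::euclidean_space"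
  assumes cE: "dual_frame n c E"
begin

lemma frame_inj: "inj_on E {1..n}"
  using cE unfolding dual_frame_def inj_on_def by (metis zero_neq_one)

lemma frame_span: "span (E ` {1..n}) = UNIV"
proof -
  have "v \<in> span (E ` {1..n})" for v
  proof -
    have "(\<Sum>k = 1..n. c k v *\<^sub>R E k) \<in> span (E ` {1..n})"
      by (intro span_sum span_scale span_base) auto
    then show ?thesis
      using cE by (simp add: dual_frame_def)
  qed
  then show ?thesis by auto
qed

lemma frame_independent: "independent (E ` {1..n})"
proof -
  have "u x = 0" if *: "(\<Sum>v\<in>E ` {1..n}. u v *\<^sub>R v) = 0" "x \<in> E ` {1..n}" for u x
  proof -
    obtain k where k: "k \<in> {1..n}" "x = E k" using *(2) by blast
    have "(\<Sum>l = 1..n. u (E l) *\<^sub>R E l) = 0"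
      using * by (simp add: sum.reindex[OF frame_inj])
    then have "c k (\<Sum>l = 1..n. u (E l) *\<^sub>R E l) = 0"
      using cE k linear_0 by (metis dual_frame_def)
    then have "(\<Sum>l = 1..n. u (E l) * (if k = l then 1 else 0)) = 0"
      using cE k by (simp add: dual_frame_def linear_sum linear_scale)
    then show ?thesis
      using k by (simp add: if_distrib cong: if_cong)
  qed
  then show ?thesis
    by (intro independent_if_scalars_zero) auto
qed

lemma frame_DIM: "DIM('v) = n"
  using dim_unique[OF subset_UNIV _ frame_independent, of n] frame_span card_image[OF frame_inj]
  by (simp add: dim_UNIV)

lemma gram_frame: "i \<in> {1..n} \<Longrightarrow> j \<in> {1..n} \<Longrightarrow> gram n c (E i) (E j) = (if i = j then 1 else 0)"
proof -
  assume ij: "i \<in> {1..n}" "j \<in> {1..n}"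
  have "gram n c (E i) (E j) = (\<Sum>k = 1..n. if k = i then (if i = j then 1 else 0) else 0)"
    unfolding gram_def by (intro sum.cong refl) (use cE ij in \<open>auto simp: dual_frame_def\<close>)
  then show ?thesis using ij by simp
qed

lemma gram_commute: "gram n c u v = gram n c v u"
  by (simp add: gram_def mult.commute)

lemma gram_linear: "linear (\<lambda>v. gram n c u v)" "linear (\<lambda>v. gram n c v u)"
proof -
  show "linear (\<lambda>v. gram n c u v)"
    unfolding gram_def using cE
    by (intro linear_compose_sum ballI linear_const_mult) (auto simp: dual_frame_def)
  then show "linear (\<lambda>v. gram n c v u)"
    by (simp add: gram_commute)
qed

lemma frame_orthonormal: "orthonormal_basis (gram n c) (E ` {1..n})"
  unfolding orthonormal_basis_def
  using frame_independent frame_span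
  by (simp add: gram_frame inj_on_eq_iff[OF frame_inj] del: atLeastAtMost_iff)

text \<open>The defect is linear in \<open>v\<close> and vanishes on the spanning set
  \<open>B\<close>.\<close>

lemma orthonormal_expand:
  assumes "orthonormal_basis (gram n c) B"
  shows "v = (\<Sum>b\<in>B. gram n c b v *\<^sub>R b)"
proof -
  have fB: "finite B" and sB: "span B = UNIV"
    using assms by (auto simp: orthonormal_basis_def)
  have "linear (\<lambda>v. v - (\<Sum>b\<in>B. gram n c b v *\<^sub>R b))"
    by (intro linear_compose_sub linear_ident linear_compose_sum ballI)
      (auto intro!: linearI simp: linear_add[OF gram_linear(1)] linear_scale[OF gram_linear(1)] algebra_simps)
  moreover have "x - (\<Sum>b\<in>B. gram n c b x *\<^sub>R b) = 0" if "x \<in> B" for x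
  proof -
    have "(\<Sum>b\<in>B. gram n c b x *\<^sub>R b) = (\<Sum>b\<in>B. if b = x then x else 0)"
      using assms that by (intro sum.cong) (auto simp: orthonormal_basis_def)
    then show ?thesis
      using that fB by simp
  qed
  ultimately have "v - (\<Sum>b\<in>B. gram n c b v *\<^sub>R b) = 0"
    using linear_eq_0_on_span[of "\<lambda>v. v - (\<Sum>b\<in>B. gram n c b v *\<^sub>R b)" B v] sB by auto
  then show ?thesis by simp
qed

text \<open>The trace of a bilinear form does not depend on the orthonormal basis: each vector of
  \<open>B\<close> is expanded in \<open>C\<close>.\<close>

lemma orthonormal_trace:
  assumes B: "orthonormal_basis (gram n c) B" and C: "orthonormal_basis (gram n c) C"
    and h: "\<And>u. linear (\<lambda>v. h u v :: real)" "\<And>v. linear (\<lambda>u. h u v)"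
  shows "(\<Sum>b\<in>B. h b b) = (\<Sum>b\<in>C. h b b)"
proof -
  let ?g = "gram n c"
  have fC: "finite C" using C by (simp add: orthonormal_basis_def)
  have "h b b = (\<Sum>x\<in>C. \<Sum>y\<in>C. ?g x b * ?g y b * h x y)" for b
  proof -
    have "h b b = h (\<Sum>x\<in>C. ?g x b *\<^sub>R x) (\<Sum>x\<in>C. ?g x b *\<^sub>R x)"
      using orthonormal_expand[OF C, of b] by simp
    also have "\<dots> = (\<Sum>y\<in>C. \<Sum>x\<in>C. ?g x b * ?g y b * h x y)"
      by (simp add: linear_sum[OF h(1)] linear_sum[OF h(2)] linear_scale[OF h(1)] linear_scale[OF h(2)]
          sum_distrib_left mult.assoc mult.left_commute)
    finally show ?thesis
      by (subst sum.swap)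
  qed
  then have "(\<Sum>b\<in>B. h b b) = (\<Sum>b\<in>B. \<Sum>x\<in>C. \<Sum>y\<in>C. ?g x b * ?g y b * h x y)"
    by simp
  also have "\<dots> = (\<Sum>x\<in>C. \<Sum>y\<in>C. (\<Sum>b\<in>B. ?g x b * ?g y b) * h x y)"
    by (simp add: sum_distrib_right sum.swap[of _ B])
  \<comment> \<open>Parseval's identity in the basis \<open>B\<close>.\<close>
  also have "\<dots> = (\<Sum>x\<in>C. \<Sum>y\<in>C. ?g x y * h x y)"
  proof -
    have "(\<Sum>b\<in>B. ?g x b * ?g y b) = ?g x y" for x y
    proof -
      have "?g x y = ?g x (\<Sum>b\<in>B. ?g b y *\<^sub>R b)"
        using orthonormal_expand[OF B, of y] by simp
      then show ?thesis
        by (simp add: linear_sum[OF gram_linear(1)] linear_scale[OF gram_linear(1)] gram_commute[of y] mult.commute)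
    qed
    then show ?thesis by simp
  qed
  also have "\<dots> = (\<Sum>x\<in>C. \<Sum>y\<in>C. if y = x then h x x else 0)"
    using C by (intro sum.cong refl) (auto simp: orthonormal_basis_def)
  finally show ?thesis
    using fC by simp
qed

text \<open>Induction on the number of contracted slots: the induction hypothesis changes the basis
  in all slots but the first, and the trace argument changes it there.\<close>

lemma orthonormal_contraction:
  assumes B: "orthonormal_basis (gram n c) B" and C: "orthonormal_basis (gram n c) C"
    and "multilinear A" "multilinear V"
  shows "(\<Sum>es\<in>{es. set es \<subseteq> B \<and> length es = k}. A es * V es)
    = (\<Sum>es\<in>{es. set es \<subseteq> C \<and> length es = k}. A es * V es)"
  using assms(3,4)
proof (induction k arbitrary: A V)
  case 0
  have "{es. set es \<subseteq> B \<and> length es = 0} = {[]}" for B :: "'v set" by auto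
  then show ?case by simp
next
  case (Suc k)
  define L where "L B A V = (\<Sum>es\<in>{es. set es \<subseteq> B \<and> length es = k}. A es * V es)" for B :: "'v set" and A V :: "'v mform"
  have step: "(\<Sum>es\<in>{es. set es \<subseteq> B \<and> length es = Suc k}. A es * V es) = (\<Sum>b\<in>B. L B (iprod b A) (iprod b V))"
    if "finite B" for B
  proof -
    have "{es. set es \<subseteq> B \<and> length es = Suc k} = (\<lambda>(b, es). b # es) ` (B \<times> {es. set es \<subseteq> B \<and> length es = k})"
      by (auto simp: length_Suc_conv image_iff)
    moreover have "inj_on (\<lambda>(b, es). b # es) (B \<times> {es. set es \<subseteq> B \<and> length es = k})"
      by (auto simp: inj_on_def)
    ultimately show ?thesis
      by (simp add: sum.reindex L_def sum.cartesian_product iprod_def case_prod_unfold o_def)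
  qed
  have fin: "finite B" "finite C"
    using B C by (auto simp: orthonormal_basis_def)
  have lin: "linear (\<lambda>v. A (v # es))" "linear (\<lambda>v. V (v # es))" for es
    by (simp_all add: multilinear_Cons Suc.prems)
  have "(\<Sum>b\<in>B. L B (iprod b A) (iprod b V)) = (\<Sum>b\<in>B. L C (iprod b A) (iprod b V))"
    unfolding L_def by (intro sum.cong refl Suc.IH) (simp_all add: multilinear_iprod Suc.prems)
  also have "\<dots> = (\<Sum>b\<in>C. L C (iprod b A) (iprod b V))"
    by (rule orthonormal_trace[OF B C])
      (auto simp: L_def iprod_def linear_add[OF lin(1)] linear_add[OF lin(2)] linear_scale[OF lin(1)]
        linear_scale[OF lin(2)] algebra_simps sum.distrib sum_distrib_left intro!: linearI)
  finally show ?case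
    by (simp add: step fin)
qed

text \<open>Makes the chosen basis in \<open>hodge\<close> harmless: some orthonormal basis exists,
  and by invariance of contractions it may be exchanged for the given frame.\<close>

lemma hodge_sum:
  assumes A: "multilinear A" and V: "multilinear V" and m: "length vs \<le> n"
  shows "hodge (gram n c) V A vs = (\<Sum>is\<in>{is. set is \<subseteq> {1..n} \<and> length is = n - length vs}.
    A (map E is) * V (map E is @ vs)) / fact (n - length vs)"
proof -
  define B where "B = (SOME B. orthonormal_basis (gram n c) B)"
  have B: "orthonormal_basis (gram n c) B"
    unfolding B_def by (rule someI) (rule frame_orthonormal)
  have V': "multilinear (\<lambda>es. V (es @ vs))"
    using V by (simp add: multilinear_def)
  have im: "{es. set es \<subseteq> E ` {1..n} \<and> length es = k} = map E ` {is. set is \<subseteq> {1..n} \<and> length is = k}" for k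
  proof (intro equalityI subsetI)
    fix es
    assume "es \<in> {es. set es \<subseteq> E ` {1..n} \<and> length es = k}"
    moreover have "\<exists>is. set is \<subseteq> {1..n} \<and> es = map E is" if "set es \<subseteq> E ` {1..n}"
      using that
    proof (induction es)
      case (Cons a es)
      then obtain "is" j where "set is \<subseteq> {1..n}" "es = map E is" "j \<in> {1..n}" "a = E j" by auto
      then show ?case by (intro exI[of _ "j # is"]) auto
    qed simp
    ultimately show "es \<in> map E ` {is. set is \<subseteq> {1..n} \<and> length is = k}" by auto
  qed fastforce
  have inj: "inj_on (map E) {is. set is \<subseteq> {1..n} \<and> length is = k}" for k
    by (rule inj_onI) (metis (mono_tags, lifting) Un_subset_iff frame_inj inj_on_map_eq_map inj_on_subset mem_Collect_eq)
  have "hodge (gram n c) V A vs = (\<Sum>es\<in>{es. set es \<subseteq> B \<and> length es = n - length vs}. A es * V (es @ vs)) / fact (n - length vs)"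
    using m by (simp add: hodge_def Let_def B_def frame_DIM)
  also have "\<dots> = (\<Sum>es\<in>{es. set es \<subseteq> E ` {1..n} \<and> length es = n - length vs}. A es * V (es @ vs)) / fact (n - length vs)"
    using orthonormal_contraction[OF B frame_orthonormal A V'] by simp
  finally show ?thesis
    unfolding im sum.reindex[OF inj] by simp
qed

lemma hodge_length: "length vs > n \<Longrightarrow> hodge (gram n c) V A vs = 0"
  by (simp add: hodge_def frame_DIM)

lemma alternating_hodge:
  assumes A: "alternating k A" and V: "skew V" and k: "k \<le> n"
  shows "alternating (n - k) (hodge (gram n c) V A)"
  unfolding alternating_iff
proof
  have mA: "multilinear A" and mV: "multilinear V"
    using A V by (simp_all add: alternating_iff skew_multilinear)
  show "of_degree (n - k) (hodge (gram n c) V A)"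
    unfolding of_degree_def
  proof (intro allI impI)
    fix vs :: "'v list"
    assume l: "length vs \<noteq> n - k"
    show "hodge (gram n c) V A vs = 0"
    proof (cases "length vs \<le> n")
      case True
      have "A (map E is) = 0" if "length is = n - length vs" for "is" :: "nat list"
      proof -
        have "length (map E is) \<noteq> k" using that l k True by auto
        then show ?thesis using A by (simp add: alternating_iff of_degree_def)
      qed
      then show ?thesis by (simp add: hodge_sum[OF mA mV True])
    qed (simp add: hodge_length)
  qed
  have lV: "linear (\<lambda>v. V (us @ v # ws))" for us ws
    using mV by (simp add: multilinear_def)
  have lV': "linear (\<lambda>v. V (xs @ us @ v # ws))" for us ws xs
    using lV[of "xs @ us" ws] by simp
  have sV: "V (xs @ us @ v # v # ws) = 0" for us ws xs v
    using V unfolding skew_def by (metis append.assoc)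
  have "linear (\<lambda>v. hodge (gram n c) V A (us @ v # ws))" for us ws
  proof (cases "length us + length ws + 1 \<le> n")
    case True
    then show ?thesis
      by (intro linearI) (simp_all add: hodge_sum[OF mA mV] linear_add[OF lV'] linear_scale[OF lV'] algebra_simps
          sum.distrib sum_distrib_left add_divide_distrib)
  next
    case False
    then have "(\<lambda>v. hodge (gram n c) V A (us @ v # ws)) = (\<lambda>v. 0)"
      by (simp add: hodge_length)
    then show ?thesis by (simp add: linear_zero)
  qed
  moreover have "hodge (gram n c) V A (us @ v # v # ws) = 0" for us v ws
    by (cases "length (us @ v # v # ws) \<le> n") (simp_all add: hodge_sum[OF mA mV] hodge_length sV)
  ultimately show "skew (hodge (gram n c) V A)"
    by (simp add: skew_def multilinear_def)
qed

lemma cmpl_props: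
  assumes "js \<in> set (combs m [1..<Suc n])"
  shows "distinct (cmpl n js @ js)" "set (cmpl n js @ js) = {1..n}" "length (cmpl n js) = n - m"
    "sort (cmpl n js @ js) = [1..<Suc n]"
proof -
  have js: "length js = m" "sorted_wrt (<) js" "set js \<subseteq> {1..n}"
    using combs_sorted[OF assms upt_sorted(1)] by (auto simp: upt_sorted(2))
  show d: "distinct (cmpl n js @ js)"
    using js by (auto simp: cmpl_def strict_sorted_iff simp del: upt_Suc)
  show s: "set (cmpl n js @ js) = {1..n}"
    using js by (auto simp: cmpl_def simp del: upt_Suc)
  have "length (cmpl n js @ js) = n"
    using distinct_card[OF d] s by simp
  then show "length (cmpl n js) = n - m"
    using js by simp
  show "sort (cmpl n js @ js) = [1..<Suc n]"
    by (rule sorted_distinct_set_unique) (use d s in \<open>auto simp del: upt_Suc\<close>)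
qed

text \<open>Of all index lists of length \<open>k\<close> only the orderings of the complement of
  \<open>js\<close> contribute. There are \<open>k!\<close> of them, they contribute equally, and
  this cancels the denominator of the star.\<close>

lemma hodge_agree:
  assumes A: "alternating k A" and V: "alternating n V" and V1: "V (map E [1..<Suc n]) = 1" and k: "k + m = n"
  shows "agree n m (hodge (gram n c) V A \<circ> map E) (nstar n (A \<circ> map E))"
  unfolding agree_def
proof
  fix js
  assume js: "js \<in> set (combs m [1..<Suc n])"
  note cp = cmpl_props[OF js]
  have l: "length js = m" and js': "set js \<subseteq> {1..n}"
    using combs_sorted[OF js upt_sorted(1)] by (auto simp: upt_sorted(2))
  have sA: "skew A" and sV: "skew V"
    using A V by (simp_all add: alternating_iff)
  define F where "F is = A (map E is) * V (map E is @ map E js)" for "is"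
  have F0: "F is = 0" if "\<not> distinct (is @ js)" for "is"
  proof -
    have "\<not> distinct (map E is @ map E js)"
      using that by (metis distinct_map map_append)
    then show ?thesis
      using skew_not_distinct[OF sV] by (simp add: F_def)
  qed
  \<comment> \<open>A transposition changes the sign of both factors, so the product
    \<open>F\<close> is symmetric.\<close>
  have F1: "F is = F (cmpl n js)" if "mset is = mset (cmpl n js)" for "is"
  proof (rule swap_invariant_mset[OF _ that])
    show "F (us @ a # b # ws) = F (us @ b # a # ws)" for us a b ws
      using skew_swap[OF sA, of "map E us" "E a" "E b" "map E ws"]
        skew_swap[OF sV, of "map E us" "E a" "E b" "map E ws @ map E js"] by (simp add: F_def)
  qed
  have P: "permutations_of_set (set (cmpl n js)) \<subseteq> {is. set is \<subseteq> {1..n} \<and> length is = k}"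
    using cp k by (auto simp: permutations_of_set_def distinct_card) (metis add_diff_cancel_right' distinct_append distinct_card)
  \<comment> \<open>Any other list repeats an index or meets \<open>js\<close>, and then the volume
    form vanishes.\<close>
  have "(\<Sum>is\<in>{is. set is \<subseteq> {1..n} \<and> length is = k}. F is) = (\<Sum>is\<in>permutations_of_set (set (cmpl n js)). F is)"
  proof (rule sum.mono_neutral_right[OF _ P], goal_cases)
    case 1
    then show ?case by (rule finite_lists_length_eq) simp
  next
    case 2
    show ?case
    proof
      fix "is"
      assume a: "is \<in> {is. set is \<subseteq> {1..n} \<and> length is = k} - permutations_of_set (set (cmpl n js))"
      have "\<not> distinct (is @ js)"
      proof
        assume d: "distinct (is @ js)"
        then have "set is \<subseteq> set (cmpl n js)"
          using a cp(2) by auto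
        moreover have "card (set is) = card (set (cmpl n js))"
          using d a cp(1,3) k by (simp add: distinct_card)
        ultimately have "set is = set (cmpl n js)"
          by (simp add: card_subset_eq)
        then show False
          using a d by (simp add: permutations_of_set_def)
      qed
      then show "F is = 0" by (rule F0)
    qed
  qed
  also have "\<dots> = (\<Sum>is\<in>permutations_of_set (set (cmpl n js)). F (cmpl n js))"
  proof (intro sum.cong refl F1)
    fix "is" assume "is \<in> permutations_of_set (set (cmpl n js))"
    then show "mset is = mset (cmpl n js)"
      using cp(1) set_eq_iff_mset_eq_distinct[of "is" "cmpl n js"] by (simp add: permutations_of_set_def)
  qed
  also have "\<dots> = fact k * F (cmpl n js)"
    using cp(1,3) k by (auto simp: distinct_card)
  finally have S: "(\<Sum>is\<in>{is. set is \<subseteq> {1..n} \<and> length is = k}. F is) = fact k * F (cmpl n js)" .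
  have nk: "n - m = k" "m \<le> n" using k by auto
  have "(\<lambda>is. V (map E is)) (cmpl n js @ js) = inv_sign (cmpl n js @ js) * (\<lambda>is. V (map E is)) (sort (cmpl n js @ js))"
  proof (rule sort_inv_sign[OF _ cp(1)])
    show "V (map E (us @ a # b # ws)) = - V (map E (us @ b # a # ws))" for us a b ws
      using skew_swap[OF sV, of "map E us" "E a" "E b" "map E ws"] by simp
  qed
  then have "V (map E (cmpl n js) @ map E js) = inv_sign (cmpl n js @ js)"
    using V1 by (simp add: cp(4) del: upt_Suc)
  moreover have "hodge (gram n c) V A (map E js) = (\<Sum>is\<in>{is. set is \<subseteq> {1..n} \<and> length is = k}. F is) / fact k"
    using hodge_sum[OF skew_multilinear[OF sA] skew_multilinear[OF sV], of "map E js"] l nk by (simp add: F_def)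
  ultimately show "(hodge (gram n c) V A \<circ> map E) js = nstar n (A \<circ> map E) js"
    unfolding S by (simp add: F_def nstar_def)
qed

text \<open>Multilinearity reduces arbitrary arguments to frame vectors, and skew-symmetry reduces
  index lists to increasing ones.\<close>

lemma alternating_eqI:
  assumes A: "alternating k A" and B: "alternating k B" and AB: "agree n k (A \<circ> map E) (B \<circ> map E)"
  shows "A = B"
proof
  fix vs :: "'v list"
  have D: "alternating k (A - B)"
    by (rule alternating_diff[OF A B])
  then have sD: "skew (A - B)"
    by (simp add: alternating_iff)
  show "A vs = B vs"
  proof (cases "length vs = k")
    case True
    have D0: "(A - B) (map E is) = 0" if "is": "set is \<subseteq> {1..n}" "length is = k" for "is"
    proof (cases "distinct is")
      case True
      have "sort is \<in> set (combs k [1..<Suc n])"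
        using sorted_in_combs[OF _ upt_sorted(1), of "sort is" n] "is" True
        unfolding upt_sorted(2) by (simp add: strict_sorted_iff del: upt_Suc)
      then have "(A - B) (map E (sort is)) = 0"
        using AB by (simp add: agree_def)
      \<comment> \<open>Only vanishing matters, so absolute values spare the sign of the
        permutation.\<close>
      moreover have "\<bar>(A - B) (map E is)\<bar> = \<bar>(A - B) (map E (sort is))\<bar>"
      proof (rule swap_invariant_mset[where F = "\<lambda>is. \<bar>(A - B) (map E is)\<bar>"])
        show "\<bar>(A - B) (map E (us @ a # b # ws))\<bar> = \<bar>(A - B) (map E (us @ b # a # ws))\<bar>" for us a b ws
          using skew_swap[OF sD, of "map E us" "E a" "E b" "map E ws"] by (simp del: fun_diff_def)
      qed simp
      ultimately show ?thesis by simp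
    next
      case False
      then show ?thesis
        using skew_not_distinct[OF sD, of "map E is"] by (simp add: distinct_map)
    qed
    have "(A - B) vs = 0"
    proof (rule skew_spans_0[OF skew_multilinear[OF sD] _ frame_span])
      fix es assume es: "set es \<subseteq> E ` {1..n}" "length es = length vs"
      then have "es = map E (map (inv_into {1..n} E) es)"
        by (auto simp: f_inv_into_f subset_iff intro!: nth_equalityI)
      moreover have "set (map (inv_into {1..n} E) es) \<subseteq> {1..n}"
        using es by (auto intro!: inv_into_into)
      ultimately show "(A - B) es = 0"
        using D0[of "map (inv_into {1..n} E) es"] es True by simp
    qed
    then show ?thesis by simp
  next
    case False
    then show ?thesis
      using A B by (simp add: alternating_def)
  qed
qed

end

section \<open>Smooth functions and the exterior derivative\<close>

lemma frechet_derivative_eqI: "(f has_derivative f') (at x) \<Longrightarrow> frechet_derivative f (at x) = f'"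
  using frechet_derivative_at by metis

lemma has_frechet_derivative: "f differentiable (at x) \<Longrightarrow> (f has_derivative frechet_derivative f (at x)) (at x)"
  using frechet_derivative_works by blast

text \<open>Derivatives at points of an open set depend only on the values in that set. This lets a
  representative in a chart be replaced by a formula valid only there.\<close>

lemma C_diff_on_cong:
  assumes "open S" "\<And>x. x \<in> S \<Longrightarrow> f x = g x" "C_diff_on n S f"
  shows "C_diff_on n S g"
  using assms(2,3)
proof (induction n arbitrary: f g)
  case 0
  then show ?case using continuous_on_cong[of S S f g] by simp
next
  case (Suc n)
  have d: "(g has_derivative frechet_derivative f (at x)) (at x)" if "x \<in> S" for x
    by (rule has_derivative_transform_within_open[OF has_frechet_derivative assms(1) that])
      (use Suc.prems that in simp_all)
  then have "frechet_derivative f (at x) = frechet_derivative g (at x)" if "x \<in> S" for x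
    using frechet_derivative_at that by blast
  then have "C_diff_on n S (\<lambda>x. frechet_derivative g (at x) v)" for v
    using Suc.IH[of "\<lambda>x. frechet_derivative f (at x) v" "\<lambda>x. frechet_derivative g (at x) v"] Suc.prems(2) by simp
  then show ?case
    using d by (auto simp: differentiable_def)
qed

lemma C_diff_on_SucD: "C_diff_on (Suc n) S f \<Longrightarrow> C_diff_on n S f"
proof (induction n arbitrary: f)
  case 0
  then show ?case
    by (auto intro!: continuous_at_imp_continuous_on differentiable_imp_continuous_within)
next
  case (Suc n)
  then show ?case by (metis C_diff_on.simps(2))
qed

lemma C_diff_on_const: "C_diff_on n S (\<lambda>x. c)"
  by (induction n arbitrary: c) (auto simp: frechet_derivative_const)

lemma C_diff_on_add:
  assumes "open S"
  shows "C_diff_on n S f \<Longrightarrow> C_diff_on n S g \<Longrightarrow> C_diff_on n S (\<lambda>x. f x + g x)"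
proof (induction n arbitrary: f g)
  case 0
  then show ?case by (auto intro: continuous_on_add)
next
  case (Suc n)
  then have d: "frechet_derivative (\<lambda>x. f x + g x) (at x) v = frechet_derivative f (at x) v + frechet_derivative g (at x) v"
    if "x \<in> S" for x v
    using that by (subst frechet_derivative_eqI[OF has_derivative_add[OF has_frechet_derivative has_frechet_derivative]]) auto
  have "C_diff_on n S (\<lambda>x. frechet_derivative (\<lambda>x. f x + g x) (at x) v)" for v
    by (rule C_diff_on_cong[OF assms, of "\<lambda>x. frechet_derivative f (at x) v + frechet_derivative g (at x) v"])
      (use d Suc in auto)
  then show ?case
    using Suc.prems by auto
qed

lemma C_diff_on_mult:
  fixes f g :: "'a::real_normed_vector \<Rightarrow> real"
  assumes "open S"
  shows "C_diff_on n S f \<Longrightarrow> C_diff_on n S g \<Longrightarrow> C_diff_on n S (\<lambda>x. f x * g x)"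
proof (induction n arbitrary: f g)
  case 0
  then show ?case by (auto intro: continuous_on_mult)
next
  case (Suc n)
  then have d: "frechet_derivative (\<lambda>x. f x * g x) (at x) v = f x * frechet_derivative g (at x) v + frechet_derivative f (at x) v * g x"
    if "x \<in> S" for x v
    using that by (subst frechet_derivative_eqI[OF has_derivative_mult[OF has_frechet_derivative has_frechet_derivative]]) auto
  have "C_diff_on n S (\<lambda>x. frechet_derivative (\<lambda>x. f x * g x) (at x) v)" for v
    by (rule C_diff_on_cong[OF assms, of "\<lambda>x. f x * frechet_derivative g (at x) v + frechet_derivative f (at x) v * g x"])
      (use d Suc.prems C_diff_on_SucD[OF Suc.prems(1)] C_diff_on_SucD[OF Suc.prems(2)] in
        \<open>auto intro!: C_diff_on_add[OF assms] Suc.IH\<close>)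
  then show ?case
    using Suc.prems by auto
qed

lemma C_diff_on_inverse:
  fixes f :: "'a::real_normed_vector \<Rightarrow> real"
  assumes "open S" "\<And>x. x \<in> S \<Longrightarrow> f x \<noteq> 0"
  shows "C_diff_on n S f \<Longrightarrow> C_diff_on n S (\<lambda>x. inverse (f x))"
proof (induction n)
  case 0
  then show ?case using assms by (auto intro: continuous_on_inverse)
next
  case (Suc n)
  \<comment> \<open>The sign is written as the factor \<open>- 1\<close>, so that the derivative is
    a product and the product lemma applies to it.\<close>
  have h: "((\<lambda>x. inverse (f x)) has_derivative (\<lambda>v. - 1 * (inverse (f x) * frechet_derivative f (at x) v * inverse (f x)))) (at x)"
    if "x \<in> S" for x
    using Deriv.has_derivative_inverse[of f x "frechet_derivative f (at x)" UNIV] has_frechet_derivative[of f x]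
      Suc.prems that assms(2) by simp
  then have d: "frechet_derivative (\<lambda>x. inverse (f x)) (at x) v = - 1 * (inverse (f x) * frechet_derivative f (at x) v * inverse (f x))"
    if "x \<in> S" for x v
    using frechet_derivative_at that by metis
  have i: "C_diff_on n S (\<lambda>x. inverse (f x))"
    by (rule Suc.IH[OF C_diff_on_SucD[OF Suc.prems]])
  have "C_diff_on n S (\<lambda>x. frechet_derivative (\<lambda>x. inverse (f x)) (at x) v)" for v
    by (rule C_diff_on_cong[OF assms(1), of "\<lambda>x. - 1 * (inverse (f x) * frechet_derivative f (at x) v * inverse (f x))"])
      (simp only: d, intro C_diff_on_mult C_diff_on_const i assms(1), use Suc.prems in simp)
  then show ?case
    using h by (auto simp: differentiable_def)
qed

text \<open>For a linear inner map the directional derivative of the composite along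
  \<open>v\<close> is again a composite with \<open>L\<close>, namely of the derivative along the
  fixed direction \<open>L v\<close>; this closes the induction.\<close>

lemma C_diff_on_linear_comp:
  assumes L: "bounded_linear L" and "open T" "L ` T \<subseteq> S"
  shows "C_diff_on n S f \<Longrightarrow> C_diff_on n T (\<lambda>x. f (L x))"
proof (induction n arbitrary: f)
  case 0
  then have "continuous_on (L ` T) f"
    using continuous_on_subset assms(3) by auto
  then show ?case
    using continuous_on_compose2[of "L ` T" f T L] linear_continuous_on[OF L] by auto
next
  case (Suc n)
  have h: "((\<lambda>x. f (L x)) has_derivative (\<lambda>v. frechet_derivative f (at (L x)) (L v))) (at x)" if "x \<in> T" for x
  proof -
    have "(f has_derivative frechet_derivative f (at (L x))) (at (L x))"
      by (rule has_frechet_derivative) (use Suc.prems assms(3) that in auto)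
    then show ?thesis
      using diff_chain_at[OF bounded_linear_imp_has_derivative[OF L], of f _ x] by (simp add: o_def)
  qed
  then have d: "frechet_derivative (\<lambda>x. f (L x)) (at x) v = frechet_derivative f (at (L x)) (L v)" if "x \<in> T" for x v
    using frechet_derivative_at that by metis
  have "C_diff_on n T (\<lambda>x. frechet_derivative (\<lambda>x. f (L x)) (at x) v)" for v
    by (rule C_diff_on_cong[OF assms(2), of "\<lambda>x. frechet_derivative f (at (L x)) (L v)"])
      (use d Suc.prems Suc.IH[of "\<lambda>x. frechet_derivative f (at x) (L v)"] in auto)
  then show ?case
    using h by (auto simp: differentiable_def)
qed

lemma C_diff_on_subset: "C_diff_on n S f \<Longrightarrow> T \<subseteq> S \<Longrightarrow> C_diff_on n T f"
  by (induction n arbitrary: f) (auto intro: continuous_on_subset)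

text \<open>Needed because smooth adapted coframes exist only near each point.\<close>

lemma C_diff_on_local:
  assumes "\<And>x. x \<in> S \<Longrightarrow> \<exists>U. open U \<and> x \<in> U \<and> C_diff_on n U f"
  shows "C_diff_on n S f"
  using assms
proof (induction n arbitrary: f)
  case 0
  then have "continuous (at x) f" if "x \<in> S" for x
    using that continuous_on_interior[of _ f x] by (metis C_diff_on.simps(1) interior_open)
  then show ?case by (simp add: continuous_at_imp_continuous_on)
next
  case (Suc n)
  then show ?case by (simp only: C_diff_on.simps) (meson)
qed

lemma smooth_on_cong: "open S \<Longrightarrow> (\<And>x. x \<in> S \<Longrightarrow> f x = g x) \<Longrightarrow> smooth_on S f \<Longrightarrow> smooth_on S g"
  using C_diff_on_cong unfolding smooth_on_def by blast

lemma smooth_on_const: "smooth_on S (\<lambda>x. c)"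
  and smooth_on_add: "open S \<Longrightarrow> smooth_on S f \<Longrightarrow> smooth_on S g \<Longrightarrow> smooth_on S (\<lambda>x. f x + g x)"
  and smooth_on_subset: "smooth_on S f \<Longrightarrow> T \<subseteq> S \<Longrightarrow> smooth_on T f"
  and smooth_on_local: "(\<And>x. x \<in> S \<Longrightarrow> \<exists>U. open U \<and> x \<in> U \<and> smooth_on U f) \<Longrightarrow> smooth_on S f"
  unfolding smooth_on_def
  by (auto intro: C_diff_on_const C_diff_on_add C_diff_on_subset)
    (metis C_diff_on_local)

lemma smooth_on_linear_comp:
  "bounded_linear L \<Longrightarrow> open T \<Longrightarrow> L ` T \<subseteq> S \<Longrightarrow> smooth_on S f \<Longrightarrow> smooth_on T (\<lambda>x. f (L x))"
  unfolding smooth_on_def by (simp add: C_diff_on_linear_comp)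

lemma smooth_on_mult: "open S \<Longrightarrow> smooth_on S f \<Longrightarrow> smooth_on S g \<Longrightarrow> smooth_on S (\<lambda>x. f x * g x :: real)"
  and smooth_on_inverse: "open S \<Longrightarrow> (\<And>x. x \<in> S \<Longrightarrow> f x \<noteq> 0) \<Longrightarrow> smooth_on S f
    \<Longrightarrow> smooth_on S (\<lambda>x. inverse (f x :: real))"
  unfolding smooth_on_def by (simp_all add: C_diff_on_mult C_diff_on_inverse)

lemma smooth_on_differentiable: "smooth_on S f \<Longrightarrow> x \<in> S \<Longrightarrow> f differentiable (at x)"
  unfolding smooth_on_def by (metis C_diff_on.simps(2))

lemma smooth_on_derivative: "smooth_on S f \<Longrightarrow> smooth_on S (\<lambda>x. frechet_derivative f (at x) v)"
  unfolding smooth_on_def by (metis C_diff_on.simps(2))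

lemma smooth_on_sum:
  "open S \<Longrightarrow> (\<And>i. i \<in> I \<Longrightarrow> smooth_on S (f i)) \<Longrightarrow> smooth_on S (\<lambda>x. \<Sum>i\<in>I. f i x)"
  by (induction I rule: infinite_finite_induct) (auto intro: smooth_on_const smooth_on_add)

lemma smooth_on_prod:
  "open S \<Longrightarrow> (\<And>i. i \<in> I \<Longrightarrow> smooth_on S (f i)) \<Longrightarrow> smooth_on S (\<lambda>x. \<Prod>i\<in>I. f i x :: real)"
  by (induction I rule: infinite_finite_induct) (auto intro: smooth_on_const smooth_on_mult)

lemma smooth_on_divide: "open S \<Longrightarrow> (\<And>x. x \<in> S \<Longrightarrow> g x \<noteq> 0) \<Longrightarrow> smooth_on S f \<Longrightarrow> smooth_on S g
    \<Longrightarrow> smooth_on S (\<lambda>x. f x / g x :: real)"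
  unfolding divide_inverse by (intro smooth_on_mult smooth_on_inverse)

lemma smooth_on_minus: "open S \<Longrightarrow> smooth_on S f \<Longrightarrow> smooth_on S (\<lambda>x. - f x :: real)"
  using smooth_on_mult[OF _ smooth_on_const[of S "-1"]] by simp

lemma smooth_on_diff: "open S \<Longrightarrow> smooth_on S f \<Longrightarrow> smooth_on S g \<Longrightarrow> smooth_on S (\<lambda>x. f x - g x :: real)"
  using smooth_on_add[OF _ _ smooth_on_minus] by simp

lemma smooth_on_mwedge:
  assumes "open S" "\<And>vs. smooth_on S (\<lambda>x. A x vs)" "\<And>vs. smooth_on S (\<lambda>x. B x vs)"
  shows "smooth_on S (\<lambda>x. (A x \<^bold>\<and> B x) vs)"
  unfolding mwedge_def by (intro smooth_on_sum smooth_on_mult smooth_on_const assms)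

lemma smooth_on_det:
  fixes A :: "'a::real_normed_vector \<Rightarrow> real^'n^'n"
  assumes "open S" "\<And>i j. smooth_on S (\<lambda>x. A x $ i $ j)"
  shows "smooth_on S (\<lambda>x. det (A x))"
  unfolding det_def by (intro smooth_on_sum smooth_on_mult smooth_on_const smooth_on_prod assms)

text \<open>In a chart \<open>ext_d\<close> is the operator \<open>d_at\<close> on form-valued functions on a vector space.\<close>

definition d_at :: "('v::real_normed_vector \<Rightarrow> 'v mform) \<Rightarrow> 'v \<Rightarrow> 'v mform" where
  "d_at F x vs = (\<Sum>l<length vs. (- 1) ^ l *
      frechet_derivative (\<lambda>y. F y (take l vs @ drop (Suc l) vs)) (at x) (vs ! l))"

definition ddir :: "('v::real_normed_vector \<Rightarrow> 'v mform) \<Rightarrow> 'v \<Rightarrow> 'v \<Rightarrow> 'v mform" where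
  "ddir F x v vs = frechet_derivative (\<lambda>y. F y vs) (at x) v"

lemma d_at_Nil: "d_at F x [] = 0"
  by (simp add: d_at_def)

text \<open>Cartan's formula for a constant vector field, whose Lie derivative is the directional
  derivative.\<close>

lemma d_at_Cons: "d_at F x (v # vs) = ddir F x v vs - d_at (\<lambda>y. iprod v (F y)) x vs"
  by (simp add: d_at_def ddir_def iprod_def sum.lessThan_Suc_shift sum_negf del: sum.lessThan_Suc)

lemma has_derivative_ddir: "(\<lambda>y. F y vs) differentiable (at x) \<Longrightarrow>
   ((\<lambda>y. F y vs) has_derivative (\<lambda>v. ddir F x v vs)) (at x)"
  by (simp add: ddir_def frechet_derivative_works)

lemma differentiable_mwedge:
  fixes F G :: "'v::real_normed_vector \<Rightarrow> 'v mform"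
  assumes "\<And>vs. (\<lambda>y. F y vs) differentiable (at x)" "\<And>vs. (\<lambda>y. G y vs) differentiable (at x)"
  shows "(\<lambda>y. (F y \<^bold>\<and> G y) vs) differentiable (at x)"
  unfolding mwedge_def using assms by (intro derivative_intros) auto

lemma ddir_mwedge:
  fixes F G :: "'v::real_normed_vector \<Rightarrow> 'v mform"
  assumes "\<And>vs. (\<lambda>y. F y vs) differentiable (at x)" "\<And>vs. (\<lambda>y. G y vs) differentiable (at x)"
  shows "ddir (\<lambda>y. F y \<^bold>\<and> G y) x v = ddir F x v \<^bold>\<and> G x + F x \<^bold>\<and> ddir G x v"
proof
  fix vs
  have "((\<lambda>y. (F y \<^bold>\<and> G y) vs) has_derivative (\<lambda>v. (ddir F x v \<^bold>\<and> G x + F x \<^bold>\<and> ddir G x v) vs)) (at x)"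
    unfolding mwedge_def plus_fun_apply
    by (rule derivative_eq_intros has_derivative_ddir assms refl)+
      (simp add: algebra_simps sum.distrib)
  then show "ddir (\<lambda>y. F y \<^bold>\<and> G y) x v vs = (ddir F x v \<^bold>\<and> G x + F x \<^bold>\<and> ddir G x v) vs"
    by (simp only: ddir_def[of "\<lambda>y. F y \<^bold>\<and> G y"] frechet_derivative_eqI)
qed

lemma d_at_add:
  assumes "\<And>vs. (\<lambda>y. F y vs) differentiable (at x)" "\<And>vs. (\<lambda>y. G y vs) differentiable (at x)"
  shows "d_at (\<lambda>y. F y + G y) x = d_at F x + d_at G x"
proof
  have "frechet_derivative (\<lambda>y. F y vs + G y vs) (at x)
      = (\<lambda>v. frechet_derivative (\<lambda>y. F y vs) (at x) v + frechet_derivative (\<lambda>y. G y vs) (at x) v)" for vs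
    by (intro frechet_derivative_eqI has_derivative_add has_frechet_derivative assms)
  then show "d_at (\<lambda>y. F y + G y) x vs = (d_at F x + d_at G x) vs" for vs
    by (simp add: d_at_def algebra_simps sum.distrib)
qed

lemma d_at_scale:
  assumes "\<And>vs. (\<lambda>y. F y vs) differentiable (at x)"
  shows "d_at (\<lambda>y vs. c * F y vs) x = (\<lambda>vs. c * d_at F x vs)"
proof -
  have "((\<lambda>y. c * F y vs) has_derivative (\<lambda>v. c * frechet_derivative (\<lambda>y. F y vs) (at x) v)) (at x)" for vs
    using assms by (intro has_derivative_mult_right) (simp add: frechet_derivative_works)
  then have "frechet_derivative (\<lambda>y. c * F y vs) (at x) = (\<lambda>v. c * frechet_derivative (\<lambda>y. F y vs) (at x) v)" for vs
    by (rule frechet_derivative_eqI)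
  then show ?thesis
    by (auto simp: fun_eq_iff d_at_def sum_distrib_left algebra_simps intro!: sum.cong)
qed

lemma parity_parity [simp]: "parity (parity A) = A"
  by (simp add: parity_def fun_eq_iff mult.assoc[symmetric] power_mult_distrib[symmetric])

lemma parity_mwedge_aux: "iprod v (parity A) = - parity (iprod v A)"
  by (simp add: iprod_def parity_def fun_eq_iff)

text \<open>The derivative at \<open>vs\<close> uses values on lists that are shorter by one, hence
  the sign.\<close>

lemma d_at_parity:
  "d_at (\<lambda>y. parity (F y)) x = - parity (d_at F x)"
  if "\<And>vs. (\<lambda>y. F y vs) differentiable (at x)"
proof
  fix vs
  have "((\<lambda>y. c * F y vs) has_derivative (\<lambda>v. c * frechet_derivative (\<lambda>y. F y vs) (at x) v)) (at x)" for vs c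
    using that by (intro has_derivative_mult_right) (simp add: frechet_derivative_works)
  then have d: "frechet_derivative (\<lambda>y. c * F y vs) (at x) = (\<lambda>v. c * frechet_derivative (\<lambda>y. F y vs) (at x) v)" for vs c
    by (rule frechet_derivative_eqI)
  show "d_at (\<lambda>y. parity (F y)) x vs = (- parity (d_at F x)) vs"
    unfolding d_at_def parity_def fun_Compl_def sum_distrib_left d sum_negf[symmetric]
    by (rule sum.cong) (auto simp: mult.assoc[symmetric] minus_one_power_iff)
qed

text \<open>Induction on the arguments, combining Cartan's formula with the contraction rule. The
  induction hypothesis is applied to \<open>iprod v (F y)\<close> and to
  \<open>parity (F y)\<close>, so no degree may be fixed in the statement.\<close>

lemma d_at_mwedge:
  assumes "\<And>vs. (\<lambda>y. F y vs) differentiable (at x)" "\<And>vs. (\<lambda>y. G y vs) differentiable (at x)"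
  shows "d_at (\<lambda>y. F y \<^bold>\<and> G y) x = d_at F x \<^bold>\<and> G x + parity (F x) \<^bold>\<and> d_at G x"
proof
  fix vs
  show "d_at (\<lambda>y. F y \<^bold>\<and> G y) x vs = (d_at F x \<^bold>\<and> G x + parity (F x) \<^bold>\<and> d_at G x) vs"
    using assms
  proof (induction vs arbitrary: F G)
    case Nil
    then show ?case by (simp add: d_at_Nil)
  next
    case (Cons v vs)
    let ?dF = "d_at F x" and ?dG = "d_at G x"
    have dp: "\<And>vs. (\<lambda>y. parity (F y) vs) differentiable (at x)"
      using Cons.prems unfolding parity_def by (intro derivative_intros) auto
    have di: "\<And>vs. (\<lambda>y. iprod v (F y) vs) differentiable (at x)" "\<And>vs. (\<lambda>y. iprod v (G y) vs) differentiable (at x)"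
      using Cons.prems unfolding iprod_def by auto
    have i: "iprod v (d_at F x) = ddir F x v - d_at (\<lambda>y. iprod v (F y)) x"
      "iprod v (d_at G x) = ddir G x v - d_at (\<lambda>y. iprod v (G y)) x"
      by (simp_all add: iprod_def[of v "d_at _ x"] fun_eq_iff d_at_Cons)
    have "(\<lambda>y. iprod v (F y \<^bold>\<and> G y)) = (\<lambda>y. iprod v (F y) \<^bold>\<and> G y + parity (F y) \<^bold>\<and> iprod v (G y))"
      by (simp add: iprod_def[of v "_ \<^bold>\<and> _"] mwedge_Cons fun_eq_iff)
    then have "d_at (\<lambda>y. iprod v (F y \<^bold>\<and> G y)) x vs
      = d_at (\<lambda>y. iprod v (F y) \<^bold>\<and> G y) x vs + d_at (\<lambda>y. parity (F y) \<^bold>\<and> iprod v (G y)) x vs"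
      using d_at_add[OF differentiable_mwedge[OF di(1) Cons.prems(2)] differentiable_mwedge[OF dp di(2)]]
      by simp
    also have "\<dots> = (d_at (\<lambda>y. iprod v (F y)) x \<^bold>\<and> G x) vs + (parity (iprod v (F x)) \<^bold>\<and> ?dG) vs
       - (parity ?dF \<^bold>\<and> iprod v (G x)) vs + (F x \<^bold>\<and> d_at (\<lambda>y. iprod v (G y)) x) vs"
      using Cons.IH[OF di(1) Cons.prems(2)] Cons.IH[OF dp di(2)]
      by (simp add: d_at_parity[OF Cons.prems(1)] mwedge_minus_left)
    finally show ?case
      by (simp add: d_at_Cons ddir_mwedge[OF Cons.prems] mwedge_Cons i parity_mwedge_aux mwedge_minus_left
          mwedge_diff_left mwedge_diff_right)
  qed
qed

lemma ext_d_d_at: "ext_d M \<omega> i p = d_at (\<lambda>x. \<omega> i (mf_inv M i x)) (mf_map M i p)"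
  by (simp add: fun_eq_iff ext_d_def d_at_def)

section \<open>Linear algebra of SU(3)-structures\<close>

text \<open>Cramer's rule writes the dual frame as quotients of determinants in the coefficients of
  the coframe, which exhibits it as smooth.\<close>

lemma dual_frame_smooth:
  fixes e :: "'x::real_normed_vector \<Rightarrow> nat \<Rightarrow> (real^6) mform"
  assumes U: "open U" and e: "\<And>x. x \<in> U \<Longrightarrow> coframe6 (e x)"
    and sm: "\<And>k vs. k \<in> {1..6} \<Longrightarrow> smooth_on U (\<lambda>x. e x k vs)"
  shows "\<exists>E. (\<forall>x\<in>U. dual_frame 6 (\<lambda>k v. e x k [v]) (E x)) \<and>
    (\<forall>k l. smooth_on U (\<lambda>x. E x k $ l))"
proof -
  \<comment> \<open>Coframes are indexed by numbers, matrices by the type \<open>6\<close>; any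
    bijection \<open>h\<close> with inverse \<open>g\<close> will do.\<close>
  have "card (UNIV :: 6 set) = card {1..6::nat}"
    by simp
  then obtain h where h: "bij_betw h (UNIV :: 6 set) {1..6::nat}"
    using finite_same_card_bij[of "UNIV :: 6 set" "{1..6::nat}"] by auto
  define g where "g = inv_into UNIV h"
  have hg: "h (g k) = k" if "k \<in> {1..6}" for k
    using that h by (simp add: g_def bij_betw_inv_into_right)
  have gh: "g (h r) = r" for r
    using h by (simp add: g_def bij_betw_inv_into_left)
  have h16: "h r \<in> {1..6}" for r
    using h bij_betwE by blast
  define P :: "'x \<Rightarrow> real^6^6" where "P x = (\<chi> r j. e x (h r) [axis j 1])" for x
  have lin: "linear (\<lambda>v. e x k [v])" if "x \<in> U" "k \<in> {1..6}" for x k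
  proof -
    have "alternating 1 (e x k)"
      using e[OF that(1)] that(2) by (simp add: coframe6_def)
    then show ?thesis
      unfolding alternating_iff by (auto intro: multilinear_Cons skew_multilinear)
  qed
  have Pv: "P x *v v = (\<chi> r. e x (h r) [v])" if "x \<in> U" for x v
  proof -
    have "e x (h r) [v] = (\<Sum>j\<in>UNIV. P x $ r $ j * v $ j)" for r
    proof -
      have "e x (h r) [v] = e x (h r) [(\<Sum>j\<in>UNIV. v $ j *\<^sub>R axis j 1)]"
        using basis_expansion[of v] by (simp add: scalar_mult_eq_scaleR)
      also have "\<dots> = (\<Sum>j\<in>UNIV. v $ j *\<^sub>R e x (h r) [axis j 1])"
        by (simp add: linear_sum[OF lin[OF that h16[of r]]] linear_scale[OF lin[OF that h16[of r]]])
      finally show ?thesis by (simp add: P_def mult.commute)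
    qed
    then show ?thesis by (simp add: matrix_vector_mult_def vec_eq_iff)
  qed
  have ker: "v = 0" if "x \<in> U" "\<forall>k\<in>{1..6}. e x k [v] = 0" for x v
    using e[OF that(1)] that(2) by (simp add: coframe6_def)
  have det: "det (P x) \<noteq> 0" if "x \<in> U" for x
  proof -
    have "v = 0" if "P x *v v = 0" for v
    proof (rule ker[OF \<open>x \<in> U\<close>], rule ballI)
      fix k :: nat assume "k \<in> {1..6}"
      then show "e x k [v] = 0"
        using that hg by (simp add: Pv[OF \<open>x \<in> U\<close>] vec_eq_iff) metis
    qed
    then show ?thesis
      by (metis invertible_det_nz invertible_left_inverse matrix_left_invertible_ker)
  qed
  \<comment> \<open>Cramer's solution of \<open>P x *v E x k = axis (g k) 1\<close>.\<close>
  define E where "E x k = (\<chi> l. det (\<chi> i j. if j = l then axis (g k) 1 $ i else P x $ i $ j) / det (P x))" for x k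
  have PE: "P x *v E x k = axis (g k) 1" if "x \<in> U" for x k
    using cramer[OF det[OF that], of "E x k" "axis (g k) 1"] by (simp add: E_def)
  have eE: "e x k [E x l] = (if k = l then 1 else 0)" if "x \<in> U" "k \<in> {1..6}" "l \<in> {1..6}" for x k l
  proof -
    have "e x (h (g k)) [E x l] = axis (g l) 1 $ g k"
      using PE[OF that(1), of l] by (simp add: Pv[OF that(1)] vec_eq_iff)
    then show ?thesis
      using that hg by (auto simp: axis_def) metis+
  qed
  have "dual_frame 6 (\<lambda>k v. e x k [v]) (E x)" if "x \<in> U" for x
  proof -
    have "v - (\<Sum>k = 1..6. e x k [v] *\<^sub>R E x k) = 0" for v
    proof (rule ker[OF that], rule ballI)
      fix k :: nat assume k: "k \<in> {1..6}"
      have "e x k [(\<Sum>l = 1..6. e x l [v] *\<^sub>R E x l)] = (\<Sum>l = 1..6. e x l [v] * e x k [E x l])"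
        by (simp add: linear_sum[OF lin[OF that k]] linear_scale[OF lin[OF that k]])
      also have "\<dots> = (\<Sum>l = 1..6. if l = k then e x l [v] else 0)"
        by (intro sum.cong refl) (use eE[OF that k] in auto)
      finally show "e x k [v - (\<Sum>k = 1..6. e x k [v] *\<^sub>R E x k)] = 0"
        using linear_diff[OF lin[OF that k]] k by simp
    qed
    then show ?thesis
      using that lin eE by (auto simp: dual_frame_def)
  qed
  moreover have "smooth_on U (\<lambda>x. E x k $ l)" for k l
  proof -
    have "smooth_on U (\<lambda>x. P x $ i $ j)" for i j
      using sm[OF h16] by (simp add: P_def)
    then have "smooth_on U (\<lambda>x. if b then c else P x $ i $ j)" for b c i j
      by (cases b) (simp_all add: smooth_on_const)
    then show ?thesis
      using \<open>\<And>i j. smooth_on U (\<lambda>x. P x $ i $ j)\<close>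
      by (simp add: E_def) (intro smooth_on_divide U smooth_on_det det; simp)
  qed
  ultimately show ?thesis by blast
qed

text \<open>The case of a constant family of coframes over the real line.\<close>

lemma coframe6_dual_frame: "coframe6 e \<Longrightarrow> \<exists>E. dual_frame 6 (\<lambda>k v. e k [v]) E"
  using dual_frame_smooth[of "UNIV :: real set" "\<lambda>x. e"] by (auto simp: smooth_on_const)

text \<open>The frame vectors move with \<open>x\<close>, so they are expanded one at a time in the
  standard basis; what remains are smooth coefficients times contractions with constant
  vectors.\<close>

lemma smooth_on_frame:
  fixes E :: "'x::real_normed_vector \<Rightarrow> nat \<Rightarrow> real^'n"
  assumes U: "open U" and E: "\<And>k l. smooth_on U (\<lambda>x. E x k $ l)"
    and "\<And>x. x \<in> U \<Longrightarrow> multilinear (A x)" "\<And>vs. smooth_on U (\<lambda>x. A x vs)"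
  shows "smooth_on U (\<lambda>x. A x (map (E x) ks @ us))"
  using assms(3,4)
proof (induction ks arbitrary: A)
  case (Cons k ks)
  have "A x (map (E x) (k # ks) @ us) = (\<Sum>l\<in>UNIV. E x k $ l * iprod (axis l 1) (A x) (map (E x) ks @ us))"
    if "x \<in> U" for x
  proof -
    have lin: "linear (\<lambda>v. A x (v # map (E x) ks @ us))"
      by (rule multilinear_Cons[OF Cons.prems(1)[OF that]])
    have "A x (E x k # map (E x) ks @ us) = A x ((\<Sum>l\<in>UNIV. E x k $ l *\<^sub>R axis l 1) # map (E x) ks @ us)"
      using basis_expansion[of "E x k"] by (simp add: scalar_mult_eq_scaleR)
    then show ?thesis
      by (simp add: linear_sum[OF lin] linear_scale[OF lin] iprod_def)
  qed
  moreover have "smooth_on U (\<lambda>x. \<Sum>l\<in>UNIV. E x k $ l * iprod (axis l 1) (A x) (map (E x) ks @ us))"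
  proof (intro smooth_on_sum smooth_on_mult U E)
    show "smooth_on U (\<lambda>x. iprod (axis l 1) (A x) (map (E x) ks @ us))" for l
    proof (rule Cons.IH)
      show "multilinear (iprod (axis l 1) (A x))" if "x \<in> U" for x
        by (rule multilinear_iprod[OF Cons.prems(1)[OF that]])
      show "smooth_on U (\<lambda>x. iprod (axis l 1) (A x) vs)" for vs
        unfolding iprod_def by (rule Cons.prems(2))
    qed
  qed
  ultimately show ?case
    using smooth_on_cong[OF U, of "\<lambda>x. \<Sum>l\<in>UNIV. E x k $ l * iprod (axis l 1) (A x) (map (E x) ks @ us)"] by auto
qed (simp add: assms)

lemma mwedge_comp_map: "(A \<^bold>\<and> B) \<circ> map E = (A \<circ> map E) \<^bold>\<and> (B \<circ> map E)"
  by (simp add: fun_eq_iff mwedge_map o_def)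

lemma of_degree_comp_map: "of_degree k A \<Longrightarrow> of_degree k (A \<circ> map E)"
  by (simp add: of_degree_def)

lemma shuf_comp_map: "of_degree k A \<Longrightarrow> (A \<^bold>\<and> B) \<circ> map E = shuf k (A \<circ> map E) (B \<circ> map E)"
  unfolding mwedge_comp_map by (rule mwedge_shuf) (rule of_degree_comp_map)

lemma alternating_of_degree: "alternating k A \<Longrightarrow> of_degree k A"
  by (simp add: alternating_iff)

lemma comp_plus: "(A + B) \<circ> f = (A \<circ> f) + (B \<circ> f)" "(A - B) \<circ> f = (A \<circ> f) - (B \<circ> f)" "(- A) \<circ> f = - (A \<circ> f)"
  for A B :: "'a \<Rightarrow> real"
  by (auto simp: fun_eq_iff)

lemma adapted_alternating:
  assumes "adapted e w a b"
  shows "alternating 2 w" "alternating 3 a" "alternating 3 b"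
proof -
  have e: "alternating 1 (e k)" if "k \<in> {1..6}" for k
    using assms that by (simp add: adapted_def coframe6_def)
  have e2: "alternating 2 (e k \<^bold>\<and> e l)" if "k \<in> {1..6}" "l \<in> {1..6}" for k l
    using alternating_mwedge[OF e[OF that(1)] e[OF that(2)]] by (simp only: one_add_one)
  have e3: "alternating 3 (e k \<^bold>\<and> e l \<^bold>\<and> e m)" if "k \<in> {1..6}" "l \<in> {1..6}" "m \<in> {1..6}" for k l m
    using alternating_mwedge[OF e[OF that(1)] e2[OF that(2,3)]] by (simp only: semiring_norm)
  show "alternating 2 w" "alternating 3 a" "alternating 3 b"
    using assms unfolding adapted_def
    by (auto intro!: alternating_add alternating_diff alternating_minus e2 e3)
qed

lemma adapted_tables:
  assumes ad: "adapted e w a b" and E: "dual_frame 6 (\<lambda>k v. e k [v]) E"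
  shows "agree 6 2 (w \<circ> map E) tw" "agree 6 3 (a \<circ> map E) ta" "agree 6 3 (b \<circ> map E) tb"
proof -
  have d: "of_degree 1 (e k)" if "k \<in> {1..6}" for k
    using ad that by (simp add: adapted_def coframe6_def alternating_of_degree)
  have s: "(e k \<^bold>\<and> B) \<circ> map E = shuf 1 (e k \<circ> map E) (B \<circ> map E)" if "k \<in> {1..6}" for k B
    by (rule shuf_comp_map[OF d[OF that]])
  note comps [simp] and One_nat_def [simp del]
  have ee: "e k [E l] = (if k = l then 1 else 0)" if "k \<in> {1..6}" "l \<in> {1..6}" for k l
    using E that unfolding dual_frame_def by blast
  have w: "w \<circ> map E = ((e 1 \<^bold>\<and> e 2) \<circ> map E) + ((e 3 \<^bold>\<and> e 4) \<circ> map E) + ((e 5 \<^bold>\<and> e 6) \<circ> map E)"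
    using ad by (simp only: adapted_def comp_plus)
  show "agree 6 2 (w \<circ> map E) tw"
    unfolding w by (simp add: s ee)
  have a: "a \<circ> map E = ((e 1 \<^bold>\<and> e 3 \<^bold>\<and> e 5) \<circ> map E) - ((e 1 \<^bold>\<and> e 4 \<^bold>\<and> e 6) \<circ> map E)
     - ((e 2 \<^bold>\<and> e 3 \<^bold>\<and> e 6) \<circ> map E) - ((e 2 \<^bold>\<and> e 4 \<^bold>\<and> e 5) \<circ> map E)"
    using ad by (simp only: adapted_def comp_plus)
  show "agree 6 3 (a \<circ> map E) ta"
    unfolding a by (simp add: s ee)
  have b: "b \<circ> map E = - ((e 2 \<^bold>\<and> e 4 \<^bold>\<and> e 6) \<circ> map E) + ((e 2 \<^bold>\<and> e 3 \<^bold>\<and> e 5) \<circ> map E)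
     + ((e 1 \<^bold>\<and> e 4 \<^bold>\<and> e 5) \<circ> map E) + ((e 1 \<^bold>\<and> e 3 \<^bold>\<and> e 6) \<circ> map E)"
    using ad by (simp only: adapted_def comp_plus)
  show "agree 6 3 (b \<circ> map E) tb"
    unfolding b by (simp add: s ee)
qed


lemma su3_contraction:
  assumes ad: "adapted e w a b" and E: "dual_frame 6 (\<lambda>k v. e k [v]) E"
  shows "(iprod u a \<^bold>\<and> iprod v a \<^bold>\<and> w) (map E [1,2,3,4,5,6]) = 2 * gram 6 (\<lambda>k v. e k [v]) u v"
proof -
  have d: "of_degree 1 (e k)" if "k \<in> {1..6}" for k
    using ad that by (simp add: adapted_def coframe6_def alternating_of_degree)
  have ee: "e k [E l] = (if k = l then 1 else 0)" if "k \<in> {1..6}" "l \<in> {1..6}" for k l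
    using E that unfolding dual_frame_def by blast
  have s: "(e k \<^bold>\<and> B) = shuf 1 (e k) B" if "k \<in> {1..6}" for k B
    by (rule mwedge_shuf[OF d[OF that]])
  define F where "F u js = a (u # map E js)" for u js
  note comps [simp] and One_nat_def [simp del]
  \<comment> \<open>The components of the contraction of \<open>a\<close> by \<open>u\<close>: one
    covector for each of the twelve index pairs that occur.\<close>
  have F: "agree 6 2 (F u) (\<lambda>js. if js = [3,5] then e 1 [u] else if js = [4,6] then - e 1 [u]
    else if js = [3,6] then - e 2 [u] else if js = [4,5] then - e 2 [u]
    else if js = [1,5] then - e 3 [u] else if js = [2,6] then e 3 [u]
    else if js = [1,6] then e 4 [u] else if js = [2,5] then e 4 [u]
    else if js = [1,3] then e 5 [u] else if js = [2,4] then - e 5 [u]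
    else if js = [1,4] then - e 6 [u] else if js = [2,3] then - e 6 [u] else 0)" for u
  proof -
    have a: "a = (e 1 \<^bold>\<and> e 3 \<^bold>\<and> e 5) - (e 1 \<^bold>\<and> e 4 \<^bold>\<and> e 6) - (e 2 \<^bold>\<and> e 3 \<^bold>\<and> e 6) - (e 2 \<^bold>\<and> e 4 \<^bold>\<and> e 5)"
      using ad by (simp only: adapted_def)
    show ?thesis
      unfolding F_def a by (simp add: s ee)
  qed
  note F [simplified, simp] 
  note adapted_tables(1)[OF ad E, simplified, simp]
  have da: "of_degree 2 (iprod x a)" for x
  proof -
    have "of_degree (Suc 2) a"
      using adapted_alternating(2)[OF ad] by (simp add: alternating_of_degree)
    then show ?thesis by (rule of_degree_iprod)
  qed
  have c: "iprod x a \<circ> map E = F x" for x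
    by (simp add: F_def fun_eq_iff)
  have "(iprod u a \<^bold>\<and> iprod v a \<^bold>\<and> w) (map E [1,2,3,4,5,6])
      = ((iprod u a \<^bold>\<and> iprod v a \<^bold>\<and> w) \<circ> map E) [1,2,3,4,5,6]"
    by (simp only: o_def)
  also have "\<dots> = shuf 2 (F u) (shuf 2 (F v) (w \<circ> map E)) [1,2,3,4,5,6]"
    by (simp only: shuf_comp_map[OF da] c)
  also have "\<dots> = 2 * (e 1 [u] * e 1 [v] + e 2 [u] * e 2 [v] + e 3 [u] * e 3 [v] + e 4 [u] * e 4 [v]
      + e 5 [u] * e 5 [v] + e 6 [u] * e 6 [v])"
    by (simp add: algebra_simps)
  also have "{1..6::nat} = {1,2,3,4,5,6}"
    by auto
  then have "2 * (e 1 [u] * e 1 [v] + e 2 [u] * e 2 [v] + e 3 [u] * e 3 [v] + e 4 [u] * e 4 [v]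
      + e 5 [u] * e 5 [v] + e 6 [u] * e 6 [v]) = 2 * gram 6 (\<lambda>k v. e k [v]) u v"
    by (simp add: gram_def)
  finally show ?thesis .
qed

lemma su3_volume:
  assumes ad: "adapted e w a b" and E: "dual_frame 6 (\<lambda>k v. e k [v]) E"
  shows "(w \<^bold>\<and> w \<^bold>\<and> w) (map E [1,2,3,4,5,6]) = 6"
proof -
  note comps [simp] and One_nat_def [simp del]
  note adapted_tables(1)[OF ad E, simplified, simp]
  have dw: "of_degree 2 w"
    using adapted_alternating(1)[OF ad] by (simp add: alternating_of_degree)
  have "(w \<^bold>\<and> w \<^bold>\<and> w) (map E [1,2,3,4,5,6])
      = ((w \<^bold>\<and> w \<^bold>\<and> w) \<circ> map E) [1,2,3,4,5,6]"
    by (simp only: o_def)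
  also have "\<dots> = shuf 2 (w \<circ> map E) (shuf 2 (w \<circ> map E) (w \<circ> map E)) [1,2,3,4,5,6]"
    by (simp only: shuf_comp_map[OF dw])
  also have "\<dots> = 6"
    by simp
  finally show ?thesis .
qed

text \<open>The metric is determined by the forms because \<open>(\<iota>\<^sub>u a) \<and> (\<iota>\<^sub>v a) \<and> w = 2 g(u, v) w\<^sup>3/3!\<close>.\<close>

lemma adapted_gram_unique:
  assumes ad: "adapted e w a b" and ad': "adapted e' w a b"
  shows "gram 6 (\<lambda>k v. e k [v]) = gram 6 (\<lambda>k v. e' k [v])"
proof (intro ext)
  fix u v
  obtain E where E: "dual_frame 6 (\<lambda>k v. e k [v]) E"
    using coframe6_dual_frame[of e] ad by (auto simp: adapted_def)
  obtain E' where E': "dual_frame 6 (\<lambda>k v. e' k [v]) E'"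
    using coframe6_dual_frame[of e'] ad' by (auto simp: adapted_def)
  let ?g = "gram 6 (\<lambda>k v. e k [v]) u v"
  have a3: "alternating 2 (iprod x a)" for x
  proof -
    have "alternating (Suc 2) a"
      using adapted_alternating(2)[OF ad] by simp
    then show ?thesis
      by (simp add: alternating_iff of_degree_iprod skew_iprod del: One_nat_def)
  qed
  note w2 = adapted_alternating(1)[OF ad]
  have X: "alternating 6 (iprod u a \<^bold>\<and> iprod v a \<^bold>\<and> w)"
    using alternating_mwedge[OF a3 alternating_mwedge[OF a3 w2]] by simp
  \<comment> \<open>The cube of \<open>w\<close> takes the value 6 on the frame, so the factor
    \<open>?g / 3\<close> matches the value \<open>2 * ?g\<close> of the contraction.\<close>
  have Y: "alternating 6 (\<lambda>vs. ?g / 3 * (w \<^bold>\<and> w \<^bold>\<and> w) vs)"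
    by (rule alternating_scale) (use alternating_mwedge[OF w2 alternating_mwedge[OF w2 w2]] in simp)
  have c6: "combs 6 [1..<Suc 6] = [[1,2,3,4,5,6::nat]]"
    by (simp add: comps del: One_nat_def)
  have "(iprod u a \<^bold>\<and> iprod v a \<^bold>\<and> w) = (\<lambda>vs. ?g / 3 * (w \<^bold>\<and> w \<^bold>\<and> w) vs)"
    by (rule alternating_eqI[OF E X Y])
      (simp only: agree_def c6 list.set ball_simps insert_iff empty_iff o_def su3_contraction[OF ad E] su3_volume[OF ad E]; simp)
  \<comment> \<open>In this identity of forms \<open>e\<close> survives only in the number
    \<open>?g\<close>; evaluating both sides on the frame dual to \<open>e'\<close> gives the other
    metric.\<close>
  then show "?g = gram 6 (\<lambda>k v. e' k [v]) u v"
    using su3_contraction[OF ad' E', of u v] su3_volume[OF ad' E'] by simp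
qed

text \<open>Uniqueness of the metric makes the definite description in \<open>su3_metric\<close>
  meaningful, and any adapted coframe at the point computes it.\<close>

lemma su3_metric_eq:
  assumes ad: "adapted e (\<omega> i p) (\<psi>\<^sub>p i p) (\<psi>\<^sub>m i p)"
  shows "su3_metric \<omega> \<psi>\<^sub>p \<psi>\<^sub>m i p = gram 6 (\<lambda>k v. e k [v])"
  unfolding su3_metric_def
proof (rule the_equality)
  show "\<forall>e'. adapted e' (\<omega> i p) (\<psi>\<^sub>p i p) (\<psi>\<^sub>m i p) \<longrightarrow>
      gram 6 (\<lambda>k v. e k [v]) = (\<lambda>u v. \<Sum>k = 1..6. e' k [u] * e' k [v])"
    unfolding gram_def[abs_def, symmetric]
    using adapted_gram_unique[OF ad] by (simp add: gram_def[abs_def])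
  show "g = gram 6 (\<lambda>k v. e k [v])"
    if "\<forall>e. adapted e (\<omega> i p) (\<psi>\<^sub>p i p) (\<psi>\<^sub>m i p) \<longrightarrow> g = (\<lambda>u v. \<Sum>k = 1..6. e k [u] * e k [v])" for g
    using that ad by (auto simp: gram_def fun_eq_iff)
qed

lemma mwedge_1_skew:
  assumes A: "of_degree 1 A" and B: "of_degree 1 B"
  shows "A \<^bold>\<and> B = - (B \<^bold>\<and> A)"
proof
  fix vs
  show "(A \<^bold>\<and> B) vs = (- (B \<^bold>\<and> A)) vs"
  proof (cases "length vs = 1 + 1")
    case True
    then obtain x y where "vs = [x, y]"
      by (auto simp: numeral_2_eq_2 length_Suc_conv)
    then show ?thesis
      unfolding mwedge_shuf[OF A] mwedge_shuf[OF B] fun_Compl_def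
      by (simp add: shuf_simps iprod_def del: One_nat_def)
  next
    case False
    then show ?thesis
      using of_degree_mwedge[OF A B] of_degree_mwedge[OF B A] by (simp add: of_degree_def)
  qed
qed

definition rot :: "real \<Rightarrow> real \<Rightarrow> (nat \<Rightarrow> 'v mform) \<Rightarrow> nat \<Rightarrow> 'v mform" where
  "rot \<alpha> \<beta> e k = (if k = 1 then (\<lambda>vs. \<alpha> * e 1 vs) - (\<lambda>vs. \<beta> * e 2 vs)
     else if k = 2 then (\<lambda>vs. \<beta> * e 1 vs) + (\<lambda>vs. \<alpha> * e 2 vs) else e k)"

text \<open>In the complex coframe \<open>z\<^sub>1 = e\<^sub>1 + i e\<^sub>2\<close>, \<open>z\<^sub>2 = e\<^sub>3 + i e\<^sub>4\<close>, \<open>z\<^sub>3 = e\<^sub>5 + i e\<^sub>6\<close> one has \<open>a + i b = z\<^sub>1 \<and> z\<^sub>2 \<and> z\<^sub>3\<close>,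
  so multiplying \<open>z\<^sub>1\<close> by the unit number \<open>\<alpha> + i \<beta>\<close> rotates \<open>a + i b\<close> by it.\<close>

lemma adapted_rot:
  assumes ad: "adapted e w a b" and ab: "\<alpha>\<^sup>2 + \<beta>\<^sup>2 = 1"
  shows "adapted (rot \<alpha> \<beta> e) w ((\<lambda>vs. \<alpha> * a vs) - (\<lambda>vs. \<beta> * b vs)) ((\<lambda>vs. \<alpha> * b vs) + (\<lambda>vs. \<beta> * a vs))"
proof -
  have e: "alternating 1 (e k)" if "k \<in> {1..6}" for k
    using ad that by (simp add: adapted_def coframe6_def)
  have r: "rot \<alpha> \<beta> e 1 = (\<lambda>vs. \<alpha> * e 1 vs) - (\<lambda>vs. \<beta> * e 2 vs)" "rot \<alpha> \<beta> e 2 = (\<lambda>vs. \<beta> * e 1 vs) + (\<lambda>vs. \<alpha> * e 2 vs)"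
    "rot \<alpha> \<beta> e 3 = e 3" "rot \<alpha> \<beta> e 4 = e 4" "rot \<alpha> \<beta> e 5 = e 5" "rot \<alpha> \<beta> e 6 = e 6"
    by (simp_all add: rot_def del: One_nat_def)
  have cf: "coframe6 (rot \<alpha> \<beta> e)"
    unfolding coframe6_def
  proof (intro conjI ballI allI impI)
    fix k :: nat assume "k \<in> {1..6}"
    then show "alternating 1 (rot \<alpha> \<beta> e k)"
      using e e[of 1] e[of 2] unfolding rot_def by (auto intro!: alternating_add alternating_diff alternating_scale simp del: One_nat_def)
  next
    fix v assume v: "\<forall>k\<in>{1..6}. rot \<alpha> \<beta> e k [v] = 0"
    have "\<alpha> * e 1 [v] - \<beta> * e 2 [v] = 0" "\<beta> * e 1 [v] + \<alpha> * e 2 [v] = 0"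
      using bspec[OF v, of 1] bspec[OF v, of 2] unfolding r by (simp_all add: fun_diff_def plus_fun_def)
    then have "(\<alpha>\<^sup>2 + \<beta>\<^sup>2) * e 1 [v] = 0" "(\<alpha>\<^sup>2 + \<beta>\<^sup>2) * e 2 [v] = 0"
      by algebra+
    then have "e 1 [v] = 0" "e 2 [v] = 0"
      using ab by simp_all
    moreover have "e k [v] = 0" if "k \<in> {1..6}" "k \<noteq> 1" "k \<noteq> 2" for k
      using bspec[OF v that(1)] that by (simp add: rot_def)
    ultimately have "\<forall>k\<in>{1..6}. e k [v] = 0"
      by metis
    then show "v = 0"
      using ad unfolding adapted_def coframe6_def by blast
  qed
  have d: "of_degree 1 (e k)" if "k \<in> {1..6}" for k
    using e[OF that] by (simp add: alternating_of_degree)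
  have s: "e 2 \<^bold>\<and> e 1 = - (e 1 \<^bold>\<and> e 2)"
    by (rule mwedge_1_skew; rule d) auto
  have s': "(e k \<^bold>\<and> e k) vs = 0" if "k \<in> {1..6}" for k vs
    using fun_cong[OF mwedge_1_skew[OF d[OF that] d[OF that]], of vs] by simp
  note lin = mwedge_add_left mwedge_diff_left mwedge_scale_left mwedge_add_right mwedge_diff_right mwedge_scale_right
  have "rot \<alpha> \<beta> e 1 \<^bold>\<and> rot \<alpha> \<beta> e 2 = e 1 \<^bold>\<and> e 2"
  proof
    fix vs
    have "(rot \<alpha> \<beta> e 1 \<^bold>\<and> rot \<alpha> \<beta> e 2) vs = (\<alpha>\<^sup>2 + \<beta>\<^sup>2) * (e 1 \<^bold>\<and> e 2) vs"
      unfolding r lin s by (simp add: s' algebra_simps power2_eq_square)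
    then show "(rot \<alpha> \<beta> e 1 \<^bold>\<and> rot \<alpha> \<beta> e 2) vs = (e 1 \<^bold>\<and> e 2) vs"
      using ab by simp
  qed
  then have w: "w = rot \<alpha> \<beta> e 1 \<^bold>\<and> rot \<alpha> \<beta> e 2 + rot \<alpha> \<beta> e 3 \<^bold>\<and> rot \<alpha> \<beta> e 4 + rot \<alpha> \<beta> e 5 \<^bold>\<and> rot \<alpha> \<beta> e 6"
    using ad unfolding adapted_def r(3-6) by simp
  have a: "a = e 1 \<^bold>\<and> e 3 \<^bold>\<and> e 5 - e 1 \<^bold>\<and> e 4 \<^bold>\<and> e 6 - e 2 \<^bold>\<and> e 3 \<^bold>\<and> e 6 - e 2 \<^bold>\<and> e 4 \<^bold>\<and> e 5"
    and b: "b = - (e 2 \<^bold>\<and> e 4 \<^bold>\<and> e 6) + e 2 \<^bold>\<and> e 3 \<^bold>\<and> e 5 + e 1 \<^bold>\<and> e 4 \<^bold>\<and> e 5 + e 1 \<^bold>\<and> e 3 \<^bold>\<and> e 6"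
    using ad unfolding adapted_def by simp_all
  show ?thesis
    unfolding adapted_def
  proof (intro conjI cf w)
  qed (simp_all only: a b r lin, simp_all add: fun_eq_iff algebra_simps)
qed

lemma gram_rot:
  assumes "\<alpha>\<^sup>2 + \<beta>\<^sup>2 = 1"
  shows "gram 6 (\<lambda>k v. rot \<alpha> \<beta> e k [v]) = gram 6 (\<lambda>k v. e k [v])"
proof (intro ext)
  fix u v
  have "{1..6::nat} = {1,2,3,4,5,6}"
    by auto
  moreover have "(\<alpha> * e 1 [u] - \<beta> * e 2 [u]) * (\<alpha> * e 1 [v] - \<beta> * e 2 [v])
      + (\<beta> * e 1 [u] + \<alpha> * e 2 [u]) * (\<beta> * e 1 [v] + \<alpha> * e 2 [v])
    = (\<alpha>\<^sup>2 + \<beta>\<^sup>2) * (e 1 [u] * e 1 [v] + e 2 [u] * e 2 [v])"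
    by algebra
  ultimately show "gram 6 (\<lambda>k v. rot \<alpha> \<beta> e k [v]) u v = gram 6 (\<lambda>k v. e k [v]) u v"
    using assms by (simp add: gram_def rot_def fun_diff_def plus_fun_def del: One_nat_def)
qed

section \<open>Differential forms on manifolds\<close>

text \<open>What the chartwise calculus uses of a manifold. It is verified directly for the circle
  and for the product, where the transition maps are treated by hand.\<close>

definition nice_charts :: "('i, 'p, 'v::euclidean_space) manifold \<Rightarrow> bool" where
  "nice_charts M \<longleftrightarrow> (\<forall>i\<in>mf_idx M. inj_on (mf_map M i) (mf_dom M i) \<and> open (mf_img M i))"

definition transition :: "('i, 'p, 'v::euclidean_space) manifold \<Rightarrow> 'i \<Rightarrow> 'i \<Rightarrow> 'p \<Rightarrow> 'v \<Rightarrow> 'v" where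
  "transition M i j p = frechet_derivative (mf_map M j \<circ> mf_inv M i) (at (mf_map M i p))"

lemma mf_inv_map: "nice_charts M \<Longrightarrow> i \<in> mf_idx M \<Longrightarrow> p \<in> mf_dom M i \<Longrightarrow> mf_inv M i (mf_map M i p) = p"
  by (simp add: nice_charts_def mf_inv_def inv_into_f_f)

lemma mf_map_inv: "x \<in> mf_img M i \<Longrightarrow> mf_map M i (mf_inv M i x) = x"
  by (simp add: mf_inv_def mf_img_def f_inv_into_f)

lemma mf_inv_dom: "x \<in> mf_img M i \<Longrightarrow> mf_inv M i x \<in> mf_dom M i"
  by (simp add: mf_inv_def mf_img_def inv_into_into)

lemma mf_map_img: "p \<in> mf_dom M i \<Longrightarrow> mf_map M i p \<in> mf_img M i"
  by (simp add: mf_img_def)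

lemma nice_charts_open: "nice_charts M \<Longrightarrow> i \<in> mf_idx M \<Longrightarrow> open (mf_img M i)"
  by (simp add: nice_charts_def)

lemma smooth_manifold_nice_charts: "smooth_manifold M \<Longrightarrow> nice_charts M"
  unfolding smooth_manifold_def nice_charts_def
  by (metis homeomorphic_imp_injective_map openin_subset topspace_subtopology_subset)

lemma smooth_manifold_open:
  assumes M: "smooth_manifold M" and i: "i \<in> mf_idx M" and W: "openin (mf_top M) W" "W \<subseteq> mf_dom M i"
  shows "open (mf_map M i ` W)"
proof -
  have h: "homeomorphic_map (subtopology (mf_top M) (mf_dom M i)) (top_of_set (mf_img M i)) (mf_map M i)"
    and o: "open (mf_img M i)" and d: "openin (mf_top M) (mf_dom M i)"
    using M i by (auto simp: smooth_manifold_def)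
  have "openin (subtopology (mf_top M) (mf_dom M i)) W"
    using W d by (simp add: openin_open_subtopology)
  moreover have "W \<subseteq> topspace (subtopology (mf_top M) (mf_dom M i))"
    using W d by (simp add: openin_subset topspace_subtopology_subset)
  ultimately have "openin (top_of_set (mf_img M i)) (mf_map M i ` W)"
    using homeomorphic_map_openness[OF h] by simp
  then show ?thesis
    using o openin_open_trans by blast
qed

lemma smooth_manifold_dom_open: "smooth_manifold M \<Longrightarrow> i \<in> mf_idx M \<Longrightarrow> openin (mf_top M) (mf_dom M i)"
  by (simp add: smooth_manifold_def)

lemma transition_derivative:
  assumes M: "smooth_manifold M" and ij: "i \<in> mf_idx M" "j \<in> mf_idx M" and p: "p \<in> mf_dom M i \<inter> mf_dom M j"
  shows "((mf_map M j \<circ> mf_inv M i) has_derivative transition M i j p) (at (mf_map M i p))"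
  unfolding transition_def
proof (intro has_frechet_derivative smooth_on_differentiable)
  show "smooth_on (mf_map M i ` (mf_dom M i \<inter> mf_dom M j)) (mf_map M j \<circ> mf_inv M i)"
    using M ij by (simp add: smooth_manifold_def)
qed (use p in simp)

lemma transition_overlap_open:
  assumes M: "smooth_manifold M" and ij: "i \<in> mf_idx M" "j \<in> mf_idx M"
  shows "open (mf_map M i ` (mf_dom M i \<inter> mf_dom M j))"
  using M ij by (intro smooth_manifold_open) (auto intro: openin_Int smooth_manifold_dom_open)

text \<open>Chain rule: the composite of the two coordinate changes is the identity on the open
  overlap.\<close>

lemma transition_inverse:
  assumes M: "smooth_manifold M" and ij: "i \<in> mf_idx M" "j \<in> mf_idx M" and p: "p \<in> mf_dom M i \<inter> mf_dom M j"
  shows "transition M j i p (transition M i j p v) = v"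
proof -
  note n = smooth_manifold_nice_charts[OF M]
  have p': "p \<in> mf_dom M j \<inter> mf_dom M i"
    using p by blast
  have e: "(mf_map M j \<circ> mf_inv M i) (mf_map M i p) = mf_map M j p"
    using mf_inv_map[OF n ij(1)] p by simp
  have "((mf_map M i \<circ> mf_inv M j) has_derivative transition M j i p) (at ((mf_map M j \<circ> mf_inv M i) (mf_map M i p)))"
    unfolding e by (rule transition_derivative[OF M ij(2,1) p'])
  note diff_chain_at[OF transition_derivative[OF M ij p] this]
  then have "((\<lambda>x. x) has_derivative transition M j i p \<circ> transition M i j p) (at (mf_map M i p))"
  proof (rule has_derivative_transform_within_open[OF _ transition_overlap_open[OF M ij]])
    show "mf_map M i p \<in> mf_map M i ` (mf_dom M i \<inter> mf_dom M j)"
      using p by blast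
    show "((mf_map M i \<circ> mf_inv M j) \<circ> (mf_map M j \<circ> mf_inv M i)) x = x"
      if "x \<in> mf_map M i ` (mf_dom M i \<inter> mf_dom M j)" for x
      using that mf_inv_map[OF n ij(1)] mf_inv_map[OF n ij(2)] by auto
  qed
  then have "transition M j i p \<circ> transition M i j p = (\<lambda>x. x)"
    using has_derivative_unique has_derivative_ident by blast
  then show ?thesis
    by (simp add: fun_eq_iff)
qed

lemma linear_transition:
  assumes M: "smooth_manifold M" and ij: "i \<in> mf_idx M" "j \<in> mf_idx M" and p: "p \<in> mf_dom M i \<inter> mf_dom M j"
  shows "linear (transition M i j p)"
  using transition_derivative[OF assms] by (rule has_derivative_linear)

lemma dforms_iff: "\<omega> \<in> dforms M k \<longleftrightarrow>
    (\<forall>i\<in>mf_idx M. \<forall>p\<in>mf_dom M i. alternating k (\<omega> i p)) \<and>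
    (\<forall>i\<in>mf_idx M. \<forall>j\<in>mf_idx M. \<forall>p\<in>mf_dom M i \<inter> mf_dom M j. \<forall>vs.
       \<omega> i p vs = \<omega> j p (map (transition M i j p) vs)) \<and>
    (\<forall>i\<in>mf_idx M. \<forall>vs. smooth_on (mf_img M i) (\<lambda>x. \<omega> i (mf_inv M i x) vs))"
  by (simp add: dforms_def transition_def)

lemma dforms_alternating: "\<omega> \<in> dforms M k \<Longrightarrow> i \<in> mf_idx M \<Longrightarrow> p \<in> mf_dom M i \<Longrightarrow> alternating k (\<omega> i p)"
  and dforms_transition: "\<omega> \<in> dforms M k \<Longrightarrow> i \<in> mf_idx M \<Longrightarrow> j \<in> mf_idx M \<Longrightarrow> p \<in> mf_dom M i \<Longrightarrow> p \<in> mf_dom M j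
    \<Longrightarrow> \<omega> i p = (\<lambda>vs. \<omega> j p (map (transition M i j p) vs))"
  and dforms_smooth: "\<omega> \<in> dforms M k \<Longrightarrow> i \<in> mf_idx M \<Longrightarrow> smooth_on (mf_img M i) (\<lambda>x. \<omega> i (mf_inv M i x) vs)"
  unfolding dforms_iff by (blast, intro ext, blast, blast)

lemma dforms_differentiable:
  assumes "\<omega> \<in> dforms M k" "i \<in> mf_idx M" "p \<in> mf_dom M i"
  shows "(\<lambda>x. \<omega> i (mf_inv M i x) vs) differentiable (at (mf_map M i p))"
  using smooth_on_differentiable[OF dforms_smooth[OF assms(1,2)] mf_map_img[OF assms(3)]] .

lemma form_eq_dforms:
  assumes n: "nice_charts M" and eq: "\<omega> \<doteq>\<^bsub>M\<^esub> \<eta>" and \<eta>: "\<eta> \<in> dforms M k"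
  shows "\<omega> \<in> dforms M k"
  unfolding dforms_iff
proof (intro conjI ballI allI)
  fix i assume i: "i \<in> mf_idx M"
  show "alternating k (\<omega> i p)" if "p \<in> mf_dom M i" for p
    using dforms_alternating[OF \<eta> i that] eq i that by (simp add: form_eq_def)
  show "\<omega> i p vs = \<omega> j p (map (transition M i j p) vs)" if "j \<in> mf_idx M" "p \<in> mf_dom M i \<inter> mf_dom M j" for p j vs
    using fun_cong[OF dforms_transition[OF \<eta> i that(1)], of p vs] eq i that by (simp add: form_eq_def)
  show "smooth_on (mf_img M i) (\<lambda>x. \<omega> i (mf_inv M i x) vs)" for vs
    by (rule smooth_on_cong[OF nice_charts_open[OF n i] _ dforms_smooth[OF \<eta> i, of vs]])
      (use eq i in \<open>simp add: form_eq_def mf_inv_dom\<close>)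
qed

context
  fixes M :: "('i, 'p, 'v::euclidean_space) manifold"
  assumes n: "nice_charts M"
begin

lemma dforms_pointwise:
  assumes alt: "\<And>i p. i \<in> mf_idx M \<Longrightarrow> p \<in> mf_dom M i \<Longrightarrow> alternating k (\<eta> i p)"
    and tr: "\<And>i j p vs. i \<in> mf_idx M \<Longrightarrow> j \<in> mf_idx M \<Longrightarrow> p \<in> mf_dom M i \<Longrightarrow> p \<in> mf_dom M j
      \<Longrightarrow> \<eta> i p vs = \<eta> j p (map (transition M i j p) vs)"
    and sm: "\<And>i vs. i \<in> mf_idx M \<Longrightarrow> smooth_on (mf_img M i) (\<lambda>x. \<eta> i (mf_inv M i x) vs)"
  shows "\<eta> \<in> dforms M k"
  unfolding dforms_iff
proof (intro conjI ballI allI)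
  show "\<eta> i p vs = \<eta> j p (map (transition M i j p) vs)"
    if "i \<in> mf_idx M" "j \<in> mf_idx M" "p \<in> mf_dom M i \<inter> mf_dom M j" for i j p vs
    using tr that by blast
qed (rule alt sm; assumption)+

lemma dforms_add:
  assumes \<omega>: "\<omega> \<in> dforms M k" and \<eta>: "\<eta> \<in> dforms M k"
  shows "\<omega> + \<eta> \<in> dforms M k"
proof (rule dforms_pointwise)
  fix i assume i: "i \<in> mf_idx M"
  show "alternating k ((\<omega> + \<eta>) i p)" if "p \<in> mf_dom M i" for p
    using alternating_add[OF dforms_alternating[OF \<omega> i that] dforms_alternating[OF \<eta> i that]] by simp
  show "(\<omega> + \<eta>) i p vs = (\<omega> + \<eta>) j p (map (transition M i j p) vs)"
    if "j \<in> mf_idx M" "p \<in> mf_dom M i" "p \<in> mf_dom M j" for j p vs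
    using fun_cong[OF dforms_transition[OF \<omega> i that], of vs] fun_cong[OF dforms_transition[OF \<eta> i that], of vs] by simp
  show "smooth_on (mf_img M i) (\<lambda>x. (\<omega> + \<eta>) i (mf_inv M i x) vs)" for vs
    using smooth_on_add[OF nice_charts_open[OF n i] dforms_smooth[OF \<omega> i] dforms_smooth[OF \<eta> i]] by simp
qed

lemma dforms_fun_scale:
  assumes f: "smooth_fun M f" and \<omega>: "\<omega> \<in> dforms M k"
  shows "f \<cdot>\<^sub>f \<omega> \<in> dforms M k"
proof (rule dforms_pointwise)
  have e: "(f \<cdot>\<^sub>f \<omega>) i p = (\<lambda>vs. f p * \<omega> i p vs)" for i p
    by (simp add: fun_scale_def fun_eq_iff)
  fix i assume i: "i \<in> mf_idx M"
  show "alternating k ((f \<cdot>\<^sub>f \<omega>) i p)" if "p \<in> mf_dom M i" for p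
    unfolding e by (rule alternating_scale[OF dforms_alternating[OF \<omega> i that]])
  show "(f \<cdot>\<^sub>f \<omega>) i p vs = (f \<cdot>\<^sub>f \<omega>) j p (map (transition M i j p) vs)"
    if "j \<in> mf_idx M" "p \<in> mf_dom M i" "p \<in> mf_dom M j" for j p vs
    using fun_cong[OF dforms_transition[OF \<omega> i that], of vs] by (simp add: e)
  show "smooth_on (mf_img M i) (\<lambda>x. (f \<cdot>\<^sub>f \<omega>) i (mf_inv M i x) vs)" for vs
    unfolding e using f i
    by (intro smooth_on_mult nice_charts_open[OF n i] dforms_smooth[OF \<omega> i]) (simp add: smooth_fun_def o_def)
qed

lemma smooth_fun_const: "smooth_fun M (\<lambda>p. c)"
  by (simp add: smooth_fun_def o_def smooth_on_const)

lemma dforms_const_scale: "\<omega> \<in> dforms M k \<Longrightarrow> c *\<^sub>f \<omega> \<in> dforms M k"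
  using dforms_fun_scale[OF smooth_fun_const, of \<omega> k c]
  by (simp add: const_scale_def[abs_def] fun_scale_def[abs_def])

lemma dforms_minus: "\<omega> \<in> dforms M k \<Longrightarrow> - \<omega> \<in> dforms M k"
  using dforms_const_scale[of \<omega> k "-1"]
  by (simp add: const_scale_def[abs_def] fun_Compl_def)

lemma dforms_diff: "\<omega> \<in> dforms M k \<Longrightarrow> \<eta> \<in> dforms M k \<Longrightarrow> \<omega> - \<eta> \<in> dforms M k"
  using dforms_add[OF _ dforms_minus, of \<omega> k \<eta>] by simp

lemma dforms_wedge: "\<omega> \<in> dforms M k \<Longrightarrow> \<eta> \<in> dforms M l \<Longrightarrow> \<omega> \<and>\<^sub>f \<eta> \<in> dforms M (k + l)"
proof -
  assume \<omega>: "\<omega> \<in> dforms M k" and \<eta>: "\<eta> \<in> dforms M l"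
  show ?thesis
  proof (rule dforms_pointwise; unfold wedge_def)
    fix i assume i: "i \<in> mf_idx M"
    show "alternating (k + l) (\<omega> i p \<^bold>\<and> \<eta> i p)" if "p \<in> mf_dom M i" for p
      by (rule alternating_mwedge[OF dforms_alternating[OF \<omega> i that] dforms_alternating[OF \<eta> i that]])
    show "(\<omega> i p \<^bold>\<and> \<eta> i p) vs = (\<omega> j p \<^bold>\<and> \<eta> j p) (map (transition M i j p) vs)"
      if "j \<in> mf_idx M" "p \<in> mf_dom M i" "p \<in> mf_dom M j" for p j vs
      unfolding mwedge_map dforms_transition[OF \<omega> i that, symmetric] dforms_transition[OF \<eta> i that, symmetric] ..
    show "smooth_on (mf_img M i) (\<lambda>x. (\<omega> i (mf_inv M i x) \<^bold>\<and> \<eta> i (mf_inv M i x)) vs)" for vs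
      by (intro smooth_on_mwedge nice_charts_open[OF n] dforms_smooth[OF \<omega>] dforms_smooth[OF \<eta>] i)
  qed
qed

lemma smooth_fun_differentiable:
  "smooth_fun M f \<Longrightarrow> i \<in> mf_idx M \<Longrightarrow> p \<in> mf_dom M i \<Longrightarrow> (\<lambda>x. f (mf_inv M i x)) differentiable (at (mf_map M i p))"
  using smooth_on_differentiable[of "mf_img M i" "f \<circ> mf_inv M i"] mf_map_img
  by (fastforce simp: smooth_fun_def o_def)

lemma smooth_fun_closed:
  "smooth_fun M f \<Longrightarrow> smooth_fun M g \<Longrightarrow> smooth_fun M (\<lambda>p. f p + g p)"
  "smooth_fun M f \<Longrightarrow> smooth_fun M g \<Longrightarrow> smooth_fun M (\<lambda>p. f p - g p)"
  "smooth_fun M f \<Longrightarrow> smooth_fun M g \<Longrightarrow> smooth_fun M (\<lambda>p. f p * g p)"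
  unfolding smooth_fun_def o_def
  by (auto intro!: smooth_on_const smooth_on_add smooth_on_diff smooth_on_mult nice_charts_open[OF n])

text \<open>Equality on one chart domain suffices, since its image is open. This is how the star of
  \<phi> gets differentiated through its closed expression.\<close>

lemma ext_d_cong:
  assumes "\<And>q. q \<in> mf_dom M i \<Longrightarrow> \<omega> i q = \<eta> i q" "i \<in> mf_idx M" "p \<in> mf_dom M i"
  shows "ext_d M \<omega> i p = ext_d M \<eta> i p"
proof -
  have "frechet_derivative (\<lambda>x. \<omega> i (mf_inv M i x) vs) (at (mf_map M i p))
      = frechet_derivative (\<lambda>x. \<eta> i (mf_inv M i x) vs) (at (mf_map M i p))" for vs
  proof -
    have "((\<lambda>x. \<omega> i (mf_inv M i x) vs) has_derivative D) (at (mf_map M i p)) \<longleftrightarrow>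
        ((\<lambda>x. \<eta> i (mf_inv M i x) vs) has_derivative D) (at (mf_map M i p))" for D
      by (rule iffI; erule has_derivative_transform_within_open[OF _ nice_charts_open[OF n assms(2)] mf_map_img[OF assms(3)]])
        (simp_all add: assms(1) mf_inv_dom)
    then show ?thesis
      by (simp add: frechet_derivative_def)
  qed
  then show ?thesis
    by (simp add: ext_d_def fun_eq_iff)
qed

lemma ext_d_add:
  assumes "\<omega> \<in> dforms M k" "\<eta> \<in> dforms M l" "i \<in> mf_idx M" "p \<in> mf_dom M i"
  shows "ext_d M (\<omega> + \<eta>) i p = ext_d M \<omega> i p + ext_d M \<eta> i p"
proof -
  have "(\<lambda>x. (\<omega> + \<eta>) i (mf_inv M i x)) = (\<lambda>x. \<omega> i (mf_inv M i x) + \<eta> i (mf_inv M i x))"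
    by simp
  then show ?thesis
    unfolding ext_d_d_at by (simp only:) (rule d_at_add; rule dforms_differentiable[OF _ assms(3,4)]; rule assms)
qed

lemma ext_d_const_scale:
  assumes "\<omega> \<in> dforms M k" "i \<in> mf_idx M" "p \<in> mf_dom M i"
  shows "ext_d M (c *\<^sub>f \<omega>) i p = (\<lambda>vs. c * ext_d M \<omega> i p vs)"
proof -
  have e: "(c *\<^sub>f \<omega>) i p = (\<lambda>vs. c * \<omega> i p vs)" for i p
    by (simp add: const_scale_def fun_eq_iff)
  show ?thesis
    unfolding ext_d_d_at e by (rule d_at_scale) (auto intro: dforms_differentiable assms)
qed

lemma ext_d_wedge:
  assumes "\<omega> \<in> dforms M k" "\<eta> \<in> dforms M l" "i \<in> mf_idx M" "p \<in> mf_dom M i"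
  shows "ext_d M (\<omega> \<and>\<^sub>f \<eta>) i p = ext_d M \<omega> i p \<^bold>\<and> \<eta> i p + (\<lambda>vs. (- 1) ^ k * \<omega> i p vs) \<^bold>\<and> ext_d M \<eta> i p"
proof -
  have "ext_d M (\<omega> \<and>\<^sub>f \<eta>) i p = ext_d M \<omega> i p \<^bold>\<and> \<eta> i (mf_inv M i (mf_map M i p))
      + parity (\<omega> i (mf_inv M i (mf_map M i p))) \<^bold>\<and> ext_d M \<eta> i p"
    unfolding ext_d_d_at wedge_def by (rule d_at_mwedge) (auto intro: dforms_differentiable assms)
  then show ?thesis
    using parity_of_degree[OF alternating_of_degree[OF dforms_alternating[OF assms(1,3,4)]]]
    by (simp only: mf_inv_map[OF n assms(3,4)])
qed

lemma zero_form_dforms: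
  assumes "smooth_fun M f"
  shows "zero_form f \<in> dforms M 0"
proof -
  have "alternating 0 (zero_form f i p :: 'v mform)" for i :: 'i and p
    by (auto simp: alternating_iff of_degree_def skew_def multilinear_def zero_form_def intro: linear_zero)
  moreover have "smooth_on (mf_img M i) (\<lambda>x. zero_form f i (mf_inv M i x) vs)" if "i \<in> mf_idx M" for i and vs :: "'v list"
    using assms that by (cases vs) (auto simp: zero_form_def smooth_fun_def o_def smooth_on_const)
  ultimately show ?thesis
    by (auto simp: dforms_iff zero_form_def)
qed

text \<open>Scaling by a function is a product with a 0-form, so the derivative of
  \<open>f \<cdot>\<^sub>f \<omega>\<close> is an instance of the Leibniz rule.\<close>

lemma zero_form_wedge:
  fixes f :: "'p \<Rightarrow> real" and \<omega> :: "('i, 'p, 'v) dform"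
  shows "zero_form f \<and>\<^sub>f \<omega> = f \<cdot>\<^sub>f \<omega>"
proof -
  have "of_degree 0 (zero_form f i p :: 'v mform)" for i :: 'i and p :: 'p
    by (simp add: of_degree_def zero_form_def)
  then show ?thesis
    by (simp add: fun_eq_iff wedge_def fun_scale_def mwedge_shuf[where p = 0]) (simp add: zero_form_def)
qed

lemma ext_d_zero_form: "ext_d M (zero_form f) i p vs =
    (if length vs = 1 then frechet_derivative (\<lambda>x. f (mf_inv M i x)) (at (mf_map M i p)) (hd vs) else 0)"
proof (cases vs)
  case Nil
  then show ?thesis by (simp add: ext_d_def)
next
  case (Cons v ws)
  have "frechet_derivative (\<lambda>x. 0 :: real) (at y) w = 0" for y w :: 'v
    by (simp add: frechet_derivative_const)
  moreover have "take l vs @ drop (Suc l) vs \<noteq> []" if "ws \<noteq> []" "l < length vs" for l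
    using that Cons by (cases l) auto
  ultimately show ?thesis
    using Cons by (cases "ws = []") (auto simp: ext_d_def zero_form_def intro!: sum.neutral)
qed

lemma ext_d_fun_scale:
  assumes "smooth_fun M f" "\<omega> \<in> dforms M k" "i \<in> mf_idx M" "p \<in> mf_dom M i"
  shows "ext_d M (f \<cdot>\<^sub>f \<omega>) i p = ext_d M (zero_form f) i p \<^bold>\<and> \<omega> i p + (\<lambda>vs. f p * ext_d M \<omega> i p vs)"
proof -
  have "of_degree 0 (zero_form f i p :: 'v mform)"
    by (simp add: of_degree_def zero_form_def)
  then have "zero_form f i p \<^bold>\<and> ext_d M \<omega> i p = (\<lambda>vs. f p * ext_d M \<omega> i p vs)"
    by (simp add: mwedge_shuf fun_eq_iff) (simp add: zero_form_def)
  then show ?thesis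
    using ext_d_wedge[OF zero_form_dforms[OF assms(1)] assms(2-4)] by (simp add: zero_form_wedge)
qed

end

text \<open>Compatibility between charts is the chain rule for the coordinate change.\<close>

lemma differential_dforms:
  assumes M: "smooth_manifold M" and f: "smooth_fun M f"
  shows "ext_d M (zero_form f) \<in> dforms M 1"
  unfolding dforms_iff
proof (intro conjI ballI allI)
  note n = smooth_manifold_nice_charts[OF M]
  fix i assume i: "i \<in> mf_idx M"
  have fd: "((\<lambda>x. f (mf_inv M i x)) has_derivative frechet_derivative (\<lambda>x. f (mf_inv M i x)) (at (mf_map M i p))) (at (mf_map M i p))"
    if "i \<in> mf_idx M" "p \<in> mf_dom M i" for p i
    by (intro has_frechet_derivative smooth_fun_differentiable n f that)
  show "alternating 1 (ext_d M (zero_form f) i p)" if "p \<in> mf_dom M i" for p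
  proof -
    have "linear (frechet_derivative (\<lambda>x. f (mf_inv M i x)) (at (mf_map M i p)))"
      using fd[OF i that] by (rule has_derivative_linear)
    then show ?thesis
      unfolding alternating_def ext_d_zero_form[OF n]
      by (auto simp: length_Suc_conv One_nat_def)
  qed
  show "smooth_on (mf_img M i) (\<lambda>x. ext_d M (zero_form f) i (mf_inv M i x) vs)" for vs
  proof (cases "length vs = 1")
    case True
    have "smooth_on (mf_img M i) (\<lambda>x. f (mf_inv M i x))"
      using f i by (simp add: smooth_fun_def o_def)
    then have "smooth_on (mf_img M i) (\<lambda>x. frechet_derivative (\<lambda>x. f (mf_inv M i x)) (at x) (hd vs))"
      by (rule smooth_on_derivative)
    then show ?thesis
      by (rule smooth_on_cong[OF nice_charts_open[OF n i], rotated])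
        (simp add: ext_d_zero_form[OF n] True mf_map_inv)
  qed (simp add: ext_d_zero_form[OF n] smooth_on_const)
  show "ext_d M (zero_form f) i p vs = ext_d M (zero_form f) j p (map (transition M i j p) vs)"
    if j: "j \<in> mf_idx M" and p: "p \<in> mf_dom M i \<inter> mf_dom M j" for p j vs
  proof -
    have "(mf_map M j \<circ> mf_inv M i) (mf_map M i p) = mf_map M j p"
      using mf_inv_map[OF n i] p by simp
    then have "((\<lambda>x. f (mf_inv M j x)) \<circ> (mf_map M j \<circ> mf_inv M i) has_derivative
        frechet_derivative (\<lambda>x. f (mf_inv M j x)) (at (mf_map M j p)) \<circ> transition M i j p) (at (mf_map M i p))"
      using fd[OF j, of p] p by (intro diff_chain_at transition_derivative[OF M i j p]) simp
    then have "((\<lambda>x. f (mf_inv M i x)) has_derivative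
        frechet_derivative (\<lambda>x. f (mf_inv M j x)) (at (mf_map M j p)) \<circ> transition M i j p) (at (mf_map M i p))"
      by (rule has_derivative_transform_within_open[OF _ transition_overlap_open[OF M i j]])
        (use p mf_inv_map[OF n i] mf_inv_map[OF n j] in auto)
    then have "frechet_derivative (\<lambda>x. f (mf_inv M i x)) (at (mf_map M i p))
        = frechet_derivative (\<lambda>x. f (mf_inv M j x)) (at (mf_map M j p)) \<circ> transition M i j p"
      by (rule frechet_derivative_eqI)
    then show ?thesis
      by (cases vs) (auto simp: ext_d_zero_form[OF n])
  qed
qed

section \<open>The Hodge star of an SU(3)-structure acting on differential forms\<close>

lemma su3_star_eq:
  assumes ad: "adapted e (\<omega> i p) (\<psi>\<^sub>p i p) (\<psi>\<^sub>m i p)"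
  shows "su3_star \<omega> \<psi>\<^sub>p \<psi>\<^sub>m A i p = hodge (gram 6 (\<lambda>k v. e k [v])) (su3_vol \<omega> i p) (A i p)"
  by (simp add: su3_star_def star_def su3_metric_eq[of e \<omega> i p \<psi>\<^sub>p \<psi>\<^sub>m, OF ad])

lemma su3_vol_eq: "su3_vol \<omega> i p = (\<lambda>vs. 1 / 6 * (\<omega> i p \<^bold>\<and> \<omega> i p \<^bold>\<and> \<omega> i p) vs)"
  by (simp add: su3_vol_def const_scale_def wedge_def fun_eq_iff fact_numeral)

lemma alternating_su3_vol: "alternating 2 (\<omega> i p) \<Longrightarrow> alternating 6 (su3_vol \<omega> i p)"
proof -
  assume w: "alternating 2 (\<omega> i p)"
  show ?thesis
    unfolding su3_vol_eq
    by (rule alternating_scale) (use alternating_mwedge[OF w alternating_mwedge[OF w w]] in simp)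
qed

lemma su3_structure_adapted:
  assumes "su3_structure M \<omega> \<psi>\<^sub>p \<psi>\<^sub>m" "i \<in> mf_idx M" "p \<in> mf_dom M i"
  shows "\<exists>e. adapted e (\<omega> i p) (\<psi>\<^sub>p i p) (\<psi>\<^sub>m i p)"
proof -
  obtain W e where "p \<in> W" "\<forall>q\<in>W. adapted (e q) (\<omega> i q) (\<psi>\<^sub>p i q) (\<psi>\<^sub>m i q)"
    using assms unfolding su3_structure_def by metis
  then show ?thesis by blast
qed

lemma adapted_dual_frame: "adapted e w a b \<Longrightarrow> \<exists>E. dual_frame 6 (\<lambda>k v. e k [v]) E"
  by (simp add: adapted_def coframe6_dual_frame)

text \<open>The left inverse \<open>D'\<close> makes \<open>D\<close> injective, so the pulled back
  covectors still separate vectors; the defining formulas pull back because the exterior product is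
  natural.\<close>

lemma adapted_transition:
  assumes ad: "adapted e w a b" and D: "linear D" "\<And>v. D' (D v) = v"
  shows "adapted (\<lambda>k vs. e k (map D vs)) (\<lambda>vs. w (map D vs)) (\<lambda>vs. a (map D vs)) (\<lambda>vs. b (map D vs))"
proof -
  have cf: "coframe6 (\<lambda>k vs. e k (map D vs))"
    unfolding coframe6_def
  proof (intro conjI ballI allI impI)
    show "alternating 1 (\<lambda>vs. e k (map D vs))" if "k \<in> {1..6}" for k
      by (rule alternating_comp[OF _ D(1)]) (use ad that in \<open>simp add: adapted_def coframe6_def\<close>)
    fix v assume "\<forall>k\<in>{1..6}. e k (map D [v]) = 0"
    then have "D v = 0"
      using ad by (simp add: adapted_def coframe6_def)
    then have "D' 0 = v"
      using D(2)[of v] by simp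
    moreover have "D' 0 = 0"
      using D(2)[of 0] linear_0[OF D(1)] by simp
    ultimately show "v = 0" by simp
  qed
  have m: "(A \<^bold>\<and> B) \<circ> map D = (A \<circ> map D) \<^bold>\<and> (B \<circ> map D)" for A B :: "(real^6) mform"
    by (rule mwedge_comp_map)
  have o: "(\<lambda>vs. A (map D vs)) = A \<circ> map D" for A :: "(real^6) mform"
    by (simp add: o_def)
  show ?thesis
    using ad cf unfolding adapted_def o by (simp add: comp_plus m)
qed

text \<open>Naturality of the star: \<open>D'\<close> carries the dual frame to the frame dual to
  the pulled back coframe, and in these two frames both sides are the same sum.\<close>

lemma su3_star_transition:
  fixes D :: "real^6 \<Rightarrow> real^6"
  assumes ad: "adapted e w a b" and D: "linear D" "\<And>v. D' (D v) = v" "\<And>v. D (D' v) = v" "linear D'"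
    and A: "multilinear A" and V: "multilinear V"
  shows "hodge (gram 6 (\<lambda>k v. e k (map D [v]))) (\<lambda>vs. V (map D vs)) (\<lambda>vs. A (map D vs)) vs
    = hodge (gram 6 (\<lambda>k v. e k [v])) V A (map D vs)"
proof -
  obtain E where E: "dual_frame 6 (\<lambda>k v. e k [v]) E"
    using adapted_dual_frame[OF ad] by blast
  have DE: "dual_frame 6 (\<lambda>k v. e k (map D [v])) (\<lambda>k. D' (E k))"
    unfolding dual_frame_def
  proof (intro conjI ballI allI)
    show "linear (\<lambda>v. e k (map D [v]))" if "k \<in> {1..6}" for k
      using linear_compose[OF D(1), of "\<lambda>v. e k [v]"] E that by (simp add: dual_frame_def o_def)
    show "e k (map D [D' (E l)]) = (if k = l then 1 else 0)" if "k \<in> {1..6}" "l \<in> {1..6}" for k l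
      using E that D(3) unfolding dual_frame_def by simp
    show "v = (\<Sum>k = 1..6. e k (map D [v]) *\<^sub>R D' (E k))" for v
    proof -
      have "D v = (\<Sum>k = 1..6. e k [D v] *\<^sub>R E k)"
        using E unfolding dual_frame_def by blast
      from arg_cong[OF this, of D'] have "D' (D v) = (\<Sum>k = 1..6. e k [D v] *\<^sub>R D' (E k))"
        by (simp only: linear_sum[OF D(4)] linear_scale[OF D(4)])
      then show ?thesis
        using D(2) by simp
    qed
  qed
  have mD: "multilinear (\<lambda>vs. B (map D vs))" if "multilinear B" for B :: "(real^6) mform"
    unfolding multilinear_def
  proof (intro allI)
    fix us ws
    have "linear (\<lambda>v. B (map D us @ v # map D ws))"
      using that unfolding multilinear_def by blast
    then show "linear (\<lambda>v. B (map D (us @ v # ws)))"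
      using linear_compose[OF D(1), of "\<lambda>v. B (map D us @ v # map D ws)"] by (simp add: o_def)
  qed
  show ?thesis
  proof (cases "length vs \<le> 6")
    case True
    then have l: "length (map D vs) \<le> 6"
      by simp
    show ?thesis
      unfolding hodge_sum[OF DE mD[OF A] mD[OF V] True] hodge_sum[OF E A V l] by (simp add: D(3) o_def)
  next
    case False
    then show ?thesis
      using hodge_length[OF DE, of vs] hodge_length[OF E, of "map D vs"] by (simp only: length_map not_le)
  qed
qed

text \<open>An adapted coframe of chart \<open>j\<close>, pulled back by the transition, is adapted
  in chart \<open>i\<close>, and uniqueness of the metric then gives compatibility. For smoothness,
  the basis chosen inside \<open>hodge\<close> may vary wildly with the point; a smooth local frame
  replaces it and exhibits the star as a finite sum of products of smooth functions.\<close>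

lemma dforms_su3_star:
  assumes M: "smooth_manifold M" and su: "su3_structure M \<omega> \<psi>\<^sub>p \<psi>\<^sub>m" and A: "A \<in> dforms M k" and k: "k \<le> 6"
  shows "su3_star \<omega> \<psi>\<^sub>p \<psi>\<^sub>m A \<in> dforms M (6 - k)"
proof (rule dforms_pointwise[OF smooth_manifold_nice_charts[OF M]])
  note n = smooth_manifold_nice_charts[OF M]
  have w: "\<omega> \<in> dforms M 2" "\<psi>\<^sub>p \<in> dforms M 3" "\<psi>\<^sub>m \<in> dforms M 3"
    using su by (simp_all add: su3_structure_def)
  fix i assume i: "i \<in> mf_idx M"
  have mv: "skew (su3_vol \<omega> j p)" if "j \<in> mf_idx M" "p \<in> mf_dom M j" for j p
    using alternating_su3_vol[of \<omega> j p, OF dforms_alternating[OF w(1) that]] by (simp add: alternating_iff)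
  have mA: "multilinear (A j p)" if "j \<in> mf_idx M" "p \<in> mf_dom M j" for j p
    using dforms_alternating[OF A that] by (simp add: alternating_iff skew_multilinear)
  show "alternating (6 - k) (su3_star \<omega> \<psi>\<^sub>p \<psi>\<^sub>m A i p)" if p: "p \<in> mf_dom M i" for p
  proof -
    obtain e where ad: "adapted e (\<omega> i p) (\<psi>\<^sub>p i p) (\<psi>\<^sub>m i p)"
      using su3_structure_adapted[OF su i p] by blast
    obtain E where E: "dual_frame 6 (\<lambda>k v. e k [v]) E"
      using adapted_dual_frame[OF ad] by blast
    show ?thesis
      unfolding su3_star_eq[of e \<omega> i p \<psi>\<^sub>p \<psi>\<^sub>m, OF ad]
      by (rule alternating_hodge[OF E dforms_alternating[OF A i p] mv[OF i p] k])
  qed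
  show "su3_star \<omega> \<psi>\<^sub>p \<psi>\<^sub>m A i p vs = su3_star \<omega> \<psi>\<^sub>p \<psi>\<^sub>m A j p (map (transition M i j p) vs)"
    if j: "j \<in> mf_idx M" and p: "p \<in> mf_dom M i" "p \<in> mf_dom M j" for j p vs
  proof -
    let ?D = "transition M i j p" and ?D' = "transition M j i p"
    have p': "p \<in> mf_dom M i \<inter> mf_dom M j" "p \<in> mf_dom M j \<inter> mf_dom M i"
      using p by auto
    note D = linear_transition[OF M i j p'(1)] transition_inverse[OF M i j p'(1)]
      transition_inverse[OF M j i p'(2)] linear_transition[OF M j i p'(2)]
    obtain e where ad: "adapted e (\<omega> j p) (\<psi>\<^sub>p j p) (\<psi>\<^sub>m j p)"
      using su3_structure_adapted[OF su j p(2)] by blast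
    note tr = dforms_transition[OF _ i j p, symmetric]
    have ad': "adapted (\<lambda>k vs. e k (map ?D vs)) (\<omega> i p) (\<psi>\<^sub>p i p) (\<psi>\<^sub>m i p)"
      using adapted_transition[OF ad D(1,2)] unfolding tr[OF w(1)] tr[OF w(2)] tr[OF w(3)] .
    have v: "su3_vol \<omega> i p = (\<lambda>vs. su3_vol \<omega> j p (map ?D vs))"
      unfolding su3_vol_eq by (simp only: mwedge_map tr[OF w(1)])
    show ?thesis
      using su3_star_transition[OF ad D mA[OF j p(2)] skew_multilinear[OF mv[OF j p(2)]], of vs]
      unfolding su3_star_eq[of e \<omega> j p \<psi>\<^sub>p \<psi>\<^sub>m, OF ad] su3_star_eq[of _ \<omega> i p \<psi>\<^sub>p \<psi>\<^sub>m, OF ad'] tr[OF A] v[symmetric] .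
  qed
  show "smooth_on (mf_img M i) (\<lambda>x. su3_star \<omega> \<psi>\<^sub>p \<psi>\<^sub>m A i (mf_inv M i x) vs)" for vs
  proof (rule smooth_on_local)
    fix x assume x: "x \<in> mf_img M i"
    obtain W e where W: "openin (mf_top M) W" "mf_inv M i x \<in> W" "W \<subseteq> mf_dom M i"
      and e: "\<And>k vs. k \<in> {1..6} \<Longrightarrow> smooth_on (mf_map M i ` W) (\<lambda>x. e (mf_inv M i x) k vs)"
      and ad: "\<And>q. q \<in> W \<Longrightarrow> adapted (e q) (\<omega> i q) (\<psi>\<^sub>p i q) (\<psi>\<^sub>m i q)"
      using su i mf_inv_dom[OF x] unfolding su3_structure_def by metis
    define U where "U = mf_map M i ` W"
    have U: "open U"
      unfolding U_def by (rule smooth_manifold_open[OF M i W(1,3)])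
    have xU: "x \<in> U"
      unfolding U_def using W(2) mf_map_inv[OF x] by (metis imageI)
    have UI: "U \<subseteq> mf_img M i"
      unfolding U_def mf_img_def using W(3) by blast
    have inv: "mf_inv M i y \<in> W" if "y \<in> U" for y
      using that mf_inv_map[OF n i] W(3) unfolding U_def by auto
    have ad': "adapted (e (mf_inv M i y)) (\<omega> i (mf_inv M i y)) (\<psi>\<^sub>p i (mf_inv M i y)) (\<psi>\<^sub>m i (mf_inv M i y))"
      if "y \<in> U" for y
      by (rule ad[OF inv[OF that]])
    have "\<exists>E. (\<forall>y\<in>U. dual_frame 6 (\<lambda>k v. e (mf_inv M i y) k [v]) (E y)) \<and> (\<forall>k l. smooth_on U (\<lambda>y. E y k $ l))"
      by (rule dual_frame_smooth[OF U]) (use ad' e in \<open>simp_all add: adapted_def U_def\<close>)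
    then obtain E where E: "\<And>y. y \<in> U \<Longrightarrow> dual_frame 6 (\<lambda>k v. e (mf_inv M i y) k [v]) (E y)"
      and sE: "\<And>k l. smooth_on U (\<lambda>y. E y k $ l)"
      by blast
    have dom: "mf_inv M i y \<in> mf_dom M i" if "y \<in> U" for y
      by (rule mf_inv_dom, rule subsetD[OF UI that])
    have sA: "smooth_on U (\<lambda>y. A i (mf_inv M i y) vs)" for vs
      by (rule smooth_on_subset[OF dforms_smooth[OF A i] UI])
    have sw: "smooth_on U (\<lambda>y. \<omega> i (mf_inv M i y) vs)" for vs
      by (rule smooth_on_subset[OF dforms_smooth[OF w(1) i] UI])
    have sV: "smooth_on U (\<lambda>y. su3_vol \<omega> i (mf_inv M i y) vs)" for vs
      unfolding su3_vol_eq by (intro smooth_on_mult smooth_on_const smooth_on_mwedge U sw)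
    have sA': "smooth_on U (\<lambda>y. A i (mf_inv M i y) (map (E y) is @ us))" for "is" us
      by (rule smooth_on_frame[OF U sE mA[OF i dom] sA])
    have sV': "smooth_on U (\<lambda>y. su3_vol \<omega> i (mf_inv M i y) (map (E y) is @ us))" for "is" us
      by (rule smooth_on_frame[OF U sE skew_multilinear[OF mv[OF i dom]] sV])
    \<comment> \<open>The appended \<open>[]\<close> gives the first factor the shape required by
      \<open>smooth_on_frame\<close>.\<close>
    have star: "su3_star \<omega> \<psi>\<^sub>p \<psi>\<^sub>m A i (mf_inv M i y) vs = (if length vs \<le> 6
        then (\<Sum>is\<in>{is. set is \<subseteq> {1..6} \<and> length is = 6 - length vs}.
          A i (mf_inv M i y) (map (E y) is @ []) * su3_vol \<omega> i (mf_inv M i y) (map (E y) is @ vs)) / fact (6 - length vs)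
        else 0)" if y: "y \<in> U" for y
      using hodge_sum[OF E[OF y] mA[OF i dom[OF y]] skew_multilinear[OF mv[OF i dom[OF y]]], of vs]
        hodge_length[OF E[OF y], of vs]
      by (simp add: su3_star_eq[of _ \<omega> i "mf_inv M i y" \<psi>\<^sub>p \<psi>\<^sub>m, OF ad'[OF y]])
    have "smooth_on U (\<lambda>y. if length vs \<le> 6
        then (\<Sum>is\<in>{is. set is \<subseteq> {1..6} \<and> length is = 6 - length vs}.
          A i (mf_inv M i y) (map (E y) is @ []) * su3_vol \<omega> i (mf_inv M i y) (map (E y) is @ vs)) / fact (6 - length vs)
        else 0)"
    proof (cases "length vs \<le> 6")
      case True
      have "smooth_on U (\<lambda>y. (\<Sum>is\<in>{is. set is \<subseteq> {1..6} \<and> length is = 6 - length vs}.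
          A i (mf_inv M i y) (map (E y) is @ []) * su3_vol \<omega> i (mf_inv M i y) (map (E y) is @ vs)) / fact (6 - length vs))"
        by (intro smooth_on_divide smooth_on_sum smooth_on_mult smooth_on_const U sA' sV' fact_nonzero)
      then show ?thesis
        using True by simp
    qed (simp add: smooth_on_const)
    then have "smooth_on U (\<lambda>y. su3_star \<omega> \<psi>\<^sub>p \<psi>\<^sub>m A i (mf_inv M i y) vs)"
      by (rule smooth_on_cong[OF U, rotated]) (rule star[symmetric])
    then show "\<exists>U. open U \<and> x \<in> U \<and> smooth_on U (\<lambda>y. su3_star \<omega> \<psi>\<^sub>p \<psi>\<^sub>m A i (mf_inv M i y) vs)"
      using U xU by blast
  qed
qed

section \<open>The circle and the product\<close>

lemma linear_fst_snd: "linear fst" "linear snd"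
  by (simp_all add: linearI)

lemma circle_idx: "mf_idx circle = UNIV"
  by (simp add: circle_def)

lemma circle_map_cis: "z \<in> mf_dom circle b \<Longrightarrow> cis (mf_map circle b z) = z"
proof -
  assume "z \<in> mf_dom circle b"
  then have z: "norm z = 1"
    by (auto simp: circle_def split: if_splits)
  then have "z \<noteq> 0" by auto
  then show ?thesis
    using z cis_Arg[of z] complex_norm_eq_1_exp[of z] by (auto simp: circle_def cis_conv_exp sgn_div_norm)
qed

lemma circle_cis_map:
  "- pi < t \<Longrightarrow> t < pi \<Longrightarrow> cis t \<in> mf_dom circle True \<and> mf_map circle True (cis t) = t"
  "0 < t \<Longrightarrow> t < 2 * pi \<Longrightarrow> cis t \<in> mf_dom circle False \<and> mf_map circle False (cis t) = t"
proof -
  assume t: "- pi < t" "t < pi"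
  then have "Arg (cis t) = t"
    by (intro Arg_cis) auto
  moreover from this have "cis t \<noteq> - 1"
    using t Arg_cis[of pi] by auto
  ultimately show "cis t \<in> mf_dom circle True \<and> mf_map circle True (cis t) = t"
    by (simp add: circle_def)
next
  assume t: "0 < t" "t < 2 * pi"
  then have "Arg2pi (cis t) = t"
    by (intro Arg2pi_unique[of 1]) (auto simp: cis_conv_exp)
  moreover from this have "cis t \<noteq> 1"
    using t Arg2pi_unique[of 1 0 1] by auto
  ultimately show "cis t \<in> mf_dom circle False \<and> mf_map circle False (cis t) = t"
    by (simp add: circle_def)
qed

lemma circle_map_range:
  assumes "z \<in> mf_dom circle b"
  shows "mf_map circle b z \<in> (if b then {- pi<..<pi} else {0<..<2 * pi})"
proof (cases b)
  case True
  have "z \<noteq> - 1"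
    using assms True by (simp add: circle_def)
  moreover have "cis (Arg z) = z"
    using circle_map_cis[OF assms] True by (simp add: circle_def)
  ultimately have "Arg z \<noteq> pi"
    by (metis cis_pi)
  then show ?thesis
    using True Arg_bounded[of z] by (simp add: circle_def)
next
  case False
  have "z \<noteq> 1"
    using assms False by (simp add: circle_def)
  moreover have "cis (Arg2pi z) = z"
    using circle_map_cis[OF assms] False by (simp add: circle_def)
  ultimately have "Arg2pi z \<noteq> 0"
    by (metis cis_zero)
  then show ?thesis
    using False Arg2pi[of z] by (simp add: circle_def)
qed

lemma circle_img: "mf_img circle b = (if b then {- pi<..<pi} else {0<..<2 * pi})"
proof
  show "mf_img circle b \<subseteq> (if b then {- pi<..<pi} else {0<..<2 * pi})"
    unfolding mf_img_def using circle_map_range by blast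
  show "(if b then {- pi<..<pi} else {0<..<2 * pi}) \<subseteq> mf_img circle b"
  proof
    fix t assume "t \<in> (if b then {- pi<..<pi} else {0<..<2 * pi})"
    then have "cis t \<in> mf_dom circle b \<and> mf_map circle b (cis t) = t"
      using circle_cis_map[of t] by (cases b) auto
    then show "t \<in> mf_img circle b"
      unfolding mf_img_def by (metis imageI)
  qed
qed

lemma nice_charts_circle: "nice_charts circle"
  unfolding nice_charts_def circle_img by (auto intro!: inj_onI) (metis circle_map_cis)+

lemma circle_inv: "t \<in> mf_img circle b \<Longrightarrow> mf_inv circle b t = cis t"
  using circle_map_cis[OF mf_inv_dom, of t b] mf_map_inv[of t circle b] by simp

text \<open>Two angles of the same point differ by a multiple of \<open>2 * pi\<close> that is
  locally constant on the overlap.\<close>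

lemma circle_transition:
  assumes z: "z \<in> mf_dom circle b" "z \<in> mf_dom circle b'"
  shows "((mf_map circle b' \<circ> mf_inv circle b) has_derivative (\<lambda>r. r)) (at (mf_map circle b z))"
proof -
  let ?t = "mf_map circle b z"
  \<comment> \<open>It suffices that near the point the coordinate change is a translation.\<close>
  have shift: ?thesis if "open U" "?t \<in> U" "\<And>x. x \<in> U \<Longrightarrow> x + c = (mf_map circle b' \<circ> mf_inv circle b) x" for U c
    by (rule has_derivative_transform_within_open[OF _ that]) (auto intro!: derivative_eq_intros)
  have t: "?t \<in> mf_img circle b" "cis ?t = z"
    using z circle_map_cis by (auto simp: mf_img_def)
  show ?thesis
  proof (cases "b = b'")
    case True
    then show ?thesis
      using t by (intro shift[of "mf_img circle b" 0]) (auto simp: mf_map_inv circle_img)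
  next
    case False
    then consider "b" "\<not> b'" | "\<not> b" "b'" by blast
    then show ?thesis
    proof cases
      case 1
      \<comment> \<open>The second chart omits the point 1, so the overlap falls into two arcs; on
        the arc of negative angles the second angle is larger by \<open>2 * pi\<close>.\<close>
      then have "?t \<noteq> 0"
        using t z by (auto simp: circle_def)
      then consider "?t \<in> {0<..<pi}" | "?t \<in> {- pi<..<0}"
        using t 1 by (fastforce simp: circle_img)
      then show ?thesis
      proof cases
        case A: 1
        then show ?thesis
          using 1 circle_cis_map(2) by (intro shift[of "{0<..<pi}" 0]) (auto simp: circle_inv circle_img)
      next
        case A: 2
        have "mf_map circle False (cis x) = x + 2 * pi" if "x \<in> {- pi<..<0}" for x
        proof -
          have "cis (x + 2 * pi) = cis x"
            by (simp add: complex_eq_iff)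
          then show ?thesis
            using circle_cis_map(2)[of "x + 2 * pi"] that by auto
        qed
        then show ?thesis
          using 1 A by (intro shift[of "{- pi<..<0}" "2 * pi"]) (auto simp: circle_inv circle_img)
      qed
    next
      case 2
      \<comment> \<open>Here the second chart omits the point -1, and beyond \<open>pi\<close> the
        second angle is smaller by \<open>2 * pi\<close>.\<close>
      then have "?t \<noteq> pi"
        using t z by (auto simp: circle_def)
      then consider "?t \<in> {0<..<pi}" | "?t \<in> {pi<..<2 * pi}"
        using t 2 by (fastforce simp: circle_img)
      then show ?thesis
      proof cases
        case A: 1
        then show ?thesis
          using 2 circle_cis_map(1) by (intro shift[of "{0<..<pi}" 0]) (auto simp: circle_inv circle_img)
      next
        case A: 2
        have "mf_map circle True (cis x) = x + - 2 * pi" if "x \<in> {pi<..<2 * pi}" for x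
        proof -
          have "cis (x - 2 * pi) = cis x"
            by (simp add: complex_eq_iff cos_diff sin_diff)
          then show ?thesis
            using circle_cis_map(1)[of "x - 2 * pi"] that by auto
        qed
        then show ?thesis
          using 2 A by (intro shift[of "{pi<..<2 * pi}" "- 2 * pi"]) (auto simp: circle_inv circle_img)
      qed
    qed
  qed
qed

section \<open>Forms on the product with the circle\<close>

context
  fixes M :: "('i, 'p, 'v::euclidean_space) manifold"
  assumes M: "smooth_manifold M"
begin

abbreviation (input) "MC \<equiv> prod_manifold M circle"

lemma prod_manifold_simps: "mf_idx MC = mf_idx M \<times> UNIV" "mf_dom MC (i, b) = mf_dom M i \<times> mf_dom circle b"
  "mf_map MC (i, b) = map_prod (mf_map M i) (mf_map circle b)" "mf_img MC (i, b) = mf_img M i \<times> mf_img circle b"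
  by (auto simp: prod_manifold_def mf_img_def circle_def)

lemma nice_charts_prod: "nice_charts MC"
  using smooth_manifold_nice_charts[OF M] nice_charts_circle
  by (auto simp: nice_charts_def prod_manifold_simps circle_idx intro!: open_Times map_prod_inj_on)

lemma prod_inv: "x \<in> mf_img MC (i, b) \<Longrightarrow> i \<in> mf_idx M \<Longrightarrow>
    mf_inv MC (i, b) x = (mf_inv M i (fst x), mf_inv circle b (snd x))"
proof -
  assume x: "x \<in> mf_img MC (i, b)" and i: "i \<in> mf_idx M"
  let ?y = "(mf_inv M i (fst x), mf_inv circle b (snd x))"
  have "?y \<in> mf_dom MC (i, b)"
    using x by (auto simp: prod_manifold_simps mf_inv_dom)
  moreover have "mf_map MC (i, b) ?y = x"
    using x by (auto simp: prod_manifold_simps mf_map_inv)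
  ultimately show ?thesis
    using mf_inv_map[OF nice_charts_prod, of "(i, b)" ?y] i by (simp add: prod_manifold_simps)
qed

text \<open>The derivative is block diagonal with the identity on the circle factor. Hence
  \<open>ds\<close> has the same value in all charts, and pulled back forms transform as they do on
  \<open>M\<close>.\<close>

lemma prod_transition:
  assumes i: "i \<in> mf_idx M" and j: "j \<in> mf_idx M" and p: "p \<in> mf_dom M i" "p \<in> mf_dom M j"
    and z: "z \<in> mf_dom circle b" "z \<in> mf_dom circle b'"
  shows "transition MC (i, b) (j, b') (p, z) = map_prod (transition M i j p) (\<lambda>r. r)"
proof -
  let ?x = "mf_map MC (i, b) (p, z)"
  have x: "?x \<in> mf_img MC (i, b)"
    using p z by (auto simp: prod_manifold_simps mf_img_def)
  have 1: "((mf_map M j \<circ> mf_inv M i) has_derivative transition M i j p) (at (fst ?x))"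
    using transition_derivative[OF M i j, of p] p by (simp add: prod_manifold_simps)
  have 2: "((mf_map circle b' \<circ> mf_inv circle b) has_derivative (\<lambda>r. r)) (at (snd ?x))"
    using circle_transition[OF z] by (simp add: prod_manifold_simps)
  have "((\<lambda>x. (((mf_map M j \<circ> mf_inv M i) \<circ> fst) x, ((mf_map circle b' \<circ> mf_inv circle b) \<circ> snd) x)) has_derivative
      (\<lambda>h. ((transition M i j p \<circ> fst) h, ((\<lambda>r. r) \<circ> snd) h))) (at ?x)"
    by (intro has_derivative_Pair diff_chain_at bounded_linear_imp_has_derivative bounded_linear_fst bounded_linear_snd 1 2)
  then have "((mf_map MC (j, b') \<circ> mf_inv MC (i, b)) has_derivative
      (\<lambda>h. ((transition M i j p \<circ> fst) h, ((\<lambda>r. r) \<circ> snd) h))) (at ?x)"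
    by (rule has_derivative_transform_within_open[OF _ _ x])
      (use nice_charts_open[OF nice_charts_prod, of "(i, b)"] i in \<open>auto simp: prod_inv prod_manifold_simps\<close>)
  then show ?thesis
    unfolding transition_def[of MC] by (auto simp: frechet_derivative_eqI map_prod_def)
qed

lemma smooth_on_prod_chart:
  assumes "i \<in> mf_idx M" "smooth_on (mf_img M i) (\<lambda>u. g (mf_inv M i u))"
  shows "smooth_on (mf_img MC (i, b)) (\<lambda>x. g (fst (mf_inv MC (i, b) x)))"
proof -
  have o: "open (mf_img MC (i, b))"
    by (rule nice_charts_open[OF nice_charts_prod]) (simp add: prod_manifold_simps assms(1))
  have "smooth_on (mf_img MC (i, b)) (\<lambda>x. g (mf_inv M i (fst x)))"
    by (rule smooth_on_linear_comp[OF bounded_linear_fst o _ assms(2)]) (auto simp: prod_manifold_simps)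
  then show ?thesis
    by (rule smooth_on_cong[OF o, rotated]) (simp add: prod_inv assms(1))
qed

lemma smooth_fun_fst: "smooth_fun M f \<Longrightarrow> smooth_fun MC (\<lambda>x. f (fst x))"
  unfolding smooth_fun_def o_def by (auto simp: prod_manifold_simps(1) intro: smooth_on_prod_chart)

lemma pull1_dforms:
  assumes \<omega>: "\<omega> \<in> dforms M k"
  shows "pull1 \<omega> \<in> dforms MC k"
proof (rule dforms_pointwise[OF nice_charts_prod])
  fix c assume c: "c \<in> mf_idx MC"
  then obtain i b where cib: "c = (i, b)" "i \<in> mf_idx M"
    by (auto simp: prod_manifold_simps)
  show "alternating k (pull1 \<omega> c x)" if "x \<in> mf_dom MC c" for x
    unfolding pull1_def
    by (rule alternating_comp[OF dforms_alternating[OF \<omega>]])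
      (use that cib in \<open>auto simp: prod_manifold_simps linear_fst_snd\<close>)
  show "smooth_on (mf_img MC c) (\<lambda>x. pull1 \<omega> c (mf_inv MC c x) vs)" for vs
    using smooth_on_prod_chart[OF cib(2) dforms_smooth[OF \<omega> cib(2), of "map fst vs"], of b] by (simp add: pull1_def cib(1))
  show "pull1 \<omega> c x vs = pull1 \<omega> c' x (map (transition MC c c' x) vs)"
    if c': "c' \<in> mf_idx MC" and x: "x \<in> mf_dom MC c" "x \<in> mf_dom MC c'" for c' x vs
  proof -
    obtain j b' p z where c: "c' = (j, b')" "j \<in> mf_idx M" "x = (p, z)"
      using c' by (cases c'; cases x) (auto simp: prod_manifold_simps)
    have p: "p \<in> mf_dom M i" "p \<in> mf_dom M j" "z \<in> mf_dom circle b" "z \<in> mf_dom circle b'"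
      using x by (auto simp: c cib prod_manifold_simps)
    have "map fst (map (transition MC c c' x) vs) = map (transition M i j p) (map fst vs)"
      by (simp add: cib c prod_transition[OF cib(2) c(2) p] o_def)
    moreover have "pull1 \<omega> c x vs = \<omega> i p (map fst vs)"
      by (simp add: pull1_def cib c)
    moreover have "pull1 \<omega> c' x (map (transition MC c c' x) vs) = \<omega> j p (map fst (map (transition MC c c' x) vs))"
      by (simp only: pull1_def c fst_conv)
    ultimately show ?thesis
      using fun_cong[OF dforms_transition[OF \<omega> cib(2) c(2) p(1,2)], of "map fst vs"] by (simp only:)
  qed
qed

lemma ds_eq: "ds c x vs = (if length vs = 1 then snd (hd vs) else 0)"
  by (cases vs) (auto simp: ds_def pull2_def circle_ds_def)

lemma ds_alternating: "alternating 1 (ds c x)"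
  unfolding alternating_def ds_eq by (auto simp: One_nat_def length_Suc_conv linear_fst_snd)

lemma ds_dforms: "ds \<in> dforms MC 1"
proof (rule dforms_pointwise[OF nice_charts_prod])
  show "ds c x vs = ds c' x (map (transition MC c c' x) vs)"
    if "c \<in> mf_idx MC" "c' \<in> mf_idx MC" "x \<in> mf_dom MC c" "x \<in> mf_dom MC c'" for c c' x vs
  proof -
    obtain i b j b' p z where c: "c = (i, b)" "c' = (j, b')" "x = (p, z)"
      by (metis surj_pair)
    have "transition MC c c' x = map_prod (transition M i j p) (\<lambda>r. r)"
      unfolding c by (rule prod_transition) (use that in \<open>auto simp: c prod_manifold_simps\<close>)
    then show ?thesis
      by (cases vs) (auto simp: ds_eq)
  qed
qed (auto simp: ds_eq ds_alternating intro: smooth_on_const)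

lemma ext_d_ds: "ext_d MC ds c x = 0"
  by (simp add: fun_eq_iff ext_d_def ds_eq frechet_derivative_const)

text \<open>The coefficients do not depend on the circle coordinate, so differentiating them only
  sees the first component of a vector.\<close>

lemma ext_d_pull1:
  assumes \<omega>: "\<omega> \<in> dforms M k" and i: "i \<in> mf_idx M" and p: "p \<in> mf_dom M i" "z \<in> mf_dom circle b"
  shows "ext_d MC (pull1 \<omega>) (i, b) (p, z) = (\<lambda>vs. ext_d M \<omega> i p (map fst vs))"
proof -
  let ?x = "mf_map MC (i, b) (p, z)"
  have x: "?x \<in> mf_img MC (i, b)"
    using p by (auto simp: prod_manifold_simps mf_img_def)
  have D: "frechet_derivative (\<lambda>x. pull1 \<omega> (i, b) (mf_inv MC (i, b) x) ws) (at ?x)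
      = (\<lambda>v. frechet_derivative (\<lambda>u. \<omega> i (mf_inv M i u) (map fst ws)) (at (mf_map M i p)) (fst v))" for ws
  proof (rule frechet_derivative_eqI)
    have "((\<lambda>u. \<omega> i (mf_inv M i u) (map fst ws)) has_derivative
        frechet_derivative (\<lambda>u. \<omega> i (mf_inv M i u) (map fst ws)) (at (mf_map M i p))) (at (fst ?x))"
      using has_frechet_derivative[OF dforms_differentiable[OF \<omega> i p(1)]] by (simp add: prod_manifold_simps)
    from diff_chain_at[OF bounded_linear_imp_has_derivative[OF bounded_linear_fst] this]
    have "((\<lambda>x. \<omega> i (mf_inv M i (fst x)) (map fst ws)) has_derivative
        (\<lambda>v. frechet_derivative (\<lambda>u. \<omega> i (mf_inv M i u) (map fst ws)) (at (mf_map M i p)) (fst v))) (at ?x)"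
      by (simp add: o_def)
    then show "((\<lambda>x. pull1 \<omega> (i, b) (mf_inv MC (i, b) x) ws) has_derivative
        (\<lambda>v. frechet_derivative (\<lambda>u. \<omega> i (mf_inv M i u) (map fst ws)) (at (mf_map M i p)) (fst v))) (at ?x)"
      by (rule has_derivative_transform_within_open[OF _ _ x])
        (use nice_charts_open[OF nice_charts_prod, of "(i, b)"] i in \<open>auto simp: prod_inv prod_manifold_simps(1) pull1_def\<close>)
  qed
  show ?thesis
    unfolding ext_d_def by (intro ext, simp only: D) (simp add: take_map drop_map)
qed

text \<open>The other Leibniz term vanishes because \<open>ds\<close> is closed.\<close>

lemma ext_d_wedge_ds:
  assumes "\<omega> \<in> dforms M k" "i \<in> mf_idx M" "p \<in> mf_dom M i" "z \<in> mf_dom circle b"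
  shows "ext_d MC (pull1 \<omega> \<and>\<^sub>f ds) (i, b) (p, z) = (\<lambda>vs. ext_d M \<omega> i p (map fst vs)) \<^bold>\<and> ds (i, b) (p, z)"
  using ext_d_wedge[OF nice_charts_prod pull1_dforms[OF assms(1)] ds_dforms, of "(i, b)" "(p, z)"] assms
  by (simp add: prod_manifold_simps ext_d_ds mwedge_zero_right ext_d_pull1)

end

section \<open>The equations at a point\<close>

text \<open>The component form of the closed expression for the star of \<phi>, in the case \<alpha>
  = 1, \<beta> = 0.\<close>

lemma nstar_phi:
  assumes "agree 6 2 W tw" "agree 6 3 A ta" "agree 6 3 B tb"
  shows "agree 7 4 (nstar 7 (up7 W + up A)) (up (\<lambda>js. 1/2 * shuf 2 W W js) + up7 B)"
proof -
  note comps [simp]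
  note assms[simplified, simp]
  show ?thesis by simp
qed

text \<open>A 2-form commutes with every form, so the two Leibniz terms in the derivative of half
  the square of \<omega> coincide.\<close>

lemma agree_wedge_w_commute:
  assumes "agree 6 2 W tw"
  shows "agree 6 5 (\<lambda>js. 1/2 * (shuf 3 D W js + shuf 2 W D js)) (shuf 2 W D)"
proof -
  note comps [simp]
  note assms[simplified, simp]
  show ?thesis by simp
qed

text \<open>\<open>su3_Omega28\<close> mentions only \<open>\<psi>\<^sub>p\<close>, but the rotation
  mixes in \<open>\<psi>\<^sub>m\<close>. Both products vanish for reasons of type: \<open>S\<close>
  is of type (1,1), while \<open>A\<close> and \<open>B\<close> are of type (3,0) + (0,3).\<close>

lemma omega8_wedge:
  assumes "agree 6 3 A ta" "agree 6 3 B tb" "agree 6 2 W tw"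
    "agree 6 5 (shuf 2 S A) 0" "agree 6 4 (nstar 6 S) (- shuf 2 S W)"
  shows "agree 6 5 (shuf 2 S B) 0"
proof -
  note comps [simp]
  note assms(1-3)[simplified, simp] omega8[OF assms(1,3,4,5), simp]
  show ?thesis by simp
qed

lemma agreeD: "agree n k A B \<Longrightarrow> js \<in> set (combs k [1..<Suc n]) \<Longrightarrow> A js = B js"
  by (simp add: agree_def)

lemma agree_refl: "agree n k A A"
  and agree_sym: "agree n k A B \<Longrightarrow> agree n k B A"
  and agree_trans: "agree n k A B \<Longrightarrow> agree n k B C \<Longrightarrow> agree n k A C"
  and agree_add: "agree n k A A' \<Longrightarrow> agree n k B B' \<Longrightarrow> agree n k (A + B) (A' + B')"
  and agree_diff: "agree n k A A' \<Longrightarrow> agree n k B B' \<Longrightarrow> agree n k (A - B) (A' - B')"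
  and agree_minus: "agree n k A A' \<Longrightarrow> agree n k (- A) (- A')"
  and agree_scale: "agree n k A A' \<Longrightarrow> agree n k (\<lambda>js. c * A js) (\<lambda>js. c * A' js)"
  by (simp_all add: agree_def del: upt_Suc)

text \<open>In an increasing list the largest index can only stand last, so components in dimension
  7 are those in dimension 6 with or without a final 7.\<close>

lemma combs_7_cases:
  assumes js: "js \<in> set (combs k [1..<Suc 7])"
  obtains "7 \<notin> set js" "js \<in> set (combs k [1..<Suc 6])"
  | us where "js = us @ [7]" "7 \<notin> set us" "Suc (length us) = k" "us \<in> set (combs (length us) [1..<Suc 6])"
proof -
  have l: "length js = k" and s: "sorted_wrt (<) js" and b: "set js \<subseteq> {1..7}"
    using combs_sorted[OF js upt_sorted(1)] by (auto simp: upt_sorted(2) simp del: upt_Suc)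
  have sub: "us \<in> set (combs (length us) [1..<Suc 6])" if "sorted_wrt (<) us" "set us \<subseteq> {1..7}" "7 \<notin> set us" for us
  proof (rule sorted_in_combs[OF that(1) upt_sorted(1)])
    have "x \<in> {1..6}" if "x \<in> set us" for x
    proof -
      have "x \<in> {1..7}" "x \<noteq> 7"
        using that \<open>set us \<subseteq> {1..7}\<close> \<open>7 \<notin> set us\<close> by auto
      then show ?thesis by simp
    qed
    then show "set us \<subseteq> set [1..<Suc 6]"
      unfolding upt_sorted(2) by blast
  qed
  show thesis
  proof (cases "7 \<in> set js")
    case False
    then show ?thesis
      using that(1) sub[OF s b] l by simp
  next
    case True
    then obtain us x where js': "js = us @ [x]"
      by (metis append_butlast_last_id empty_iff empty_set)
    have "x = 7"
    proof (rule ccontr)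
      assume "x \<noteq> 7"
      then have "7 < x"
        using True s by (auto simp: js' sorted_wrt_append)
      then show False
        using b by (auto simp: js')
    qed
    moreover from this have "7 \<notin> set us"
      using s by (auto simp: js' sorted_wrt_append)
    moreover have "us \<in> set (combs (length us) [1..<Suc 6])"
      using sub[of us] s b calculation by (auto simp: js' sorted_wrt_append)
    ultimately show ?thesis
      using that(2)[of us] l js' by simp
  qed
qed

lemma agree_up: "agree 6 k A B \<Longrightarrow> agree 7 k (up A) (up B)"
  unfolding agree_def[of 7]
proof
  fix js assume AB: "agree 6 k A B" and js: "js \<in> set (combs k [1..<Suc 7])"
  show "up A js = up B js"
    using js by (cases rule: combs_7_cases) (use agreeD[OF AB] in \<open>auto simp: up_def\<close>)
qed

lemma agree_up7: "agree 6 k A B \<Longrightarrow> agree 7 (Suc k) (up7 A) (up7 B)"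
  unfolding agree_def[of 7]
proof
  fix js assume AB: "agree 6 k A B" and js: "js \<in> set (combs (Suc k) [1..<Suc 7])"
  show "up7 A js = up7 B js"
    using js by (cases rule: combs_7_cases) (use agreeD[OF AB] in \<open>auto simp: up7_def\<close>)
qed

section \<open>Passage from six to seven dimensions at a point\<close>

abbreviation (input) pl :: "'v mform \<Rightarrow> ('v \<times> real) mform" where
  "pl A \<equiv> (\<lambda>vs. A (map fst vs))"

definition dt :: "('v \<times> real) mform" where
  "dt vs = (if length vs = 1 then snd (hd vs) else 0)"

lemma alternating_dt: "alternating 1 (dt :: ('v::real_vector \<times> real) mform)"
  unfolding alternating_def dt_def by (auto simp: One_nat_def length_Suc_conv linear_fst_snd)

lemma alternating_pl: "alternating k A \<Longrightarrow> alternating k (pl A)"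
  by (rule alternating_comp[OF _ linear_fst_snd(1)])

lemma alternating_pl_dt: "alternating k A \<Longrightarrow> alternating (Suc k) (pl A \<^bold>\<and> dt)"
  using alternating_mwedge[OF alternating_pl alternating_dt, of k A] by (simp only: Suc_eq_plus1)

text \<open>Only the shuffle that hands the last argument to \<open>B\<close> survives, and it has
  no inversion.\<close>

lemma mwedge_append_1:
  assumes "of_degree 1 B" "\<And>u. u \<in> set us \<Longrightarrow> B [u] = 0"
  shows "(A \<^bold>\<and> B) (us @ [v]) = A us * B [v]"
  using assms(2)
proof (induction us arbitrary: A)
  case Nil
  have "B [] = 0"
    using assms(1) by (simp add: of_degree_def)
  then show ?case
    by (simp add: mwedge_Cons iprod_def parity_def)
next
  case (Cons u us)
  have "iprod u B xs = 0" for xs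
    using Cons.prems assms(1) by (cases xs) (auto simp: iprod_def of_degree_def)
  then have "iprod u B = 0"
    by (simp add: fun_eq_iff)
  then show ?case
    using Cons.IH[of "iprod u A"] Cons.prems by (simp add: mwedge_Cons mwedge_zero_right) (simp add: iprod_def)
qed

lemma mwedge_1_eq_0:
  assumes "of_degree 1 B" "\<And>u. u \<in> set us \<Longrightarrow> B [u] = 0"
  shows "(A \<^bold>\<and> B) us = 0"
  using assms(2)
proof (induction us arbitrary: A)
  case Nil
  then show ?case
    using assms(1) by (simp add: of_degree_def)
next
  case (Cons u us)
  have "iprod u B xs = 0" for xs
    using Cons.prems assms(1) by (cases xs) (auto simp: iprod_def of_degree_def)
  then have "iprod u B = 0"
    by (simp add: fun_eq_iff)
  then show ?case
    using Cons by (simp add: mwedge_Cons mwedge_zero_right)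
qed

text \<open>The factor \<open>1 / f\<close> makes the last vector dual to \<open>f ds\<close>, hence
  of unit length for the warped metric.\<close>

definition frame7 :: "real \<Rightarrow> (nat \<Rightarrow> 'v::zero) \<Rightarrow> nat \<Rightarrow> 'v \<times> real" where
  "frame7 f E k = (if k = 7 then (0, 1 / f) else (E k, 0))"

definition coframe7 :: "real \<Rightarrow> (nat \<Rightarrow> 'v mform) \<Rightarrow> nat \<Rightarrow> 'v \<times> real \<Rightarrow> real" where
  "coframe7 f e k v = (if k = 7 then f * snd v else e k [fst v])"

lemma dual_frame7:
  fixes e :: "nat \<Rightarrow> (real^6) mform"
  assumes E: "dual_frame 6 (\<lambda>k v. e k [v]) E" and f: "f \<noteq> 0"
  shows "dual_frame 7 (coframe7 f e) (frame7 f E)"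
  unfolding dual_frame_def
proof (intro conjI ballI allI)
  have lin: "linear (\<lambda>v. e k [v])" if "k \<in> {1..6}" for k
    using E that by (simp add: dual_frame_def)
  have split: "{1..7::nat} = insert 7 {1..6}"
    by auto
  show "linear (coframe7 f e k)" if "k \<in> {1..7}" for k
  proof (cases "k = 7")
    case True
    then show ?thesis
      unfolding coframe7_def[abs_def] by (simp add: linear_const_mult linear_fst_snd)
  next
    case False
    then have "linear (\<lambda>v. e k [fst v])"
      using linear_compose[OF linear_fst_snd(1) lin, of k] that by (simp add: o_def)
    then show ?thesis
      using False unfolding coframe7_def[abs_def] by simp
  qed
  show "coframe7 f e k (frame7 f E l) = (if k = l then 1 else 0)" if kl: "k \<in> {1..7}" "l \<in> {1..7}" for k l
  proof -
    have "e k [0] = 0" if "k \<in> {1..6}"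
      using linear_0[OF lin[OF that]] .
    then show ?thesis
      using E kl f unfolding dual_frame_def coframe7_def frame7_def split by auto
  qed
  show "v = (\<Sum>k = 1..7. coframe7 f e k v *\<^sub>R frame7 f E k)" for v
  proof -
    have "fst v = (\<Sum>k = 1..6. e k [fst v] *\<^sub>R E k)"
      using E unfolding dual_frame_def by blast
    moreover have "(\<Sum>k = 1..6. coframe7 f e k v *\<^sub>R frame7 f E k) = (\<Sum>k = 1..6. (e k [fst v] *\<^sub>R E k, 0))"
      by (intro sum.cong refl) (auto simp: coframe7_def frame7_def)
    moreover have "(\<Sum>k = 1..6. (e k [fst v] *\<^sub>R E k, 0 :: real)) = (\<Sum>k = 1..6. e k [fst v] *\<^sub>R E k, 0)"
      by (simp add: prod_eq_iff fst_sum snd_sum)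
    ultimately show ?thesis
      using f unfolding split by (subst sum.insert) (auto simp: coframe7_def frame7_def prod_eq_iff)
  qed
qed

text \<open>The seventh frame vector has first component 0, so a pulled back form vanishes as soon
  as it occurs.\<close>

lemma agree_pl:
  assumes A: "alternating k (A :: 'v::real_vector mform)"
  shows "agree 7 k (pl A \<circ> map (frame7 f E)) (up (A \<circ> map E))"
  unfolding agree_def
proof
  fix js assume "js \<in> set (combs k [1..<Suc 7])"
  then show "(pl A \<circ> map (frame7 f E)) js = up (A \<circ> map E) js"
  proof (cases rule: combs_7_cases)
    case 1
    then have "map fst (map (frame7 f E) js) = map E js"
      by (auto simp: frame7_def)
    then show ?thesis
      using 1 by (simp add: up_def del: map_map)
  next
    case (2 us)
    have "linear (\<lambda>v. A (map (fst \<circ> frame7 f E) us @ v # []))"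
      using A by (simp only: alternating_iff skew_def multilinear_def)
    from linear_0[OF this] show ?thesis
      using 2 by (simp add: up_def frame7_def)
  qed
qed

text \<open>The factor \<open>f\<close> of the form cancels the factor \<open>1 / f\<close> of the
  seventh frame vector.\<close>

lemma agree_pl_dt:
  assumes f: "f \<noteq> 0"
  shows "agree 7 (Suc k) ((pl (\<lambda>vs. f * A vs) \<^bold>\<and> dt) \<circ> map (frame7 f E)) (up7 (A \<circ> map E))"
  unfolding agree_def
proof
  have d: "of_degree 1 (dt :: ('v \<times> real) mform)"
    by (simp add: of_degree_def dt_def)
  have z: "dt [u] = 0" if "u \<in> set (map (frame7 f E) us)" "7 \<notin> set us" for u us
    using that by (auto simp: dt_def frame7_def)
  fix js assume "js \<in> set (combs (Suc k) [1..<Suc 7])"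
  then show "((pl (\<lambda>vs. f * A vs) \<^bold>\<and> dt) \<circ> map (frame7 f E)) js = up7 (A \<circ> map E) js"
  proof (cases rule: combs_7_cases)
    case 1
    then show ?thesis
      by (simp add: up7_def) (rule mwedge_1_eq_0[OF d z[OF _ 1(1)]])
  next
    case (2 us)
    have "map fst (map (frame7 f E) us) = map E us"
      using 2(2) by (auto simp: frame7_def)
    moreover have "dt [frame7 f E 7] = 1 / f"
      by (simp add: dt_def frame7_def)
    moreover have "(pl (\<lambda>vs. f * A vs) \<^bold>\<and> dt) (map (frame7 f E) us @ [frame7 f E 7])
        = f * A (map fst (map (frame7 f E) us)) * dt [frame7 f E 7]"
      by (rule mwedge_append_1[OF d z[OF _ 2(2)]])
    ultimately show ?thesis
      using 2 f by (simp add: up7_def del: map_map)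
  qed
qed

lemma comp_scale: "(\<lambda>vs. c * A vs) \<circ> f = (\<lambda>js. c * (A \<circ> f) js)"
  for A :: "'a \<Rightarrow> real"
  by (simp add: o_def)

text \<open>The data at one point of the 6-manifold, free of charts and derivatives and with the
  rotation already carried out. \<open>T\<close>, \<open>P\<close>, \<open>N\<close> stand for the
  values of \<open>df/f\<close>, \<open>\<pi>\<^sub>1\<close>, \<open>\<nu>\<^sub>1\<close>;
  \<open>p0\<close>, \<open>s0\<close>, \<open>A2\<close>, \<open>S2\<close> for those of the
  rotated torsion forms.\<close>

locale g2_point =
  fixes e :: "nat \<Rightarrow> (real^6) mform" and E :: "nat \<Rightarrow> real^6" and w a b T P N A2 S2 N3 :: "(real^6) mform"
    and f p0 s0 :: real
  assumes ad: "adapted e w a b" and E: "dual_frame 6 (\<lambda>k v. e k [v]) E" and f: "f \<noteq> 0"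
    and one: "alternating 1 T" "alternating 1 P" "alternating 1 N"
    and A2: "alternating 2 A2" "A2 \<^bold>\<and> a = 0"
      "hodge (gram 6 (\<lambda>k v. e k [v])) (\<lambda>vs. 1/6 * (w \<^bold>\<and> w \<^bold>\<and> w) vs) A2 = - (A2 \<^bold>\<and> w)"
    and S2: "alternating 2 S2" "S2 \<^bold>\<and> a = 0"
      "hodge (gram 6 (\<lambda>k v. e k [v])) (\<lambda>vs. 1/6 * (w \<^bold>\<and> w \<^bold>\<and> w) vs) S2 = - (S2 \<^bold>\<and> w)"
    and N3: "alternating 3 N3" "N3 \<^bold>\<and> w = 0" "N3 \<^bold>\<and> a = 0" "N3 \<^bold>\<and> b = 0"
begin

definition "V6 = (\<lambda>vs. 1/6 * (w \<^bold>\<and> w \<^bold>\<and> w) vs)"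
definition "st6 = hodge (gram 6 (\<lambda>k v. e k [v])) V6"
definition "V7 = (\<lambda>vs. f * (pl V6 \<^bold>\<and> dt) vs)"
definition "st7 = hodge (gram 7 (coframe7 f e)) V7"
abbreviation "F \<equiv> frame7 f E"

definition "H2 = (\<lambda>vs. T vs + P vs - 2 * N vs)"
definition "H3 = T - P + N"
definition "phi = (\<lambda>vs. f * (pl w \<^bold>\<and> dt) vs) + pl a"
definition "t1 = (\<lambda>vs. 1/2 * s0 * f * dt vs) + pl (\<lambda>vs. 1/6 * (T + P + N) vs)"
definition "t2 = pl (- S2) + pl (\<lambda>vs. f / 3 * st6 (H2 \<^bold>\<and> w \<^bold>\<and> w) vs) \<^bold>\<and> dt - pl (\<lambda>vs. 1/3 * st6 (H2 \<^bold>\<and> b) vs)"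
definition "t3 = pl (\<lambda>vs. 2/7 * p0 * f * w vs - f / 2 * st6 (H3 \<^bold>\<and> a) vs + f * A2 vs) \<^bold>\<and> dt
    - pl (\<lambda>vs. 1/2 * st6 (H3 \<^bold>\<and> w) vs) - pl (\<lambda>vs. 3/14 * p0 * a vs) - pl (st6 N3)"

text \<open>\<open>dw\<close>, \<open>da\<close>, \<open>db\<close> are what the SU(3) torsion
  equations prescribe as derivatives of \<open>w\<close>, \<open>a\<close>,
  \<open>b\<close>.\<close>

definition "dw = (\<lambda>vs. - 3/2 * s0 * a vs + 3/2 * p0 * b vs + (N \<^bold>\<and> w) vs + N3 vs)"
definition "da = (\<lambda>vs. p0 * (w \<^bold>\<and> w) vs + (P \<^bold>\<and> a) vs - (A2 \<^bold>\<and> w) vs)"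
definition "db = (\<lambda>vs. s0 * (w \<^bold>\<and> w) vs + (P \<^bold>\<and> b) vs - (S2 \<^bold>\<and> w) vs)"

lemmas F_frame = dual_frame7[OF E f]
lemmas alt_wab = adapted_alternating[OF ad]
lemmas tables = adapted_tables[OF ad E]

lemma alt_w: "alternating 4 (w \<^bold>\<and> w)" "alternating 6 (w \<^bold>\<and> w \<^bold>\<and> w)"
  using alternating_mwedge[OF alt_wab(1,1)] alternating_mwedge[OF alt_wab(1) alternating_mwedge[OF alt_wab(1,1)]] by simp_all

lemma alt_H: "alternating 1 H2" "alternating 1 H3"
proof -
  have "H2 = T + P - (\<lambda>vs. 2 * N vs)"
    by (simp add: H2_def fun_eq_iff)
  then show "alternating 1 H2"
    by (simp add: alternating_diff alternating_add alternating_scale one)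
  show "alternating 1 H3"
    unfolding H3_def by (intro alternating_diff alternating_add one)
qed

lemma alternating_1_wedge: "alternating 1 A \<Longrightarrow> alternating 2 B \<Longrightarrow> alternating 3 (A \<^bold>\<and> B)"
  "alternating 1 A \<Longrightarrow> alternating 3 B \<Longrightarrow> alternating 4 (A \<^bold>\<and> B)"
  "alternating 1 A \<Longrightarrow> alternating 4 B \<Longrightarrow> alternating 5 (A \<^bold>\<and> B)"
  "alternating 2 A \<Longrightarrow> alternating 2 B \<Longrightarrow> alternating 4 (A \<^bold>\<and> B)"
  "alternating 2 A \<Longrightarrow> alternating 3 B \<Longrightarrow> alternating 5 (A \<^bold>\<and> B)"
  "alternating 3 A \<Longrightarrow> alternating 2 B \<Longrightarrow> alternating 5 (A \<^bold>\<and> B)"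
  "alternating 3 A \<Longrightarrow> alternating 3 B \<Longrightarrow> alternating 6 (A \<^bold>\<and> B)"
  "alternating 3 A \<Longrightarrow> alternating 4 B \<Longrightarrow> alternating 7 (A \<^bold>\<and> B)"
  using alternating_mwedge[of 1 A 2 B] alternating_mwedge[of 1 A 3 B] alternating_mwedge[of 1 A 4 B]
    alternating_mwedge[of 2 A 2 B] alternating_mwedge[of 2 A 3 B] alternating_mwedge[of 3 A 2 B]
    alternating_mwedge[of 3 A 3 B] alternating_mwedge[of 3 A 4 B] by simp_all

lemma alternating_pl_dt': "alternating 1 A \<Longrightarrow> alternating 2 (pl A \<^bold>\<and> dt)" "alternating 2 A \<Longrightarrow> alternating 3 (pl A \<^bold>\<and> dt)"
  "alternating 3 A \<Longrightarrow> alternating 4 (pl A \<^bold>\<and> dt)" "alternating 4 A \<Longrightarrow> alternating 5 (pl A \<^bold>\<and> dt)"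
  "alternating 6 A \<Longrightarrow> alternating 7 (pl A \<^bold>\<and> dt)"
  using alternating_pl_dt[of 1 A] alternating_pl_dt[of 2 A] alternating_pl_dt[of 3 A] alternating_pl_dt[of 4 A]
   alternating_pl_dt[of 6 A] by simp_all

lemma alternating_sum: "alternating k A \<Longrightarrow> alternating k B \<Longrightarrow> alternating k (\<lambda>vs. A vs + B vs)"
  "alternating k A \<Longrightarrow> alternating k B \<Longrightarrow> alternating k (\<lambda>vs. A vs - B vs)"
  using alternating_add[of k A B] alternating_diff[of k A B] by (simp_all add: plus_fun_def fun_diff_def)

lemma V6: "alternating 6 V6" "V6 (map E [1..<Suc 6]) = 1"
proof -
  show "alternating 6 V6"
    unfolding V6_def by (rule alternating_scale[OF alt_w(2)])
  have "[1..<Suc 6] = [1,2,3,4,5,6::nat]"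
    by (simp add: upt_16)
  then show "V6 (map E [1..<Suc 6]) = 1"
    unfolding V6_def using su3_volume[OF ad E] by (simp only:)
qed

lemma V7: "alternating 7 V7" "V7 (map F [1..<Suc 7]) = 1"
proof -
  show "alternating 7 V7"
    unfolding V7_def by (intro alternating_scale alternating_pl_dt' V6)
  have V: "V7 = pl (\<lambda>vs. f * V6 vs) \<^bold>\<and> dt"
    by (simp add: V7_def mwedge_scale_left)
  have "[1..<Suc 7] = [1..<Suc 6] @ [7::nat]"
    by (simp add: upt_16)
  moreover have "[1..<Suc 7] \<in> set (combs (Suc 6) [1..<Suc 7])"
    by (simp add: upt_16 comps)
  ultimately show "V7 (map F [1..<Suc 7]) = 1"
    using agreeD[OF agree_pl_dt[OF f, of 6 V6 E], of "[1..<Suc 7]"] V6(2) unfolding V by (simp add: up7_def upt_16)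
qed

lemma alt_st6: "alternating k A \<Longrightarrow> k \<le> 6 \<Longrightarrow> alternating (6 - k) (st6 A)"
  unfolding st6_def by (rule alternating_hodge[OF E]) (use V6 in \<open>auto simp: alternating_iff\<close>)

lemma alt_st7: "alternating k A \<Longrightarrow> k \<le> 7 \<Longrightarrow> alternating (7 - k) (st7 A)"
  unfolding st7_def by (rule alternating_hodge[OF F_frame]) (use V7 in \<open>auto simp: alternating_iff\<close>)

lemma agree_st6: "alternating k A \<Longrightarrow> k + m = 6 \<Longrightarrow> agree 6 m (st6 A \<circ> map E) (nstar 6 (A \<circ> map E))"
  unfolding st6_def by (rule hodge_agree[OF E _ V6])

lemma agree_st7: "alternating k A \<Longrightarrow> k + m = 7 \<Longrightarrow> agree 7 m (st7 A \<circ> map F) (nstar 7 (A \<circ> map F))"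
  unfolding st7_def by (rule hodge_agree[OF F_frame _ V7])

lemma alt_st6': "alternating 5 A \<Longrightarrow> alternating 1 (st6 A)" "alternating 4 A \<Longrightarrow> alternating 2 (st6 A)"
  "alternating 3 A \<Longrightarrow> alternating 3 (st6 A)"
  using alt_st6[of 5 A] alt_st6[of 4 A] alt_st6[of 3 A] by (simp_all add: One_nat_def)

lemma alt_st7': "alternating 3 A \<Longrightarrow> alternating 4 (st7 A)" "alternating 2 A \<Longrightarrow> alternating 5 (st7 A)"
  using alt_st7[of 3 A] alt_st7[of 2 A] by simp_all

lemmas alts = alternating_add alternating_diff alternating_sum alternating_minus alternating_scale alternating_pl alternating_pl_dt'
  alternating_1_wedge alternating_dt alt_st6' alt_st7' alt_wab alt_w alt_H one A2(1) S2(1) N3(1) alternating_zero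

lemma alt_t: "alternating 3 phi" "alternating 1 t1" "alternating 2 t2" "alternating 3 t3"
  "alternating 3 dw" "alternating 4 da" "alternating 4 db"
  unfolding phi_def t1_def t2_def t3_def dw_def da_def db_def
  by (intro alts)+

lemma comp_wedge_6: "(A \<^bold>\<and> B) \<circ> map E = shuf k (A \<circ> map E) (B \<circ> map E)" if "alternating k A"
  by (rule shuf_comp_map[OF alternating_of_degree[OF that]])

lemma comp_wedge_7: "(A \<^bold>\<and> B) \<circ> map F = shuf k (A \<circ> map F) (B \<circ> map F)" if "alternating k A"
  by (rule shuf_comp_map[OF alternating_of_degree[OF that]])

lemma agree_pl_dt_scaled: "agree 7 (Suc k) ((\<lambda>vs. f * (pl A \<^bold>\<and> dt) vs) \<circ> map F) (up7 (A \<circ> map E))"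
  using agree_pl_dt[OF f, of k A E] by (simp only: mwedge_scale_left)

lemma agree_pl_dt_up7:
  assumes "agree 6 k (A \<circ> map E) B" "Suc k = m"
  shows "agree 7 m ((\<lambda>vs. f * (pl A \<^bold>\<and> dt) vs) \<circ> map F) (up7 B)"
  using agree_trans[OF agree_pl_dt_scaled agree_up7[OF assms(1)]] assms(2) by simp

lemma omega8_tables:
  assumes "alternating 2 S" "S \<^bold>\<and> a = 0"
    "hodge (gram 6 (\<lambda>k v. e k [v])) (\<lambda>vs. 1/6 * (w \<^bold>\<and> w \<^bold>\<and> w) vs) S = - (S \<^bold>\<and> w)"
  shows "agree 6 5 (shuf 2 (S \<circ> map E) (a \<circ> map E)) 0"
    "agree 6 4 (nstar 6 (S \<circ> map E)) (- shuf 2 (S \<circ> map E) (w \<circ> map E))"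
proof -
  have "(S \<^bold>\<and> a) \<circ> map E = 0"
    using assms(2) by (simp add: fun_eq_iff)
  then show "agree 6 5 (shuf 2 (S \<circ> map E) (a \<circ> map E)) 0"
    by (simp add: comp_wedge_6[OF assms(1)] agree_refl)
  have "st6 S = - (S \<^bold>\<and> w)"
    using assms(3) by (simp add: st6_def V6_def)
  then show "agree 6 4 (nstar 6 (S \<circ> map E)) (- shuf 2 (S \<circ> map E) (w \<circ> map E))"
    using agree_sym[OF agree_st6[OF assms(1), of 4]] by (simp add: comp_plus comp_wedge_6[OF assms(1)])
qed

lemma omega12_table: "N3 \<^bold>\<and> B = 0 \<Longrightarrow> agree 6 k (shuf 3 (N3 \<circ> map E) (B \<circ> map E)) 0"
proof -
  assume "N3 \<^bold>\<and> B = 0"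
  then have "(N3 \<^bold>\<and> B) \<circ> map E = 0"
    by (simp add: fun_eq_iff)
  then show ?thesis
    by (simp add: comp_wedge_6[OF N3(1)] agree_refl)
qed

lemma phi_table: "agree 7 3 (phi \<circ> map F) (up7 (w \<circ> map E) + up (a \<circ> map E))"
  unfolding phi_def comp_plus
  using agree_pl_dt_scaled[of 2 w] by (intro agree_add agree_pl alt_wab) simp

lemma sphi_table: "agree 7 4 (st7 phi \<circ> map F) (nstar 7 (phi \<circ> map F))"
  by (rule agree_st7[OF alt_t(1)]) simp

lemma dt_table: "agree 7 1 (dt \<circ> map F) (\<lambda>js. up7 (\<lambda>_. 1 / f) js)"
  using f by (simp add: comps dt_def frame7_def)

lemma t1_table: "agree 7 1 (t1 \<circ> map F)
    (up7 (\<lambda>_. s0/2) + up (\<lambda>js. 1/6 * ((T \<circ> map E) + (P \<circ> map E) + (N \<circ> map E)) js))"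
proof -
  \<comment> \<open>The form \<open>ds\<close> has seventh component \<open>1 / f\<close>, so the
    factor \<open>f\<close> in the claimed formula disappears.\<close>
  have "(\<lambda>js. 1/2 * s0 * f * up7 (\<lambda>_. 1 / f) js) = up7 (\<lambda>_. s0/2)"
    using f by (auto simp: up7_def fun_eq_iff)
  with agree_scale[OF dt_table, of "1/2 * s0 * f"]
  have 1: "agree 7 1 ((\<lambda>vs. 1/2 * s0 * f * dt vs) \<circ> map F) (up7 (\<lambda>_. s0/2))"
    unfolding comp_scale by (simp only:)
  have 2: "agree 7 1 (pl (\<lambda>vs. 1/6 * (T + P + N) vs) \<circ> map F) (up ((\<lambda>vs. 1/6 * (T + P + N) vs) \<circ> map E))"
    by (intro agree_pl alts)
  show ?thesis
    using agree_add[OF 1 2] unfolding t1_def comp_plus comp_scale .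
qed

lemma H_comp: "H2 \<circ> map E = (\<lambda>js. (T \<circ> map E) js + (P \<circ> map E) js - 2 * (N \<circ> map E) js)"
  "H3 \<circ> map E = (T \<circ> map E) - (P \<circ> map E) + (N \<circ> map E)"
  by (simp_all add: H2_def H3_def fun_eq_iff)

lemma t2_table: "agree 7 2 (t2 \<circ> map F) (up (- (S2 \<circ> map E))
   + up7 (\<lambda>js. 1/3 * nstar 6 (shuf 1 (H2 \<circ> map E) (shuf 2 (w \<circ> map E) (w \<circ> map E))) js)
   - up (\<lambda>js. 1/3 * nstar 6 (shuf 1 (H2 \<circ> map E) (b \<circ> map E)) js))"
proof -
  have "pl (\<lambda>vs. f / 3 * st6 (H2 \<^bold>\<and> w \<^bold>\<and> w) vs) \<^bold>\<and> dt = (\<lambda>vs. f * (pl (\<lambda>vs. 1/3 * st6 (H2 \<^bold>\<and> w \<^bold>\<and> w) vs) \<^bold>\<and> dt) vs)"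
    by (subst mwedge_scale_left[symmetric]) simp
  moreover have "agree 6 1 ((\<lambda>vs. 1/3 * st6 (H2 \<^bold>\<and> w \<^bold>\<and> w) vs) \<circ> map E)
      (\<lambda>js. 1/3 * nstar 6 ((H2 \<^bold>\<and> w \<^bold>\<and> w) \<circ> map E) js)"
    unfolding comp_scale by (rule agree_scale, rule agree_st6[of 5], intro alts) simp
  ultimately have 1: "agree 7 2 ((pl (\<lambda>vs. f / 3 * st6 (H2 \<^bold>\<and> w \<^bold>\<and> w) vs) \<^bold>\<and> dt) \<circ> map F)
      (up7 (\<lambda>js. 1/3 * nstar 6 ((H2 \<^bold>\<and> w \<^bold>\<and> w) \<circ> map E) js))"
    by (simp only:) (rule agree_pl_dt_up7, assumption, simp)
  have "agree 6 2 ((\<lambda>vs. 1/3 * st6 (H2 \<^bold>\<and> b) vs) \<circ> map E) (\<lambda>js. 1/3 * nstar 6 ((H2 \<^bold>\<and> b) \<circ> map E) js)"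
    unfolding comp_scale by (rule agree_scale, rule agree_st6[of 4], intro alts) simp
  then have 2: "agree 7 2 (pl (\<lambda>vs. 1/3 * st6 (H2 \<^bold>\<and> b) vs) \<circ> map F) (up (\<lambda>js. 1/3 * nstar 6 ((H2 \<^bold>\<and> b) \<circ> map E) js))"
    by (intro agree_trans[OF agree_pl agree_up] alts)
  have 3: "agree 7 2 (pl (- S2) \<circ> map F) (up ((- S2) \<circ> map E))"
    by (intro agree_pl alts)
  show ?thesis
    using agree_diff[OF agree_add[OF 3 1] 2]
    unfolding t2_def comp_plus comp_wedge_6[OF alt_H(1)] comp_wedge_6[OF alt_wab(1)] .
qed

lemma t3_table: "agree 7 3 (t3 \<circ> map F) (up7 (\<lambda>js. 2/7 * p0 * (w \<circ> map E) js
       - 1/2 * nstar 6 (shuf 1 (H3 \<circ> map E) (a \<circ> map E)) js + (A2 \<circ> map E) js)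
      - up (\<lambda>js. 1/2 * nstar 6 (shuf 1 (H3 \<circ> map E) (w \<circ> map E)) js) 
      - up (\<lambda>js. 3/14 * p0 * (a \<circ> map E) js) - up (nstar 6 (N3 \<circ> map E)))"
proof -
  let ?X = "\<lambda>vs. 2/7 * p0 * w vs - 1/2 * st6 (H3 \<^bold>\<and> a) vs + A2 vs"
  have "pl (\<lambda>vs. 2/7 * p0 * f * w vs - f / 2 * st6 (H3 \<^bold>\<and> a) vs + f * A2 vs) \<^bold>\<and> dt = (\<lambda>vs. f * (pl ?X \<^bold>\<and> dt) vs)"
    by (subst mwedge_scale_left[symmetric]) (simp add: algebra_simps)
  moreover have "agree 6 2 (?X \<circ> map E) (\<lambda>js. 2/7 * p0 * (w \<circ> map E) js
       - 1/2 * nstar 6 ((H3 \<^bold>\<and> a) \<circ> map E) js + (A2 \<circ> map E) js)"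
  proof -
    have "agree 6 2 (st6 (H3 \<^bold>\<and> a) \<circ> map E) (nstar 6 ((H3 \<^bold>\<and> a) \<circ> map E))"
      by (rule agree_st6[of 4], intro alts) simp
    then show ?thesis
      by (simp add: agree_def)
  qed
  ultimately have 1: "agree 7 3 ((pl (\<lambda>vs. 2/7 * p0 * f * w vs - f / 2 * st6 (H3 \<^bold>\<and> a) vs + f * A2 vs) \<^bold>\<and> dt) \<circ> map F)
      (up7 (\<lambda>js. 2/7 * p0 * (w \<circ> map E) js - 1/2 * nstar 6 ((H3 \<^bold>\<and> a) \<circ> map E) js + (A2 \<circ> map E) js))"
    by (simp only:) (rule agree_pl_dt_up7, assumption, simp)
  have "agree 6 3 ((\<lambda>vs. 1/2 * st6 (H3 \<^bold>\<and> w) vs) \<circ> map E) (\<lambda>js. 1/2 * nstar 6 ((H3 \<^bold>\<and> w) \<circ> map E) js)"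
    unfolding comp_scale by (rule agree_scale, rule agree_st6[of 3], intro alts) simp
  then have 2: "agree 7 3 (pl (\<lambda>vs. 1/2 * st6 (H3 \<^bold>\<and> w) vs) \<circ> map F) (up (\<lambda>js. 1/2 * nstar 6 ((H3 \<^bold>\<and> w) \<circ> map E) js))"
    by (intro agree_trans[OF agree_pl agree_up] alts)
  have 3: "agree 7 3 (pl (\<lambda>vs. 3/14 * p0 * a vs) \<circ> map F) (up ((\<lambda>vs. 3/14 * p0 * a vs) \<circ> map E))"
    by (intro agree_pl alts)
  have "agree 6 3 (st6 N3 \<circ> map E) (nstar 6 (N3 \<circ> map E))"
    by (rule agree_st6[OF N3(1)]) simp
  then have 4: "agree 7 3 (pl (st6 N3) \<circ> map F) (up (nstar 6 (N3 \<circ> map E)))"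
    by (intro agree_trans[OF agree_pl agree_up] alts)
  show ?thesis
    using agree_diff[OF agree_diff[OF agree_diff[OF 1 2] 3] 4]
    unfolding t3_def comp_plus comp_wedge_6[OF alt_H(2)] comp_scale .
qed

text \<open>Each component assumption is the table of the corresponding form, so the component
  identities become available for the forms themselves.\<close>

sublocale C: comps7 "w \<circ> map E" "a \<circ> map E" "b \<circ> map E" "T \<circ> map E" "P \<circ> map E" "N \<circ> map E" "A2 \<circ> map E" "S2 \<circ> map E"
  "N3 \<circ> map E" "phi \<circ> map F" "st7 phi \<circ> map F" "t1 \<circ> map F" "t2 \<circ> map F" "t3 \<circ> map F" p0 s0
  by unfold_locales
    (rule tables omega8_tables[OF A2] omega8_tables[OF S2] omega12_table[OF N3(2)] omega12_table[OF N3(3)] omega12_table[OF N3(4)]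
      phi_table sphi_table t1_table t2_table[unfolded H_comp] t3_table[unfolded H_comp])+

text \<open>The closed expression contains neither frame nor metric, which is what allows it to be
  differentiated later.\<close>

lemma star_phi: "st7 phi = pl (\<lambda>vs. 1/2 * (w \<^bold>\<and> w) vs) + pl (\<lambda>vs. f * b vs) \<^bold>\<and> dt"
proof (rule alternating_eqI[OF F_frame])
  have "agree 7 4 (nstar 7 (phi \<circ> map F)) (nstar 7 (up7 (w \<circ> map E) + up (a \<circ> map E)))"
    using phi_table by (simp add: comps)
  moreover note nstar_phi[OF tables]
  moreover have "agree 7 4 ((pl (\<lambda>vs. 1/2 * (w \<^bold>\<and> w) vs) + pl (\<lambda>vs. f * b vs) \<^bold>\<and> dt) \<circ> map F)
      (up (\<lambda>js. 1/2 * shuf 2 (w \<circ> map E) (w \<circ> map E) js) + up7 (b \<circ> map E))"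
  proof -
    have "agree 7 4 (pl (\<lambda>vs. 1/2 * (w \<^bold>\<and> w) vs) \<circ> map F) (up (\<lambda>js. 1/2 * shuf 2 (w \<circ> map E) (w \<circ> map E) js))"
      unfolding comp_wedge_6[OF alt_wab(1), symmetric] comp_scale[symmetric] by (intro agree_pl alts)
    then show ?thesis
      unfolding comp_plus using agree_pl_dt[OF f, of 3 b E] by (intro agree_add) simp_all
  qed
  ultimately show "agree 7 4 (st7 phi \<circ> map F) ((pl (\<lambda>vs. 1/2 * (w \<^bold>\<and> w) vs) + pl (\<lambda>vs. f * b vs) \<^bold>\<and> dt) \<circ> map F)"
    using sphi_table agree_trans agree_sym by blast
qed (intro alts alt_t)+

end

lemma hodge_diff: "hodge g v (A - B) = hodge g v A - hodge g v B"
  and hodge_add: "hodge g v (A + B) = hodge g v A + hodge g v B"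
  and hodge_scale: "hodge g v (\<lambda>vs. c * A vs) = (\<lambda>vs. c * hodge g v A vs)"
  by (simp_all add: fun_eq_iff hodge_def Let_def algebra_simps sum_subtractf sum.distrib sum_distrib_left
      diff_divide_distrib add_divide_distrib)

section \<open>Solvability and uniqueness of the torsion equations at a point\<close>

context g2_point
begin

text \<open>The torsion equations as a linear system with free right-hand sides \<open>X\<close> and
  \<open>Y\<close>, the places of the derivatives of \<phi> and of its star. Leaving them free makes
  the homogeneous system an instance.\<close>

definition "solution \<tau>\<^sub>0 \<tau>\<^sub>1 \<tau>\<^sub>2 \<tau>\<^sub>3 X Y \<longleftrightarrow>
  alternating 1 \<tau>\<^sub>1 \<and> alternating 2 \<tau>\<^sub>2 \<and> alternating 3 \<tau>\<^sub>3 \<and>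
  X = (\<lambda>vs. \<tau>\<^sub>0 * st7 phi vs) + (\<lambda>vs. 3 * (\<tau>\<^sub>1 \<^bold>\<and> phi) vs) + st7 \<tau>\<^sub>3 \<and>
  Y = (\<lambda>vs. 4 * (\<tau>\<^sub>1 \<^bold>\<and> st7 phi) vs) + \<tau>\<^sub>2 \<^bold>\<and> phi \<and>
  \<tau>\<^sub>2 \<^bold>\<and> phi = - st7 \<tau>\<^sub>2 \<and> \<tau>\<^sub>3 \<^bold>\<and> phi = 0 \<and> \<tau>\<^sub>3 \<^bold>\<and> st7 phi = 0"

lemma solution_unique_0:
  assumes "solution \<tau>\<^sub>0 \<tau>\<^sub>1 \<tau>\<^sub>2 \<tau>\<^sub>3 0 0"
  shows "\<tau>\<^sub>0 = 0 \<and> \<tau>\<^sub>1 = 0 \<and> \<tau>\<^sub>2 = 0 \<and> \<tau>\<^sub>3 = 0"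
proof -
  have alt: "alternating 1 \<tau>\<^sub>1" "alternating 2 \<tau>\<^sub>2" "alternating 3 \<tau>\<^sub>3"
    and X: "(\<lambda>vs. \<tau>\<^sub>0 * st7 phi vs) + (\<lambda>vs. 3 * (\<tau>\<^sub>1 \<^bold>\<and> phi) vs) + st7 \<tau>\<^sub>3 = 0"
    and Y: "(\<lambda>vs. 4 * (\<tau>\<^sub>1 \<^bold>\<and> st7 phi) vs) + \<tau>\<^sub>2 \<^bold>\<and> phi = 0"
    and 2: "\<tau>\<^sub>2 \<^bold>\<and> phi = - st7 \<tau>\<^sub>2" and 3: "\<tau>\<^sub>3 \<^bold>\<and> phi = 0" "\<tau>\<^sub>3 \<^bold>\<and> st7 phi = 0"
    using assms unfolding solution_def by metis+
  note w = comp_wedge_7[OF alt(1)] comp_wedge_7[OF alt(2)] comp_wedge_7[OF alt(3)]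
  have z: "(0 :: ((real^6) \<times> real) mform) \<circ> map F = 0"
    by (simp add: fun_eq_iff)
  have ph: "agree 7 3 (phi \<circ> map F) (\<lambda>js. tab [[1,2,7],[3,4,7],[5,6,7],[1,3,5]] [[1,4,6],[2,3,6],[2,4,5]] js)"
  proof -
    note comps [simp]
    note tables[simplified, simp]
    show ?thesis
      using phi_table by simp
  qed
  have x: "agree 7 4 (\<lambda>js. \<tau>\<^sub>0 * (st7 phi \<circ> map F) js + 3 * shuf 1 (\<tau>\<^sub>1 \<circ> map F) (phi \<circ> map F) js + nstar 7 (\<tau>\<^sub>3 \<circ> map F) js) 0"
  proof -
    have "agree 7 4 (st7 \<tau>\<^sub>3 \<circ> map F) (nstar 7 (\<tau>\<^sub>3 \<circ> map F))"
      by (rule agree_st7[OF alt(3)]) simp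
    moreover have "\<tau>\<^sub>0 * (st7 phi \<circ> map F) js + 3 * shuf 1 (\<tau>\<^sub>1 \<circ> map F) (phi \<circ> map F) js + (st7 \<tau>\<^sub>3 \<circ> map F) js = 0" for js
      using fun_cong[OF X, of "map F js"] unfolding w[symmetric] by simp
    ultimately show ?thesis
      unfolding agree_def by (metis zero_fun_apply)
  qed
  have y: "agree 7 5 (\<lambda>js. 4 * shuf 1 (\<tau>\<^sub>1 \<circ> map F) (st7 phi \<circ> map F) js + shuf 2 (\<tau>\<^sub>2 \<circ> map F) (phi \<circ> map F) js) 0"
  proof -
    have "4 * shuf 1 (\<tau>\<^sub>1 \<circ> map F) (st7 phi \<circ> map F) js + shuf 2 (\<tau>\<^sub>2 \<circ> map F) (phi \<circ> map F) js = 0" for js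
      using fun_cong[OF Y, of "map F js"] unfolding w[symmetric] by simp
    then show ?thesis
      by (simp add: agree_def)
  qed
  have t2: "agree 7 5 (shuf 2 (\<tau>\<^sub>2 \<circ> map F) (phi \<circ> map F)) (- nstar 7 (\<tau>\<^sub>2 \<circ> map F))"
  proof -
    have "agree 7 5 (st7 \<tau>\<^sub>2 \<circ> map F) (nstar 7 (\<tau>\<^sub>2 \<circ> map F))"
      by (rule agree_st7[OF alt(2)]) simp
    then show ?thesis
      unfolding w[symmetric] 2 comp_plus by (rule agree_minus)
  qed
  have t3: "agree 7 6 (shuf 3 (\<tau>\<^sub>3 \<circ> map F) (phi \<circ> map F)) 0" "agree 7 7 (shuf 3 (\<tau>\<^sub>3 \<circ> map F) (st7 phi \<circ> map F)) 0"
    unfolding w[symmetric] 3 z by (rule agree_refl)+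
  note u = g2_unique[OF ph sphi_table x y t2 t3]
  show ?thesis
  proof (intro conjI)
    show "\<tau>\<^sub>0 = 0" by (rule u)
    show "\<tau>\<^sub>1 = 0" by (rule alternating_eqI[OF F_frame alt(1) alternating_zero]) (simp only: z u)
    show "\<tau>\<^sub>2 = 0" by (rule alternating_eqI[OF F_frame alt(2) alternating_zero]) (simp only: z u)
    show "\<tau>\<^sub>3 = 0" by (rule alternating_eqI[OF F_frame alt(3) alternating_zero]) (simp only: z u)
  qed
qed

text \<open>The system is linear, so the difference of two solutions solves the homogeneous
  one.\<close>

lemma solution_unique:
  assumes "solution \<tau>\<^sub>0 \<tau>\<^sub>1 \<tau>\<^sub>2 \<tau>\<^sub>3 X Y" "solution \<tau>\<^sub>0' \<tau>\<^sub>1' \<tau>\<^sub>2' \<tau>\<^sub>3' X Y"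
  shows "\<tau>\<^sub>0 = \<tau>\<^sub>0' \<and> \<tau>\<^sub>1 = \<tau>\<^sub>1' \<and> \<tau>\<^sub>2 = \<tau>\<^sub>2' \<and> \<tau>\<^sub>3 = \<tau>\<^sub>3'"
proof -
  have "solution (\<tau>\<^sub>0 - \<tau>\<^sub>0') (\<tau>\<^sub>1 - \<tau>\<^sub>1') (\<tau>\<^sub>2 - \<tau>\<^sub>2') (\<tau>\<^sub>3 - \<tau>\<^sub>3') 0 0"
    unfolding solution_def
  proof (intro conjI alternating_diff)
    have d: "st7 (A - B) = st7 A - st7 B" for A B
      by (simp add: st7_def hodge_diff)
    note s = assms[unfolded solution_def]
    show "0 = (\<lambda>vs. (\<tau>\<^sub>0 - \<tau>\<^sub>0') * st7 phi vs) + (\<lambda>vs. 3 * ((\<tau>\<^sub>1 - \<tau>\<^sub>1') \<^bold>\<and> phi) vs) + st7 (\<tau>\<^sub>3 - \<tau>\<^sub>3')"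
    proof
      fix vs
      have "\<tau>\<^sub>0 * st7 phi vs + 3 * (\<tau>\<^sub>1 \<^bold>\<and> phi) vs + st7 \<tau>\<^sub>3 vs = \<tau>\<^sub>0' * st7 phi vs + 3 * (\<tau>\<^sub>1' \<^bold>\<and> phi) vs + st7 \<tau>\<^sub>3' vs"
        using s by (metis (no_types, lifting) plus_fun_apply)
      then show "0 vs = ((\<lambda>vs. (\<tau>\<^sub>0 - \<tau>\<^sub>0') * st7 phi vs) + (\<lambda>vs. 3 * ((\<tau>\<^sub>1 - \<tau>\<^sub>1') \<^bold>\<and> phi) vs) + st7 (\<tau>\<^sub>3 - \<tau>\<^sub>3')) vs"
        by (simp add: d mwedge_diff_left algebra_simps)
    qed
    show "0 = (\<lambda>vs. 4 * ((\<tau>\<^sub>1 - \<tau>\<^sub>1') \<^bold>\<and> st7 phi) vs) + (\<tau>\<^sub>2 - \<tau>\<^sub>2') \<^bold>\<and> phi"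
    proof
      fix vs
      have "4 * (\<tau>\<^sub>1 \<^bold>\<and> st7 phi) vs + (\<tau>\<^sub>2 \<^bold>\<and> phi) vs = 4 * (\<tau>\<^sub>1' \<^bold>\<and> st7 phi) vs + (\<tau>\<^sub>2' \<^bold>\<and> phi) vs"
        using s by (metis (no_types, lifting) plus_fun_apply)
      then show "0 vs = ((\<lambda>vs. 4 * ((\<tau>\<^sub>1 - \<tau>\<^sub>1') \<^bold>\<and> st7 phi) vs) + (\<tau>\<^sub>2 - \<tau>\<^sub>2') \<^bold>\<and> phi) vs"
        by (simp add: mwedge_diff_left algebra_simps)
    qed
    show "(\<tau>\<^sub>2 - \<tau>\<^sub>2') \<^bold>\<and> phi = - st7 (\<tau>\<^sub>2 - \<tau>\<^sub>2')" "(\<tau>\<^sub>3 - \<tau>\<^sub>3') \<^bold>\<and> phi = 0" "(\<tau>\<^sub>3 - \<tau>\<^sub>3') \<^bold>\<and> st7 phi = 0"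
      using s by (simp_all add: d mwedge_diff_left)
  qed (use assms in \<open>simp_all add: solution_def\<close>)
  from solution_unique_0[OF this] show ?thesis
    by simp
qed

text \<open>The right-hand sides are the derivatives of \<phi> and of its star after
  \<open>df\<close> is replaced by \<open>f T\<close>. Each equation is compared on the frame, where
  it is one of the component identities.\<close>

lemma solution_t:
  "solution (12/7 * p0) t1 t2 t3
     (pl (\<lambda>vs. f * ((T \<^bold>\<and> w) vs + dw vs)) \<^bold>\<and> dt + pl da)
     (pl (\<lambda>vs. 1/2 * ((dw \<^bold>\<and> w) vs + (w \<^bold>\<and> dw) vs)) + pl (\<lambda>vs. f * ((T \<^bold>\<and> b) vs + db vs)) \<^bold>\<and> dt)"
  unfolding solution_def
proof (intro conjI alt_t)
  note w6 = comp_wedge_6[OF one(1)] comp_wedge_6[OF one(2)] comp_wedge_6[OF one(3)] comp_wedge_6[OF alt_wab(1)]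
    comp_wedge_6[OF A2(1)] comp_wedge_6[OF S2(1)] comp_wedge_6[OF alt_t(5)]
  note w7 = comp_wedge_7[OF alt_t(2)] comp_wedge_7[OF alt_t(3)] comp_wedge_7[OF alt_t(4)]
  have st: "agree 7 4 (st7 t3 \<circ> map F) (nstar 7 (t3 \<circ> map F))"
    by (rule agree_st7[OF alt_t(4)]) simp
  show "pl (\<lambda>vs. f * ((T \<^bold>\<and> w) vs + dw vs)) \<^bold>\<and> dt + pl da
      = (\<lambda>vs. 12/7 * p0 * st7 phi vs) + (\<lambda>vs. 3 * (t1 \<^bold>\<and> phi) vs) + st7 t3"
  proof (rule alternating_eqI[OF F_frame])
    have 1: "(\<lambda>vs. (T \<^bold>\<and> w) vs + dw vs) \<circ> map E = (\<lambda>js. shuf 1 (T \<circ> map E) (w \<circ> map E) js - 3/2 * s0 * (a \<circ> map E) js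
        + 3/2 * p0 * (b \<circ> map E) js + shuf 1 (N \<circ> map E) (w \<circ> map E) js + (N3 \<circ> map E) js)"
      unfolding w6[symmetric] by (simp add: fun_eq_iff dw_def)
    have 2: "da \<circ> map E = (\<lambda>js. p0 * shuf 2 (w \<circ> map E) (w \<circ> map E) js + shuf 1 (P \<circ> map E) (a \<circ> map E) js
        - shuf 2 (A2 \<circ> map E) (w \<circ> map E) js)"
      unfolding w6[symmetric] by (simp add: fun_eq_iff da_def)
    have 3: "agree 7 4 ((pl (\<lambda>vs. f * ((T \<^bold>\<and> w) vs + dw vs)) \<^bold>\<and> dt) \<circ> map F) (up7 ((\<lambda>vs. (T \<^bold>\<and> w) vs + dw vs) \<circ> map E))"
      using agree_pl_dt[OF f, of 3 "\<lambda>vs. (T \<^bold>\<and> w) vs + dw vs" E] by simp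
    have 4: "agree 7 4 (pl da \<circ> map F) (up (da \<circ> map E))"
      by (rule agree_pl[OF alt_t(6)])
    have 5: "agree 7 4 (((\<lambda>vs. 12/7 * p0 * st7 phi vs) + (\<lambda>vs. 3 * (t1 \<^bold>\<and> phi) vs) + st7 t3) \<circ> map F)
        (\<lambda>js. p0 * 12/7 * (st7 phi \<circ> map F) js + 3 * shuf 1 (t1 \<circ> map F) (phi \<circ> map F) js + nstar 7 (t3 \<circ> map F) js)"
      unfolding w7[symmetric] using st by (simp add: agree_def)
    show "agree 7 4 ((pl (\<lambda>vs. f * ((T \<^bold>\<and> w) vs + dw vs)) \<^bold>\<and> dt + pl da) \<circ> map F)
       (((\<lambda>vs. 12/7 * p0 * st7 phi vs) + (\<lambda>vs. 3 * (t1 \<^bold>\<and> phi) vs) + st7 t3) \<circ> map F)"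
      using agree_trans[OF agree_trans[OF agree_add[OF 3 4, unfolded 1 2] C.d_phi_comps] agree_sym[OF 5]]
      unfolding comp_plus .
  qed (intro alts alt_t)+
  show "pl (\<lambda>vs. 1/2 * ((dw \<^bold>\<and> w) vs + (w \<^bold>\<and> dw) vs)) + pl (\<lambda>vs. f * ((T \<^bold>\<and> b) vs + db vs)) \<^bold>\<and> dt
      = (\<lambda>vs. 4 * (t1 \<^bold>\<and> st7 phi) vs) + t2 \<^bold>\<and> phi"
  proof (rule alternating_eqI[OF F_frame])
    have 1: "(\<lambda>vs. (T \<^bold>\<and> b) vs + db vs) \<circ> map E = (\<lambda>js. shuf 1 (T \<circ> map E) (b \<circ> map E) js
        + s0 * shuf 2 (w \<circ> map E) (w \<circ> map E) js + shuf 1 (P \<circ> map E) (b \<circ> map E) js - shuf 2 (S2 \<circ> map E) (w \<circ> map E) js)"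
      unfolding w6[symmetric] by (simp add: fun_eq_iff db_def)
    have 2: "(\<lambda>vs. 1/2 * ((dw \<^bold>\<and> w) vs + (w \<^bold>\<and> dw) vs)) \<circ> map E
        = (\<lambda>js. 1/2 * (shuf 3 (dw \<circ> map E) (w \<circ> map E) js + shuf 2 (w \<circ> map E) (dw \<circ> map E) js))"
      unfolding w6[symmetric] by (simp add: fun_eq_iff)
    have d: "dw \<circ> map E = (\<lambda>js. - 3/2 * s0 * (a \<circ> map E) js + 3/2 * p0 * (b \<circ> map E) js
        + shuf 1 (N \<circ> map E) (w \<circ> map E) js + (N3 \<circ> map E) js)"
      unfolding w6[symmetric] by (simp add: fun_eq_iff dw_def)
    have 3: "agree 7 5 ((pl (\<lambda>vs. f * ((T \<^bold>\<and> b) vs + db vs)) \<^bold>\<and> dt) \<circ> map F) (up7 ((\<lambda>vs. (T \<^bold>\<and> b) vs + db vs) \<circ> map E))"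
      using agree_pl_dt[OF f, of 4 "\<lambda>vs. (T \<^bold>\<and> b) vs + db vs" E] by simp
    have 4: "agree 7 5 (pl (\<lambda>vs. 1/2 * ((dw \<^bold>\<and> w) vs + (w \<^bold>\<and> dw) vs)) \<circ> map F)
        (up (shuf 2 (w \<circ> map E) (dw \<circ> map E)))"
    proof -
      have "agree 7 5 (pl (\<lambda>vs. 1/2 * ((dw \<^bold>\<and> w) vs + (w \<^bold>\<and> dw) vs)) \<circ> map F)
          (up ((\<lambda>vs. 1/2 * ((dw \<^bold>\<and> w) vs + (w \<^bold>\<and> dw) vs)) \<circ> map E))"
        by (intro agree_pl alts alt_t)
      then show ?thesis
        unfolding 2 by (rule agree_trans[OF _ agree_up[OF agree_wedge_w_commute[OF tables(1)]]])
    qed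
    have 5: "agree 7 5 (((\<lambda>vs. 4 * (t1 \<^bold>\<and> st7 phi) vs) + t2 \<^bold>\<and> phi) \<circ> map F)
        (\<lambda>js. 4 * shuf 1 (t1 \<circ> map F) (st7 phi \<circ> map F) js + shuf 2 (t2 \<circ> map F) (phi \<circ> map F) js)"
      unfolding w7[symmetric] by (simp add: agree_def)
    have 6: "agree 7 5 ((up (shuf 2 (w \<circ> map E) (dw \<circ> map E))) + (up7 ((\<lambda>vs. (T \<^bold>\<and> b) vs + db vs) \<circ> map E)))
        (\<lambda>js. 4 * shuf 1 (t1 \<circ> map F) (st7 phi \<circ> map F) js + shuf 2 (t2 \<circ> map F) (phi \<circ> map F) js)"
      using C.d_star_phi_comps unfolding 1 d by (simp only: add.commute)
    show "agree 7 5 ((pl (\<lambda>vs. 1/2 * ((dw \<^bold>\<and> w) vs + (w \<^bold>\<and> dw) vs)) + pl (\<lambda>vs. f * ((T \<^bold>\<and> b) vs + db vs)) \<^bold>\<and> dt) \<circ> map F)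
      (((\<lambda>vs. 4 * (t1 \<^bold>\<and> st7 phi) vs) + t2 \<^bold>\<and> phi) \<circ> map F)"
      using agree_trans[OF agree_trans[OF agree_add[OF 4 3] 6] agree_sym[OF 5]]
      unfolding comp_plus .
  qed (intro alts alt_t)+
  show "t2 \<^bold>\<and> phi = - st7 t2"
  proof (rule alternating_eqI[OF F_frame])
    have "agree 7 5 (st7 t2 \<circ> map F) (nstar 7 (t2 \<circ> map F))"
      by (rule agree_st7[OF alt_t(3)]) simp
    then show "agree 7 5 ((t2 \<^bold>\<and> phi) \<circ> map F) ((- st7 t2) \<circ> map F)"
      unfolding w7 comp_plus using agree_trans[OF C.T2_wedge_phi agree_sym[OF agree_minus]] by blast
  qed (intro alts alt_t)+
  have z: "(0 :: ((real^6) \<times> real) mform) \<circ> map F = 0"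
    by (simp add: fun_eq_iff)
  show "t3 \<^bold>\<and> phi = 0"
    by (rule alternating_eqI[OF F_frame, of 6], intro alts alt_t, rule alternating_zero) (simp only: w7 z C.T3_wedge_phi)
  show "t3 \<^bold>\<and> st7 phi = 0"
    by (rule alternating_eqI[OF F_frame, of 7], intro alts alt_t, rule alternating_zero) (simp only: w7 z C.T3_wedge_star_phi)
qed

end

section \<open>The torsion forms\<close>

lemma hodge_zero: "hodge g v 0 = 0"
  using hodge_scale[of g v 0 0] by (simp add: zero_fun_def)

lemma Omega28_wedge:
  assumes ad: "adapted e w a b" and S: "alternating 2 S" "S \<^bold>\<and> a = 0"
    and h: "hodge (gram 6 (\<lambda>k v. e k [v])) (\<lambda>vs. 1/6 * (w \<^bold>\<and> w \<^bold>\<and> w) vs) S = - (S \<^bold>\<and> w)"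
  shows "S \<^bold>\<and> b = 0"
proof -
  obtain E where E: "dual_frame 6 (\<lambda>k v. e k [v]) E"
    using adapted_dual_frame[OF ad] by blast
  \<comment> \<open>With zero torsion data and \<open>f = 1\<close> every assumption on the torsion
    is trivial; the interpretation only provides the component tables of \<open>w\<close>,
    \<open>a\<close>, \<open>b\<close>.\<close>
  interpret g2_point e E w a b 0 0 0 0 0 0 1 0 0
    by unfold_locales
      (simp_all add: ad E alternating_zero mwedge_zero_left hodge_zero)
  show ?thesis
  proof (rule alternating_eqI[OF E])
    show "agree 6 5 ((S \<^bold>\<and> b) \<circ> map E) (0 \<circ> map E)"
      using omega8_wedge[OF tables(2,3,1) omega8_tables[OF S h]] comp_wedge_6[OF S(1), of b]
      by (simp add: agree_def)
  qed (intro alts S)+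
qed

section \<open>The global torsion forms\<close>

locale warped =
  fixes M :: "('i, 'p, real^6) manifold"
    and \<omega> \<psi>\<^sub>p \<psi>\<^sub>m \<pi>\<^sub>1 \<nu>\<^sub>1 \<pi>\<^sub>2 \<sigma>\<^sub>2 \<nu>\<^sub>3 :: "('i, 'p, real^6) dform"
    and \<pi>\<^sub>0 \<sigma>\<^sub>0 f :: "'p \<Rightarrow> real"
    and \<alpha> \<beta> :: real
  assumes M: "smooth_manifold M"
    and su: "su3_structure M \<omega> \<psi>\<^sub>p \<psi>\<^sub>m"
    and tors: "su3_torsion M \<omega> \<psi>\<^sub>p \<psi>\<^sub>m \<pi>\<^sub>0 \<sigma>\<^sub>0 \<pi>\<^sub>1 \<nu>\<^sub>1 \<pi>\<^sub>2 \<sigma>\<^sub>2 \<nu>\<^sub>3"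
    and f: "smooth_fun M f" and f0: "\<forall>p\<in>mf_points M. f p \<noteq> 0"
    and ab: "\<alpha>\<^sup>2 + \<beta>\<^sup>2 = 1"
begin

abbreviation "N \<equiv> prod_manifold M circle"
abbreviation "star6 \<equiv> su3_star \<omega> \<psi>\<^sub>p \<psi>\<^sub>m"
abbreviation "star7 \<equiv> warped_star f \<omega> \<psi>\<^sub>p \<psi>\<^sub>m"

definition "\<phi> = (f \<circ> fst) \<cdot>\<^sub>f (pull1 \<omega> \<and>\<^sub>f ds) + pull1 (\<alpha> *\<^sub>f \<psi>\<^sub>p - \<beta> *\<^sub>f \<psi>\<^sub>m)"
definition "\<theta> = (\<lambda>p. 1 / f p) \<cdot>\<^sub>f ext_d M (zero_form f)"
text \<open>The complex 3-form of the structure, with real part \<open>\<psi>\<^sub>p\<close> and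
  imaginary part \<open>\<psi>\<^sub>m\<close>, multiplied by \<alpha> + i \<beta>. Its torsion
  forms are obtained likewise: \<open>p\<^sub>0\<close>, \<open>s\<^sub>0\<close> and
  \<open>A\<^sub>2\<close>, \<open>S\<^sub>2\<close> are the rotated pairs, and
  \<open>\<pi>\<^sub>1\<close>, \<open>\<nu>\<^sub>1\<close>, \<open>\<nu>\<^sub>3\<close> stay as
  they are.\<close>

definition "\<rho>\<^sub>p = \<alpha> *\<^sub>f \<psi>\<^sub>p - \<beta> *\<^sub>f \<psi>\<^sub>m"
definition "\<rho>\<^sub>m = \<alpha> *\<^sub>f \<psi>\<^sub>m + \<beta> *\<^sub>f \<psi>\<^sub>p"
definition "A\<^sub>2 = \<alpha> *\<^sub>f \<pi>\<^sub>2 - \<beta> *\<^sub>f \<sigma>\<^sub>2"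
definition "S\<^sub>2 = \<alpha> *\<^sub>f \<sigma>\<^sub>2 + \<beta> *\<^sub>f \<pi>\<^sub>2"
definition "p\<^sub>0 p = \<alpha> * \<pi>\<^sub>0 p - \<beta> * \<sigma>\<^sub>0 p"
definition "s\<^sub>0 p = \<alpha> * \<sigma>\<^sub>0 p + \<beta> * \<pi>\<^sub>0 p"

definition "T\<^sub>0 = (\<lambda>x :: 'p \<times> complex. 12/7 * (\<alpha> * \<pi>\<^sub>0 (fst x) - \<beta> * \<sigma>\<^sub>0 (fst x)))"
definition "T\<^sub>1 = (\<lambda>x. 1/2 * (\<alpha> * \<sigma>\<^sub>0 (fst x) + \<beta> * \<pi>\<^sub>0 (fst x)) * f (fst x)) \<cdot>\<^sub>f ds
      + pull1 ((1/6) *\<^sub>f (\<theta> + \<pi>\<^sub>1 + \<nu>\<^sub>1))"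
definition "T\<^sub>2 = pull1 (- (\<alpha> *\<^sub>f \<sigma>\<^sub>2) - \<beta> *\<^sub>f \<pi>\<^sub>2)
      + pull1 ((\<lambda>p. f p / 3) \<cdot>\<^sub>f star6 ((\<theta> + \<pi>\<^sub>1 - 2 *\<^sub>f \<nu>\<^sub>1) \<and>\<^sub>f \<omega> \<and>\<^sub>f \<omega>)) \<and>\<^sub>f ds
      - pull1 ((1/3) *\<^sub>f star6 ((\<theta> + \<pi>\<^sub>1 - 2 *\<^sub>f \<nu>\<^sub>1) \<and>\<^sub>f (\<alpha> *\<^sub>f \<psi>\<^sub>m + \<beta> *\<^sub>f \<psi>\<^sub>p)))"
definition "T\<^sub>3 = pull1 ((\<lambda>p. 2/7 * (\<alpha> * \<pi>\<^sub>0 p - \<beta> * \<sigma>\<^sub>0 p) * f p) \<cdot>\<^sub>f \<omega>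
             - (\<lambda>p. f p / 2) \<cdot>\<^sub>f star6 ((\<theta> - \<pi>\<^sub>1 + \<nu>\<^sub>1) \<and>\<^sub>f (\<alpha> *\<^sub>f \<psi>\<^sub>p - \<beta> *\<^sub>f \<psi>\<^sub>m))
             + f \<cdot>\<^sub>f (\<alpha> *\<^sub>f \<pi>\<^sub>2 - \<beta> *\<^sub>f \<sigma>\<^sub>2)) \<and>\<^sub>f ds
      - pull1 ((1/2) *\<^sub>f star6 ((\<theta> - \<pi>\<^sub>1 + \<nu>\<^sub>1) \<and>\<^sub>f \<omega>))
      - pull1 ((\<lambda>p. 3/14 * (\<alpha> * \<pi>\<^sub>0 p - \<beta> * \<sigma>\<^sub>0 p)) \<cdot>\<^sub>f (\<alpha> *\<^sub>f \<psi>\<^sub>p - \<beta> *\<^sub>f \<psi>\<^sub>m))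
      - pull1 (star6 \<nu>\<^sub>3)"

lemmas nM = smooth_manifold_nice_charts[OF M]
lemmas nN = nice_charts_prod[OF M]

lemma dom_point: "i \<in> mf_idx M \<Longrightarrow> p \<in> mf_dom M i \<Longrightarrow> f p \<noteq> 0"
  using M f0 unfolding smooth_manifold_def by blast

lemma torsion_forms:
  "smooth_fun M \<pi>\<^sub>0" "smooth_fun M \<sigma>\<^sub>0" "\<pi>\<^sub>1 \<in> dforms M 1" "\<nu>\<^sub>1 \<in> dforms M 1" "\<pi>\<^sub>2 \<in> dforms M 2" "\<sigma>\<^sub>2 \<in> dforms M 2"
  "\<nu>\<^sub>3 \<in> dforms M 3" "\<omega> \<in> dforms M 2" "\<psi>\<^sub>p \<in> dforms M 3" "\<psi>\<^sub>m \<in> dforms M 3"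
  using tors su by (simp_all add: su3_torsion_def su3_structure_def su3_Omega28_def su3_Omega312_def)

lemma \<theta>_dforms: "\<theta> \<in> dforms M 1"
proof -
  have "smooth_fun M (\<lambda>p. 1 / f p)"
    unfolding smooth_fun_def o_def
  proof
    fix i assume i: "i \<in> mf_idx M"
    show "smooth_on (mf_img M i) (\<lambda>x. 1 / f (mf_inv M i x))"
      using f i by (intro smooth_on_divide smooth_on_const nice_charts_open[OF nM i] dom_point[OF i] mf_inv_dom)
        (auto simp: smooth_fun_def o_def)
  qed
  then show ?thesis
    unfolding \<theta>_def by (rule dforms_fun_scale[OF nM _ differential_dforms[OF M f]])
qed

lemma rotated_dforms: "\<rho>\<^sub>p \<in> dforms M 3" "\<rho>\<^sub>m \<in> dforms M 3" "A\<^sub>2 \<in> dforms M 2" "S\<^sub>2 \<in> dforms M 2"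
  unfolding \<rho>\<^sub>p_def \<rho>\<^sub>m_def A\<^sub>2_def S\<^sub>2_def
  by (intro dforms_add[OF nM] dforms_diff[OF nM] dforms_const_scale[OF nM] torsion_forms)+

lemma point_forms: "\<rho>\<^sub>p i p = (\<lambda>vs. \<alpha> * \<psi>\<^sub>p i p vs) - (\<lambda>vs. \<beta> * \<psi>\<^sub>m i p vs)"
  "\<rho>\<^sub>m i p = (\<lambda>vs. \<alpha> * \<psi>\<^sub>m i p vs) + (\<lambda>vs. \<beta> * \<psi>\<^sub>p i p vs)"
  "A\<^sub>2 i p = (\<lambda>vs. \<alpha> * \<pi>\<^sub>2 i p vs) - (\<lambda>vs. \<beta> * \<sigma>\<^sub>2 i p vs)"
  "S\<^sub>2 i p = (\<lambda>vs. \<alpha> * \<sigma>\<^sub>2 i p vs) + (\<lambda>vs. \<beta> * \<pi>\<^sub>2 i p vs)"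
  by (simp_all add: \<rho>\<^sub>p_def \<rho>\<^sub>m_def A\<^sub>2_def S\<^sub>2_def const_scale_def fun_eq_iff)

text \<open>The coframe returned is the rotated one; it has the same metric and the same \<omega>,
  so the stars do not change. The conditions on the torsion forms survive because their products
  with both original 3-forms vanish and the star is linear.\<close>

lemma point:
  assumes i: "i \<in> mf_idx M" and p: "p \<in> mf_dom M i"
  obtains e E where "g2_point e E (\<omega> i p) (\<rho>\<^sub>p i p) (\<rho>\<^sub>m i p) (\<theta> i p) (\<pi>\<^sub>1 i p) (\<nu>\<^sub>1 i p) (A\<^sub>2 i p) (S\<^sub>2 i p) (\<nu>\<^sub>3 i p) (f p)"
    "su3_metric \<omega> \<psi>\<^sub>p \<psi>\<^sub>m i p = gram 6 (\<lambda>k v. e k [v])"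
proof -
  obtain e where ad: "adapted e (\<omega> i p) (\<psi>\<^sub>p i p) (\<psi>\<^sub>m i p)"
    using su3_structure_adapted[OF su i p] by blast
  have ad': "adapted (rot \<alpha> \<beta> e) (\<omega> i p) (\<rho>\<^sub>p i p) (\<rho>\<^sub>m i p)"
    unfolding point_forms by (rule adapted_rot[OF ad ab])
  obtain E where E: "dual_frame 6 (\<lambda>k v. rot \<alpha> \<beta> e k [v]) E"
    using adapted_dual_frame[OF ad'] by blast
  let ?g = "gram 6 (\<lambda>k v. e k [v])" and ?V = "\<lambda>vs. 1/6 * (\<omega> i p \<^bold>\<and> \<omega> i p \<^bold>\<and> \<omega> i p) vs"
  have Om: "\<sigma> i p \<^bold>\<and> \<psi>\<^sub>p i p = 0 \<and> \<sigma> i p \<^bold>\<and> \<psi>\<^sub>m i p = 0 \<and> hodge ?g ?V (\<sigma> i p) = - (\<sigma> i p \<^bold>\<and> \<omega> i p)"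
    if "\<sigma> \<in> su3_Omega28 M \<omega> \<psi>\<^sub>p \<psi>\<^sub>m" for \<sigma>
  proof -
    have d: "\<sigma> \<in> dforms M 2" and 1: "\<sigma> i p \<^bold>\<and> \<psi>\<^sub>p i p = 0" and s: "su3_star \<omega> \<psi>\<^sub>p \<psi>\<^sub>m \<sigma> i p = - (\<sigma> i p \<^bold>\<and> \<omega> i p)"
      using that i p by (auto simp: su3_Omega28_def form_eq_def wedge_def)
    have 2: "hodge ?g ?V (\<sigma> i p) = - (\<sigma> i p \<^bold>\<and> \<omega> i p)"
      using s unfolding su3_star_eq[of e \<omega> i p \<psi>\<^sub>p \<psi>\<^sub>m, OF ad] su3_vol_eq .
    show ?thesis
      using 1 2 Omega28_wedge[OF ad dforms_alternating[OF d i p] 1 2] by simp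
  qed
  have "\<pi>\<^sub>2 \<in> su3_Omega28 M \<omega> \<psi>\<^sub>p \<psi>\<^sub>m" "\<sigma>\<^sub>2 \<in> su3_Omega28 M \<omega> \<psi>\<^sub>p \<psi>\<^sub>m"
    using tors by (simp_all add: su3_torsion_def)
  note O = Om[OF this(1)] Om[OF this(2)]
  have N: "\<nu>\<^sub>3 i p \<^bold>\<and> \<omega> i p = 0" "\<nu>\<^sub>3 i p \<^bold>\<and> \<psi>\<^sub>p i p = 0" "\<nu>\<^sub>3 i p \<^bold>\<and> \<psi>\<^sub>m i p = 0"
    using tors i p by (simp_all add: su3_torsion_def su3_Omega312_def form_eq_def wedge_def)
  note lin = mwedge_add_left mwedge_diff_left mwedge_scale_left mwedge_add_right mwedge_diff_right mwedge_scale_right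
  have "g2_point (rot \<alpha> \<beta> e) E (\<omega> i p) (\<rho>\<^sub>p i p) (\<rho>\<^sub>m i p) (\<theta> i p) (\<pi>\<^sub>1 i p) (\<nu>\<^sub>1 i p) (A\<^sub>2 i p) (S\<^sub>2 i p) (\<nu>\<^sub>3 i p) (f p)"
  proof
    show "hodge (gram 6 (\<lambda>k v. rot \<alpha> \<beta> e k [v])) ?V (A\<^sub>2 i p) = - (A\<^sub>2 i p \<^bold>\<and> \<omega> i p)"
      "hodge (gram 6 (\<lambda>k v. rot \<alpha> \<beta> e k [v])) ?V (S\<^sub>2 i p) = - (S\<^sub>2 i p \<^bold>\<and> \<omega> i p)"
      unfolding gram_rot[OF ab] point_forms(3,4) lin hodge_diff hodge_add hodge_scale
      using O by (simp_all add: fun_eq_iff)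
    show "A\<^sub>2 i p \<^bold>\<and> \<rho>\<^sub>p i p = 0" "S\<^sub>2 i p \<^bold>\<and> \<rho>\<^sub>p i p = 0" "\<nu>\<^sub>3 i p \<^bold>\<and> \<omega> i p = 0"
      "\<nu>\<^sub>3 i p \<^bold>\<and> \<rho>\<^sub>p i p = 0" "\<nu>\<^sub>3 i p \<^bold>\<and> \<rho>\<^sub>m i p = 0"
      unfolding point_forms lin using O N by (simp_all add: fun_eq_iff)
  qed (rule ad' E dom_point[OF i p] dforms_alternating[OF _ i p] \<theta>_dforms torsion_forms rotated_dforms)+
  moreover have "su3_metric \<omega> \<psi>\<^sub>p \<psi>\<^sub>m i p = gram 6 (\<lambda>k v. rot \<alpha> \<beta> e k [v])"
    unfolding gram_rot[OF ab] by (rule su3_metric_eq, rule ad)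
  ultimately show thesis
    by (rule that)
qed

text \<open>With \<open>f\<close> moved inside the pullback, \<phi> is built from forms on
  \<open>M\<close> to which the product rules for the derivative apply.\<close>

lemma \<phi>_alt: "\<phi> = pull1 (f \<cdot>\<^sub>f \<omega>) \<and>\<^sub>f ds + pull1 \<rho>\<^sub>p"
proof -
  have e: "pull1 (f \<cdot>\<^sub>f \<omega>) c x = (\<lambda>vs. f (fst x) * pull1 \<omega> c x vs)" for c :: "'i \<times> bool" and x :: "'p \<times> complex"
    by (simp add: fun_eq_iff fun_scale_def pull1_def)
  show ?thesis
    unfolding \<phi>_def \<rho>\<^sub>p_def by (simp add: e fun_eq_iff fun_scale_def[of "f \<circ> fst"] wedge_def mwedge_scale_left)
qed

lemma ds_dt: "ds c x = dt"
  by (simp add: fun_eq_iff ds_eq[OF M] dt_def)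

lemma pull1_point: "pull1 A (i, b) (p, z) = pl (A i p)"
  by (simp add: pull1_def fun_eq_iff)

context
  fixes i p and b :: bool and z e E
  assumes i: "i \<in> mf_idx M" and p: "p \<in> mf_dom M i" and z: "z \<in> mf_dom circle b"
    and P: "g2_point e E (\<omega> i p) (\<rho>\<^sub>p i p) (\<rho>\<^sub>m i p) (\<theta> i p) (\<pi>\<^sub>1 i p) (\<nu>\<^sub>1 i p) (A\<^sub>2 i p) (S\<^sub>2 i p) (\<nu>\<^sub>3 i p) (f p)"
    and g: "su3_metric \<omega> \<psi>\<^sub>p \<psi>\<^sub>m i p = gram 6 (\<lambda>k v. e k [v])"
begin

interpretation P: g2_point e E "\<omega> i p" "\<rho>\<^sub>p i p" "\<rho>\<^sub>m i p" "\<theta> i p" "\<pi>\<^sub>1 i p" "\<nu>\<^sub>1 i p" "A\<^sub>2 i p" "S\<^sub>2 i p" "\<nu>\<^sub>3 i p" "f p" "p\<^sub>0 p" "s\<^sub>0 p"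
  by (rule P)

lemma star6_point: "star6 A i p = P.st6 (A i p)"
  by (simp add: su3_star_def star_def g P.st6_def P.V6_def su3_vol_eq)

lemma star7_point: "star7 A (i, b) (p, z) = P.st7 (A (i, b) (p, z))"
proof -
  have "warped_metric f (su3_metric \<omega> \<psi>\<^sub>p \<psi>\<^sub>m) (i, b) (p, z) = gram 7 (coframe7 (f p) e)"
  proof (intro ext)
    fix u v :: "(real^6) \<times> real"
    have "{1..7::nat} = insert 7 {1..6}"
      by auto
    moreover have "(\<Sum>k = 1..6. coframe7 (f p) e k u * coframe7 (f p) e k v) = (\<Sum>k = 1..6. e k [fst u] * e k [fst v])"
      by (intro sum.cong) (auto simp: coframe7_def)
    ultimately show "warped_metric f (su3_metric \<omega> \<psi>\<^sub>p \<psi>\<^sub>m) (i, b) (p, z) u v = gram 7 (coframe7 (f p) e) u v"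
      by (simp add: warped_metric_def g gram_def coframe7_def power2_eq_square)
  qed
  moreover have "warped_vol f (su3_vol \<omega>) (i, b) (p, z) = P.V7"
    by (simp add: warped_vol_def P.V7_def P.V6_def fun_scale_def wedge_def pull1_point ds_dt fun_eq_iff su3_vol_eq)
  ultimately show ?thesis
    by (simp add: warped_star_def star_def P.st7_def)
qed

lemma \<phi>_point: "\<phi> (i, b) (p, z) = P.phi"
  unfolding \<phi>_def \<rho>\<^sub>p_def[symmetric] P.phi_def
  by (simp add: fun_scale_def wedge_def pull1_point ds_dt fun_eq_iff)

lemma star_\<phi>_point: "star7 \<phi> (i, b) (p, z) = (pull1 ((1/2) *\<^sub>f (\<omega> \<and>\<^sub>f \<omega>)) + pull1 (f \<cdot>\<^sub>f \<rho>\<^sub>m) \<and>\<^sub>f ds) (i, b) (p, z)"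
  unfolding star7_point \<phi>_point P.star_phi
  by (simp add: fun_scale_def const_scale_def wedge_def pull1_point ds_dt fun_eq_iff)

lemma T_point: "T\<^sub>0 (p, z) = 12/7 * p\<^sub>0 p" "T\<^sub>1 (i, b) (p, z) = P.t1" "T\<^sub>2 (i, b) (p, z) = P.t2" "T\<^sub>3 (i, b) (p, z) = P.t3"
proof -
  have H: "(\<theta> + \<pi>\<^sub>1 - 2 *\<^sub>f \<nu>\<^sub>1) i p = P.H2" "(\<theta> - \<pi>\<^sub>1 + \<nu>\<^sub>1) i p = P.H3"
    by (simp_all add: P.H2_def P.H3_def fun_eq_iff const_scale_def)
  show "T\<^sub>0 (p, z) = 12/7 * p\<^sub>0 p"
    by (simp add: T\<^sub>0_def p\<^sub>0_def)
  show "T\<^sub>1 (i, b) (p, z) = P.t1"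
    unfolding T\<^sub>1_def P.t1_def
    by (simp add: fun_scale_def const_scale_def pull1_point ds_dt fun_eq_iff s\<^sub>0_def)
  have pp: "(A + B) (i, b) (p, z) = A (i, b) (p, z) + B (i, b) (p, z)"
    "(A - B) (i, b) (p, z) = A (i, b) (p, z) - B (i, b) (p, z)" for A B :: "('i \<times> bool, 'p \<times> complex, (real^6) \<times> real) dform"
    by simp_all
  have 1: "(- (\<alpha> *\<^sub>f \<sigma>\<^sub>2) - \<beta> *\<^sub>f \<pi>\<^sub>2) i p = - S\<^sub>2 i p"
    by (simp add: fun_eq_iff S\<^sub>2_def)
  have 2: "((\<lambda>p. f p / 3) \<cdot>\<^sub>f star6 ((\<theta> + \<pi>\<^sub>1 - 2 *\<^sub>f \<nu>\<^sub>1) \<and>\<^sub>f \<omega> \<and>\<^sub>f \<omega>)) i p = (\<lambda>vs. f p / 3 * P.st6 (P.H2 \<^bold>\<and> \<omega> i p \<^bold>\<and> \<omega> i p) vs)"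
    by (simp only: fun_eq_iff fun_scale_def star6_point wedge_def H) simp
  have 3: "((1/3) *\<^sub>f star6 ((\<theta> + \<pi>\<^sub>1 - 2 *\<^sub>f \<nu>\<^sub>1) \<and>\<^sub>f \<rho>\<^sub>m)) i p = (\<lambda>vs. 1/3 * P.st6 (P.H2 \<^bold>\<and> \<rho>\<^sub>m i p) vs)"
    by (simp only: fun_eq_iff const_scale_def star6_point wedge_def H) simp
  show "T\<^sub>2 (i, b) (p, z) = P.t2"
    unfolding T\<^sub>2_def P.t2_def \<rho>\<^sub>m_def[symmetric] pp wedge_def[of "pull1 _"] pull1_point ds_dt 1 2 3 ..
  have 4: "((\<lambda>p. 2/7 * (\<alpha> * \<pi>\<^sub>0 p - \<beta> * \<sigma>\<^sub>0 p) * f p) \<cdot>\<^sub>f \<omega>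
             - (\<lambda>p. f p / 2) \<cdot>\<^sub>f star6 ((\<theta> - \<pi>\<^sub>1 + \<nu>\<^sub>1) \<and>\<^sub>f \<rho>\<^sub>p) + f \<cdot>\<^sub>f A\<^sub>2) i p
     = (\<lambda>vs. 2/7 * p\<^sub>0 p * f p * \<omega> i p vs - f p / 2 * P.st6 (P.H3 \<^bold>\<and> \<rho>\<^sub>p i p) vs + f p * A\<^sub>2 i p vs)"
  proof -
    have "star6 ((\<theta> - \<pi>\<^sub>1 + \<nu>\<^sub>1) \<and>\<^sub>f \<rho>\<^sub>p) i p = P.st6 (P.H3 \<^bold>\<and> \<rho>\<^sub>p i p)"
      by (simp only: star6_point wedge_def H)
    then show ?thesis
      by (simp add: fun_eq_iff fun_scale_def p\<^sub>0_def)
  qed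
  have 5: "((1/2) *\<^sub>f star6 ((\<theta> - \<pi>\<^sub>1 + \<nu>\<^sub>1) \<and>\<^sub>f \<omega>)) i p = (\<lambda>vs. 1/2 * P.st6 (P.H3 \<^bold>\<and> \<omega> i p) vs)"
    by (simp only: fun_eq_iff const_scale_def star6_point wedge_def H) simp
  have 6: "((\<lambda>p. 3/14 * (\<alpha> * \<pi>\<^sub>0 p - \<beta> * \<sigma>\<^sub>0 p)) \<cdot>\<^sub>f \<rho>\<^sub>p) i p = (\<lambda>vs. 3/14 * p\<^sub>0 p * \<rho>\<^sub>p i p vs)"
    by (simp add: fun_eq_iff fun_scale_def p\<^sub>0_def)
  show "T\<^sub>3 (i, b) (p, z) = P.t3"
    unfolding T\<^sub>3_def P.t3_def \<rho>\<^sub>p_def[symmetric] A\<^sub>2_def[symmetric] pp wedge_def[of "pull1 _"] pull1_point ds_dt 4 5 6 star6_point ..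
qed

lemma d\<omega>_point: "ext_d M \<omega> i p = P.dw"
  and d\<rho>_point: "ext_d M \<rho>\<^sub>p i p = P.da" "ext_d M \<rho>\<^sub>m i p = P.db"
proof -
  have w: "ext_d M \<omega> i p vs = - (3/2 * (\<sigma>\<^sub>0 p * \<psi>\<^sub>p i p vs)) + 3/2 * (\<pi>\<^sub>0 p * \<psi>\<^sub>m i p vs) + (\<nu>\<^sub>1 i p \<^bold>\<and> \<omega> i p) vs + \<nu>\<^sub>3 i p vs"
    and a: "ext_d M \<psi>\<^sub>p i p vs = \<pi>\<^sub>0 p * (\<omega> i p \<^bold>\<and> \<omega> i p) vs + (\<pi>\<^sub>1 i p \<^bold>\<and> \<psi>\<^sub>p i p) vs - (\<pi>\<^sub>2 i p \<^bold>\<and> \<omega> i p) vs"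
    and b: "ext_d M \<psi>\<^sub>m i p vs = \<sigma>\<^sub>0 p * (\<omega> i p \<^bold>\<and> \<omega> i p) vs + (\<pi>\<^sub>1 i p \<^bold>\<and> \<psi>\<^sub>m i p) vs - (\<sigma>\<^sub>2 i p \<^bold>\<and> \<omega> i p) vs" for vs
    using tors i p by (auto simp: su3_torsion_def form_eq_def const_scale_def fun_scale_def wedge_def)
  show "ext_d M \<omega> i p = P.dw"
  proof
    fix vs
    have "P.dw vs = (\<alpha>\<^sup>2 + \<beta>\<^sup>2) * (- (3/2 * (\<sigma>\<^sub>0 p * \<psi>\<^sub>p i p vs)) + 3/2 * (\<pi>\<^sub>0 p * \<psi>\<^sub>m i p vs)) + (\<nu>\<^sub>1 i p \<^bold>\<and> \<omega> i p) vs + \<nu>\<^sub>3 i p vs"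
      unfolding P.dw_def by (simp add: point_forms s\<^sub>0_def p\<^sub>0_def algebra_simps power2_eq_square add_divide_distrib)
    then show "ext_d M \<omega> i p vs = P.dw vs"
      using ab by (simp add: w)
  qed
  note lin = mwedge_add_left mwedge_diff_left mwedge_scale_left mwedge_add_right mwedge_diff_right mwedge_scale_right
  have "\<rho>\<^sub>p = \<alpha> *\<^sub>f \<psi>\<^sub>p + (- \<beta>) *\<^sub>f \<psi>\<^sub>m"
    by (simp add: \<rho>\<^sub>p_def fun_eq_iff const_scale_def)
  then have "ext_d M \<rho>\<^sub>p i p = (\<lambda>vs. \<alpha> * ext_d M \<psi>\<^sub>p i p vs) + (\<lambda>vs. - \<beta> * ext_d M \<psi>\<^sub>m i p vs)"
    using ext_d_add[OF nM dforms_const_scale[OF nM torsion_forms(9)] dforms_const_scale[OF nM torsion_forms(10)] i p]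
    by (simp add: ext_d_const_scale[OF nM torsion_forms(9) i p] ext_d_const_scale[OF nM torsion_forms(10) i p])
  then show "ext_d M \<rho>\<^sub>p i p = P.da"
    unfolding P.da_def by (simp add: fun_eq_iff a b point_forms lin p\<^sub>0_def algebra_simps)
  have "ext_d M \<rho>\<^sub>m i p = (\<lambda>vs. \<alpha> * ext_d M \<psi>\<^sub>m i p vs) + (\<lambda>vs. \<beta> * ext_d M \<psi>\<^sub>p i p vs)"
    using ext_d_add[OF nM dforms_const_scale[OF nM torsion_forms(10)] dforms_const_scale[OF nM torsion_forms(9)] i p]
    by (simp add: \<rho>\<^sub>m_def ext_d_const_scale[OF nM torsion_forms(9) i p] ext_d_const_scale[OF nM torsion_forms(10) i p])
  then show "ext_d M \<rho>\<^sub>m i p = P.db"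
    unfolding P.db_def by (simp add: fun_eq_iff a b point_forms lin s\<^sub>0_def algebra_simps)
qed

lemma d_scaled_point:
  assumes A: "A \<in> dforms M k"
  shows "ext_d M (f \<cdot>\<^sub>f A) i p = (\<lambda>vs. f p * ((\<theta> i p \<^bold>\<and> A i p) vs + ext_d M A i p vs))"
proof -
  have d: "ext_d M (zero_form f) i p = (\<lambda>vs. f p * \<theta> i p vs)"
    using dom_point[OF i p] by (simp add: \<theta>_def fun_scale_def fun_eq_iff)
  then show ?thesis
    unfolding ext_d_fun_scale[OF nM f A i p] d mwedge_scale_left by (simp add: fun_eq_iff algebra_simps)
qed

lemma d\<phi>_point: "ext_d N \<phi> (i, b) (p, z) =
    pl (\<lambda>vs. f p * ((\<theta> i p \<^bold>\<and> \<omega> i p) vs + P.dw vs)) \<^bold>\<and> dt + pl P.da"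
proof -
  have c: "(i, b) \<in> mf_idx N" "(p, z) \<in> mf_dom N (i, b)"
    using i p z by (simp_all add: prod_manifold_simps[OF M])
  have 1: "f \<cdot>\<^sub>f \<omega> \<in> dforms M 2"
    by (rule dforms_fun_scale[OF nM f torsion_forms(8)])
  have 2: "pull1 (f \<cdot>\<^sub>f \<omega>) \<and>\<^sub>f ds \<in> dforms N (2 + 1)"
    by (rule dforms_wedge[OF nN pull1_dforms[OF M 1] ds_dforms[OF M]])
  show ?thesis
    unfolding \<phi>_alt ext_d_add[OF nN 2 pull1_dforms[OF M rotated_dforms(1)] c] ext_d_wedge_ds[OF M 1 i p z]
      ext_d_pull1[OF M rotated_dforms(1) i p z] d_scaled_point[OF torsion_forms(8)] d\<omega>_point d\<rho>_point ds_dt ..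
qed

end

text \<open>The coframe obtained at a point need not vary continuously, so the star of \<phi> is
  first replaced on the entire chart domain by its closed expression, using a separate coframe at
  each point. For this reason the statement is free of any chosen coframe.\<close>

lemma dstar\<phi>_point:
  assumes i: "i \<in> mf_idx M" and p: "p \<in> mf_dom M i" and z: "z \<in> mf_dom circle b"
  shows "ext_d N (star7 \<phi>) (i, b) (p, z) =
    pl (\<lambda>vs. 1/2 * ((ext_d M \<omega> i p \<^bold>\<and> \<omega> i p) vs + (\<omega> i p \<^bold>\<and> ext_d M \<omega> i p) vs))
    + pl (\<lambda>vs. f p * ((\<theta> i p \<^bold>\<and> \<rho>\<^sub>m i p) vs + ext_d M \<rho>\<^sub>m i p vs)) \<^bold>\<and> dt"
proof -
  let ?X = "(1/2) *\<^sub>f (\<omega> \<and>\<^sub>f \<omega>)" and ?Y = "f \<cdot>\<^sub>f \<rho>\<^sub>m"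
  have c: "(i, b) \<in> mf_idx N" "(p, z) \<in> mf_dom N (i, b)"
    using i p z by (simp_all add: prod_manifold_simps[OF M])
  have ww: "\<omega> \<and>\<^sub>f \<omega> \<in> dforms M (2 + 2)"
    by (rule dforms_wedge[OF nM torsion_forms(8,8)])
  have X: "?X \<in> dforms M (2 + 2)"
    by (rule dforms_const_scale[OF nM ww])
  have Y: "?Y \<in> dforms M 3"
    by (rule dforms_fun_scale[OF nM f rotated_dforms(2)])
  have Yds: "pull1 ?Y \<and>\<^sub>f ds \<in> dforms N (3 + 1)"
    by (rule dforms_wedge[OF nN pull1_dforms[OF M Y] ds_dforms[OF M]])
  have "ext_d N (star7 \<phi>) (i, b) (p, z) = ext_d N (pull1 ?X + pull1 ?Y \<and>\<^sub>f ds) (i, b) (p, z)"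
  proof (rule ext_d_cong[OF nN _ c])
    fix q assume "q \<in> mf_dom N (i, b)"
    then obtain p' z' where q: "q = (p', z')" "p' \<in> mf_dom M i" "z' \<in> mf_dom circle b"
      by (auto simp: prod_manifold_simps[OF M])
    show "star7 \<phi> (i, b) q = (pull1 ?X + pull1 ?Y \<and>\<^sub>f ds) (i, b) q"
      unfolding q(1) by (rule point[OF i q(2)]) (rule star_\<phi>_point[OF i q(2,3)])
  qed
  also have "\<dots> = (\<lambda>vs. ext_d M ?X i p (map fst vs)) + (\<lambda>vs. ext_d M ?Y i p (map fst vs)) \<^bold>\<and> dt"
    unfolding ext_d_add[OF nN pull1_dforms[OF M X] Yds c] ext_d_wedge_ds[OF M Y i p z] ext_d_pull1[OF M X i p z] ds_dt ..
  also have "ext_d M ?X i p = (\<lambda>vs. 1/2 * ((ext_d M \<omega> i p \<^bold>\<and> \<omega> i p) vs + (\<omega> i p \<^bold>\<and> ext_d M \<omega> i p) vs))"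
    unfolding ext_d_const_scale[OF nM ww i p] ext_d_wedge[OF nM torsion_forms(8,8) i p] by (simp add: fun_eq_iff)
  also have "ext_d M ?Y i p = (\<lambda>vs. f p * ((\<theta> i p \<^bold>\<and> \<rho>\<^sub>m i p) vs + ext_d M \<rho>\<^sub>m i p vs))"
    by (rule point[OF i p]) (rule d_scaled_point[OF i p z _ _ rotated_dforms(2)])
  finally show ?thesis .
qed

text \<open>The algebraic content of \<open>g2_torsion\<close> in one chart at one point, with
  smoothness and compatibility between charts set aside.\<close>

definition "eqs \<tau>\<^sub>0 \<tau>\<^sub>1 \<tau>\<^sub>2 \<tau>\<^sub>3 c x \<longleftrightarrow>
  alternating 1 (\<tau>\<^sub>1 c x) \<and> alternating 2 (\<tau>\<^sub>2 c x) \<and> alternating 3 (\<tau>\<^sub>3 c x) \<and>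
  ext_d N \<phi> c x = (\<tau>\<^sub>0 \<cdot>\<^sub>f star7 \<phi> + 3 *\<^sub>f (\<tau>\<^sub>1 \<and>\<^sub>f \<phi>) + star7 \<tau>\<^sub>3) c x \<and>
  ext_d N (star7 \<phi>) c x = (4 *\<^sub>f (\<tau>\<^sub>1 \<and>\<^sub>f star7 \<phi>) + \<tau>\<^sub>2 \<and>\<^sub>f \<phi>) c x \<and>
  (\<tau>\<^sub>2 \<and>\<^sub>f \<phi>) c x = (- star7 \<tau>\<^sub>2) c x \<and> (\<tau>\<^sub>3 \<and>\<^sub>f \<phi>) c x = 0 \<and> (\<tau>\<^sub>3 \<and>\<^sub>f star7 \<phi>) c x = 0"

text \<open>In an adapted frame \<open>eqs\<close> is the linear system \<open>solution\<close> for
  the actual derivatives; the candidates solve it, and it has only one solution.\<close>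

lemma eqs_point:
  assumes c: "c \<in> mf_idx N" and x: "x \<in> mf_dom N c"
  shows "eqs \<tau>\<^sub>0 \<tau>\<^sub>1 \<tau>\<^sub>2 \<tau>\<^sub>3 c x \<longleftrightarrow> \<tau>\<^sub>0 x = T\<^sub>0 x \<and> \<tau>\<^sub>1 c x = T\<^sub>1 c x \<and> \<tau>\<^sub>2 c x = T\<^sub>2 c x \<and> \<tau>\<^sub>3 c x = T\<^sub>3 c x"
proof -
  obtain i b p z where cx: "c = (i, b)" "x = (p, z)" and i: "i \<in> mf_idx M" and p: "p \<in> mf_dom M i"
    and z: "z \<in> mf_dom circle b"
    using c x by (cases c; cases x) (auto simp: prod_manifold_simps[OF M])
  obtain e E where P: "g2_point e E (\<omega> i p) (\<rho>\<^sub>p i p) (\<rho>\<^sub>m i p) (\<theta> i p) (\<pi>\<^sub>1 i p) (\<nu>\<^sub>1 i p) (A\<^sub>2 i p) (S\<^sub>2 i p) (\<nu>\<^sub>3 i p) (f p)"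
    and g: "su3_metric \<omega> \<psi>\<^sub>p \<psi>\<^sub>m i p = gram 6 (\<lambda>k v. e k [v])"
    by (rule point[OF i p])
  interpret P: g2_point e E "\<omega> i p" "\<rho>\<^sub>p i p" "\<rho>\<^sub>m i p" "\<theta> i p" "\<pi>\<^sub>1 i p" "\<nu>\<^sub>1 i p" "A\<^sub>2 i p" "S\<^sub>2 i p" "\<nu>\<^sub>3 i p" "f p" "p\<^sub>0 p" "s\<^sub>0 p"
    by (rule P)
  note pt = i p z P g
  let ?X = "pl (\<lambda>vs. f p * ((\<theta> i p \<^bold>\<and> \<omega> i p) vs + P.dw vs)) \<^bold>\<and> dt + pl P.da"
  let ?Y = "pl (\<lambda>vs. 1/2 * ((P.dw \<^bold>\<and> \<omega> i p) vs + (\<omega> i p \<^bold>\<and> P.dw) vs)) + pl (\<lambda>vs. f p * ((\<theta> i p \<^bold>\<and> \<rho>\<^sub>m i p) vs + P.db vs)) \<^bold>\<and> dt"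
  have Y: "ext_d N (star7 \<phi>) (i, b) (p, z) = ?Y"
    unfolding dstar\<phi>_point[OF i p z] d\<omega>_point[OF pt] d\<rho>_point[OF pt] ..
  have "(\<tau>\<^sub>0 \<cdot>\<^sub>f star7 \<phi> + 3 *\<^sub>f (\<tau>\<^sub>1 \<and>\<^sub>f \<phi>) + star7 \<tau>\<^sub>3) (i, b) (p, z)
      = (\<lambda>vs. \<tau>\<^sub>0 (p, z) * P.st7 P.phi vs) + (\<lambda>vs. 3 * (\<tau>\<^sub>1 (i, b) (p, z) \<^bold>\<and> P.phi) vs) + P.st7 (\<tau>\<^sub>3 (i, b) (p, z))"
    by (simp add: fun_eq_iff fun_scale_def const_scale_def wedge_def \<phi>_point[OF pt] star7_point[OF pt])
  moreover have "(4 *\<^sub>f (\<tau>\<^sub>1 \<and>\<^sub>f star7 \<phi>) + \<tau>\<^sub>2 \<and>\<^sub>f \<phi>) (i, b) (p, z)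
      = (\<lambda>vs. 4 * (\<tau>\<^sub>1 (i, b) (p, z) \<^bold>\<and> P.st7 P.phi) vs) + \<tau>\<^sub>2 (i, b) (p, z) \<^bold>\<and> P.phi"
    by (simp add: fun_eq_iff fun_scale_def const_scale_def wedge_def \<phi>_point[OF pt] star7_point[OF pt])
  moreover have "(- star7 \<tau>\<^sub>2) (i, b) (p, z) = - P.st7 (\<tau>\<^sub>2 (i, b) (p, z))"
    by (simp add: fun_eq_iff star7_point[OF pt])
  ultimately have "eqs \<tau>\<^sub>0 \<tau>\<^sub>1 \<tau>\<^sub>2 \<tau>\<^sub>3 (i, b) (p, z) \<longleftrightarrow>
      P.solution (\<tau>\<^sub>0 (p, z)) (\<tau>\<^sub>1 (i, b) (p, z)) (\<tau>\<^sub>2 (i, b) (p, z)) (\<tau>\<^sub>3 (i, b) (p, z)) ?X ?Y"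
    unfolding eqs_def P.solution_def d\<phi>_point[OF pt] Y by (simp only: wedge_def \<phi>_point[OF pt] star7_point[OF pt])
  moreover have "P.solution (\<tau>\<^sub>0 (p, z)) (\<tau>\<^sub>1 (i, b) (p, z)) (\<tau>\<^sub>2 (i, b) (p, z)) (\<tau>\<^sub>3 (i, b) (p, z)) ?X ?Y \<longleftrightarrow>
      \<tau>\<^sub>0 (p, z) = 12/7 * p\<^sub>0 p \<and> \<tau>\<^sub>1 (i, b) (p, z) = P.t1 \<and> \<tau>\<^sub>2 (i, b) (p, z) = P.t2 \<and> \<tau>\<^sub>3 (i, b) (p, z) = P.t3"
  proof
    assume "P.solution (\<tau>\<^sub>0 (p, z)) (\<tau>\<^sub>1 (i, b) (p, z)) (\<tau>\<^sub>2 (i, b) (p, z)) (\<tau>\<^sub>3 (i, b) (p, z)) ?X ?Y"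
    from P.solution_unique[OF this P.solution_t]
    show "\<tau>\<^sub>0 (p, z) = 12/7 * p\<^sub>0 p \<and> \<tau>\<^sub>1 (i, b) (p, z) = P.t1 \<and> \<tau>\<^sub>2 (i, b) (p, z) = P.t2 \<and> \<tau>\<^sub>3 (i, b) (p, z) = P.t3" .
  next
    assume t: "\<tau>\<^sub>0 (p, z) = 12/7 * p\<^sub>0 p \<and> \<tau>\<^sub>1 (i, b) (p, z) = P.t1 \<and> \<tau>\<^sub>2 (i, b) (p, z) = P.t2 \<and> \<tau>\<^sub>3 (i, b) (p, z) = P.t3"
    show "P.solution (\<tau>\<^sub>0 (p, z)) (\<tau>\<^sub>1 (i, b) (p, z)) (\<tau>\<^sub>2 (i, b) (p, z)) (\<tau>\<^sub>3 (i, b) (p, z)) ?X ?Y"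
      by (simp only: t P.solution_t)
  qed
  ultimately show ?thesis
    unfolding cx T_point[OF pt] by blast
qed

lemma T_dforms: "T\<^sub>1 \<in> dforms N 1" "T\<^sub>2 \<in> dforms N 2" "T\<^sub>3 \<in> dforms N 3" and T0_smooth: "smooth_fun N T\<^sub>0"
proof -
  note fs = smooth_fun_closed[OF nM] smooth_fun_const[OF nM] f torsion_forms(1,2)
  have sf: "smooth_fun M (\<lambda>p. f p / c)" for c
    using smooth_fun_closed(3)[OF nM smooth_fun_const[OF nM] f, of "1 / c"] by simp
  note cl = dforms_add[OF nM] dforms_diff[OF nM] dforms_minus[OF nM] dforms_const_scale[OF nM] dforms_fun_scale[OF nM]
    torsion_forms \<theta>_dforms
  have e: "\<theta> + \<pi>\<^sub>1 + \<nu>\<^sub>1 \<in> dforms M 1" "\<theta> + \<pi>\<^sub>1 - 2 *\<^sub>f \<nu>\<^sub>1 \<in> dforms M 1" "\<theta> - \<pi>\<^sub>1 + \<nu>\<^sub>1 \<in> dforms M 1"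
    by (intro cl)+
  have st: "star6 A \<in> dforms M m" if "A \<in> dforms M k" "k + m = 6" for A k m
  proof -
    have "6 - k = m" "k \<le> 6"
      using that(2) by simp_all
    then show ?thesis
      using dforms_su3_star[OF M su that(1)] by simp
  qed
  \<comment> \<open>The degree is matched by an equation, since a sum such as \<open>2 + 3\<close>
    does not unify with its value.\<close>
  have w: "A \<and>\<^sub>f B \<in> dforms M m" if "A \<in> dforms M k" "B \<in> dforms M l" "k + l = m" for A B k l m
    using dforms_wedge[OF nM that(1,2)] that(3) by simp
  have wds: "pull1 A \<and>\<^sub>f ds \<in> dforms N m" if "A \<in> dforms M k" "Suc k = m" for A k m
    using dforms_wedge[OF nN pull1_dforms[OF M that(1)] ds_dforms[OF M]] that(2) unfolding Suc_eq_plus1 by simp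
  note st_forms = st[OF w[OF e(2) w[OF torsion_forms(8,8)]], of 4 5 1] st[OF w[OF e(2) rotated_dforms(2)], of 4 2]
    st[OF w[OF e(3) rotated_dforms(1)], of 4 2] st[OF w[OF e(3) torsion_forms(8)], of 3 3] st[OF torsion_forms(7), of 3]
  note st_forms = this[simplified]
  note clN = dforms_add[OF nN] dforms_diff[OF nN]
  have f1: "smooth_fun N (\<lambda>x. 1/2 * (\<alpha> * \<sigma>\<^sub>0 (fst x) + \<beta> * \<pi>\<^sub>0 (fst x)) * f (fst x))"
    by (rule smooth_fun_fst[OF M]) (intro fs)
  show "T\<^sub>1 \<in> dforms N 1"
    unfolding T\<^sub>1_def by (intro clN dforms_fun_scale[OF nN f1] ds_dforms[OF M] pull1_dforms[OF M] cl)
  show "T\<^sub>2 \<in> dforms N 2"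
    unfolding T\<^sub>2_def \<rho>\<^sub>m_def[symmetric]
    by (intro clN pull1_dforms[OF M] wds[of _ 1] cl st_forms sf) simp
  show "T\<^sub>3 \<in> dforms N 3"
    unfolding T\<^sub>3_def \<rho>\<^sub>p_def[symmetric] A\<^sub>2_def[symmetric]
    by (intro clN pull1_dforms[OF M] wds[of _ 2] cl st_forms sf fs rotated_dforms) simp
  show "smooth_fun N T\<^sub>0"
    unfolding T\<^sub>0_def by (rule smooth_fun_fst[OF M]) (intro fs)
qed

text \<open>The pointwise equivalence settles the equations in both directions. Conversely, the
  given forms inherit smoothness and compatibility from the candidates, with which they agree on all
  chart domains.\<close>

lemma g2_torsion_iff: "g2_torsion N star7 \<phi> \<tau>\<^sub>0 \<tau>\<^sub>1 \<tau>\<^sub>2 \<tau>\<^sub>3 \<longleftrightarrow>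
   (\<forall>x\<in>mf_points N. \<tau>\<^sub>0 x = T\<^sub>0 x) \<and> \<tau>\<^sub>1 \<doteq>\<^bsub>N\<^esub> T\<^sub>1 \<and> \<tau>\<^sub>2 \<doteq>\<^bsub>N\<^esub> T\<^sub>2 \<and> \<tau>\<^sub>3 \<doteq>\<^bsub>N\<^esub> T\<^sub>3"
proof
  assume L: "g2_torsion N star7 \<phi> \<tau>\<^sub>0 \<tau>\<^sub>1 \<tau>\<^sub>2 \<tau>\<^sub>3"
  have "eqs \<tau>\<^sub>0 \<tau>\<^sub>1 \<tau>\<^sub>2 \<tau>\<^sub>3 c x" if "c \<in> mf_idx N" "x \<in> mf_dom N c" for c x
    using L that unfolding eqs_def g2_torsion_def g2_Omega214_def g2_Omega327_def form_eq_def
    by (auto intro: dforms_alternating)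
  then have eq: "\<tau>\<^sub>0 x = T\<^sub>0 x \<and> \<tau>\<^sub>1 c x = T\<^sub>1 c x \<and> \<tau>\<^sub>2 c x = T\<^sub>2 c x \<and> \<tau>\<^sub>3 c x = T\<^sub>3 c x"
    if "c \<in> mf_idx N" "x \<in> mf_dom N c" for c x
    using eqs_point that by blast
  moreover have "\<exists>c\<in>mf_idx N. x \<in> mf_dom N c" if xN: "x \<in> mf_points N" for x
  proof -
    obtain p z where x: "x = (p, z)" "p \<in> mf_points M" "z \<in> sphere 0 1"
      using xN by (cases x) (auto simp: prod_manifold_def circle_def)
    obtain i where i: "i \<in> mf_idx M" "p \<in> mf_dom M i"
      using M x(2) unfolding smooth_manifold_def by blast
    \<comment> \<open>The chart \<open>True\<close> omits only -1 and the chart \<open>False\<close>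
      only 1, so this truth value names a chart around \<open>z\<close>.\<close>
    have "z \<in> mf_dom circle (z \<noteq> - 1)"
      using x(3) by (auto simp: circle_def)
    then show ?thesis
      using i x(1) by (intro bexI[of _ "(i, z \<noteq> - 1)"]) (auto simp: prod_manifold_simps[OF M])
  qed
  ultimately show "(\<forall>x\<in>mf_points N. \<tau>\<^sub>0 x = T\<^sub>0 x) \<and> \<tau>\<^sub>1 \<doteq>\<^bsub>N\<^esub> T\<^sub>1 \<and> \<tau>\<^sub>2 \<doteq>\<^bsub>N\<^esub> T\<^sub>2 \<and> \<tau>\<^sub>3 \<doteq>\<^bsub>N\<^esub> T\<^sub>3"
    unfolding form_eq_def by blast
next
  assume R: "(\<forall>x\<in>mf_points N. \<tau>\<^sub>0 x = T\<^sub>0 x) \<and> \<tau>\<^sub>1 \<doteq>\<^bsub>N\<^esub> T\<^sub>1 \<and> \<tau>\<^sub>2 \<doteq>\<^bsub>N\<^esub> T\<^sub>2 \<and> \<tau>\<^sub>3 \<doteq>\<^bsub>N\<^esub> T\<^sub>3"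
  have pts: "x \<in> mf_points N" if "c \<in> mf_idx N" "x \<in> mf_dom N c" for c x
  proof -
    have "p \<in> mf_points M" if "i \<in> mf_idx M" "p \<in> mf_dom M i" for i p
      using M that unfolding smooth_manifold_def by blast
    then show ?thesis
      using that by (cases c; cases x) (auto simp: prod_manifold_def circle_def)
  qed
  have eq: "eqs \<tau>\<^sub>0 \<tau>\<^sub>1 \<tau>\<^sub>2 \<tau>\<^sub>3 c x" if "c \<in> mf_idx N" "x \<in> mf_dom N c" for c x
    unfolding eqs_point[OF that] using R that pts[OF that] by (auto simp: form_eq_def)
  have d: "\<tau>\<^sub>1 \<in> dforms N 1" "\<tau>\<^sub>2 \<in> dforms N 2" "\<tau>\<^sub>3 \<in> dforms N 3"
    using R by (auto intro: form_eq_dforms[OF nN _ T_dforms(1)] form_eq_dforms[OF nN _ T_dforms(2)]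
        form_eq_dforms[OF nN _ T_dforms(3)])
  have "smooth_fun N \<tau>\<^sub>0"
    unfolding smooth_fun_def
  proof
    fix c assume c: "c \<in> mf_idx N"
    show "smooth_on (mf_img N c) (\<tau>\<^sub>0 \<circ> mf_inv N c)"
    proof (rule smooth_on_cong[OF nice_charts_open[OF nN c]])
      show "smooth_on (mf_img N c) (T\<^sub>0 \<circ> mf_inv N c)"
        using T0_smooth c by (simp add: smooth_fun_def)
      show "(T\<^sub>0 \<circ> mf_inv N c) y = (\<tau>\<^sub>0 \<circ> mf_inv N c) y" if "y \<in> mf_img N c" for y
        using R pts[OF c mf_inv_dom[OF that]] by simp
    qed
  qed
  then show "g2_torsion N star7 \<phi> \<tau>\<^sub>0 \<tau>\<^sub>1 \<tau>\<^sub>2 \<tau>\<^sub>3"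
    using eq d unfolding eqs_def g2_torsion_def g2_Omega214_def g2_Omega327_def form_eq_def by simp
qed

end

theorem theorem2p4:
  fixes M :: "('i, 'p, real^6) manifold"
    and \<omega> \<psi>\<^sub>p \<psi>\<^sub>m \<pi>\<^sub>1 \<nu>\<^sub>1 \<pi>\<^sub>2 \<sigma>\<^sub>2 \<nu>\<^sub>3 \<eta>\<^sub>1 \<eta>\<^sub>2 \<eta>\<^sub>3 :: "('i, 'p, real^6) dform"
    and \<pi>\<^sub>0 \<sigma>\<^sub>0 f :: "'p \<Rightarrow> real"
    and \<alpha> \<beta> :: real
    and star6 :: "('i, 'p, real^6) dform \<Rightarrow> ('i, 'p, real^6) dform"
    and M7 :: "('i \<times> bool, 'p \<times> complex, (real^6) \<times> real) manifold"
    and \<phi> \<tau>\<^sub>1 \<tau>\<^sub>2 \<tau>\<^sub>3 :: "('i \<times> bool, 'p \<times> complex, (real^6) \<times> real) dform"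
    and \<tau>\<^sub>0 :: "'p \<times> complex \<Rightarrow> real"
  assumes "smooth_manifold M"
    and "su3_structure M \<omega> \<psi>\<^sub>p \<psi>\<^sub>m"
    and "su3_torsion M \<omega> \<psi>\<^sub>p \<psi>\<^sub>m \<pi>\<^sub>0 \<sigma>\<^sub>0 \<pi>\<^sub>1 \<nu>\<^sub>1 \<pi>\<^sub>2 \<sigma>\<^sub>2 \<nu>\<^sub>3"
    and "smooth_fun M f" and "\<forall>p\<in>mf_points M. f p \<noteq> 0"
    and "\<alpha>\<^sup>2 + \<beta>\<^sup>2 = 1"
    and "star6 = su3_star \<omega> \<psi>\<^sub>p \<psi>\<^sub>m"
    and "M7 = prod_manifold M circle"
    and "\<phi> = (f \<circ> fst) \<cdot>\<^sub>f (pull1 \<omega> \<and>\<^sub>f ds) + pull1 (\<alpha> *\<^sub>f \<psi>\<^sub>p - \<beta> *\<^sub>f \<psi>\<^sub>m)"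
    and "\<eta>\<^sub>1 = (\<lambda>p. 1 / f p) \<cdot>\<^sub>f ext_d M (zero_form f) + \<pi>\<^sub>1 + \<nu>\<^sub>1"
    and "\<eta>\<^sub>2 = (\<lambda>p. 1 / f p) \<cdot>\<^sub>f ext_d M (zero_form f) + \<pi>\<^sub>1 - 2 *\<^sub>f \<nu>\<^sub>1"
    and "\<eta>\<^sub>3 = (\<lambda>p. 1 / f p) \<cdot>\<^sub>f ext_d M (zero_form f) - \<pi>\<^sub>1 + \<nu>\<^sub>1"
  shows "g2_torsion M7 (warped_star f \<omega> \<psi>\<^sub>p \<psi>\<^sub>m) \<phi> \<tau>\<^sub>0 \<tau>\<^sub>1 \<tau>\<^sub>2 \<tau>\<^sub>3 \<longleftrightarrow>
    (\<forall>x\<in>mf_points M7. \<tau>\<^sub>0 x = 12/7 * (\<alpha> * \<pi>\<^sub>0 (fst x) - \<beta> * \<sigma>\<^sub>0 (fst x))) \<and>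
    \<tau>\<^sub>1 \<doteq>\<^bsub>M7\<^esub>
      (\<lambda>x. 1/2 * (\<alpha> * \<sigma>\<^sub>0 (fst x) + \<beta> * \<pi>\<^sub>0 (fst x)) * f (fst x)) \<cdot>\<^sub>f ds
      + pull1 ((1/6) *\<^sub>f \<eta>\<^sub>1) \<and>
    \<tau>\<^sub>2 \<doteq>\<^bsub>M7\<^esub>
      pull1 (- (\<alpha> *\<^sub>f \<sigma>\<^sub>2) - \<beta> *\<^sub>f \<pi>\<^sub>2)
      + pull1 ((\<lambda>p. f p / 3) \<cdot>\<^sub>f star6 (\<eta>\<^sub>2 \<and>\<^sub>f \<omega> \<and>\<^sub>f \<omega>)) \<and>\<^sub>f ds
      - pull1 ((1/3) *\<^sub>f star6 (\<eta>\<^sub>2 \<and>\<^sub>f (\<alpha> *\<^sub>f \<psi>\<^sub>m + \<beta> *\<^sub>f \<psi>\<^sub>p))) \<and>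
    \<tau>\<^sub>3 \<doteq>\<^bsub>M7\<^esub>
      pull1 ((\<lambda>p. 2/7 * (\<alpha> * \<pi>\<^sub>0 p - \<beta> * \<sigma>\<^sub>0 p) * f p) \<cdot>\<^sub>f \<omega>
             - (\<lambda>p. f p / 2) \<cdot>\<^sub>f star6 (\<eta>\<^sub>3 \<and>\<^sub>f (\<alpha> *\<^sub>f \<psi>\<^sub>p - \<beta> *\<^sub>f \<psi>\<^sub>m))
             + f \<cdot>\<^sub>f (\<alpha> *\<^sub>f \<pi>\<^sub>2 - \<beta> *\<^sub>f \<sigma>\<^sub>2)) \<and>\<^sub>f ds
      - pull1 ((1/2) *\<^sub>f star6 (\<eta>\<^sub>3 \<and>\<^sub>f \<omega>))
      - pull1 ((\<lambda>p. 3/14 * (\<alpha> * \<pi>\<^sub>0 p - \<beta> * \<sigma>\<^sub>0 p)) \<cdot>\<^sub>f (\<alpha> *\<^sub>f \<psi>\<^sub>p - \<beta> *\<^sub>f \<psi>\<^sub>m))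
      - pull1 (star6 \<nu>\<^sub>3)"
proof -
  interpret W: warped M \<omega> \<psi>\<^sub>p \<psi>\<^sub>m \<pi>\<^sub>1 \<nu>\<^sub>1 \<pi>\<^sub>2 \<sigma>\<^sub>2 \<nu>\<^sub>3 \<pi>\<^sub>0 \<sigma>\<^sub>0 f \<alpha> \<beta>
    by unfold_locales (rule assms)+
  show ?thesis
    unfolding assms(7-12)
    using W.g2_torsion_iff[of \<tau>\<^sub>0 \<tau>\<^sub>1 \<tau>\<^sub>2 \<tau>\<^sub>3]
    unfolding W.\<phi>_def W.T\<^sub>0_def W.T\<^sub>1_def W.T\<^sub>2_def W.T\<^sub>3_def W.\<theta>_def .
qed

end
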